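(* Let $p=6$ and $\alpha<0$. Then $$\mathcal{F}(\mu)=\begin{cases}-c & \text{if } 0<\mu<\frac{\sqrt3\,\pi}{4},\\ -\infty & \text{if }\mu\geq\frac{\sqrt3\,\pi}{4},\end{cases}$$ with $c=c(\mu)>0$ a finite constant (depending on $\mu$). Furthermore, if $0<\mu<\frac{\sqrt3\,\pi}{4}$, then ground states of $F$ at mass $\mu$ exist and (the positive one) coincides with the only positive bound state of mass $\mu$.
   Context: Let $\mathbb{R}^+=(0,+\infty)$. For $p\in(2,6]$ and $\alpha\in\mathbb{R}$, the energy is $$F(u)=\frac12\int_0^{+\infty}|u'|^2\,dx-\frac1p\int_0^{+\infty}|u|^p\,dx+\frac{\alpha}{2}|u(0)|^2,\qquad u\in H^1(\mathbb{R}^+),$$ where $u(0)$ is the value at $0$ of the continuous representative of $u$. For $\mu>0$, $H^1_\mu(\mathbb{R}^+):=\{u\in H^1(\mathbb{R}^+):\int_0^{+\infty}|u|^2\,dx=\mu\}$ and $\mathcal{F}(\mu):=\inf_{u\in H^1_\mu(\mathbb{R}^+)}F(u)$. A ground state of $F$ at mass $\mu$ is a function $u\in H^1_\mu(\mathbb{R}^+)$ with $F(u)=\mathcal{F}(\mu)$. Minimization is carried out among real-valued and positive functions (this is not restrictive, since ground states are positive up to a constant phase). A bound state is a real-valued $u\in H^1(\mathbb{R}^+)$ which, for some $\omega>0$, solves $$-u''-|u|^{p-2}u+\omega u=0\ \text{ on }\mathbb{R}^+,\qquad u'(0)=\alpha u(0);$$ its mass is $\int_0^{+\infty}|u|^2\,dx$.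 *)

theory Defs
  imports "HOL-Analysis.Analysis"
begin

text \<open>Functions on the half-line are total functions on the reals whose values at negative
  arguments are irrelevant.\<close>

definition smooth :: "(real \<Rightarrow> real) \<Rightarrow> bool" where
  "smooth \<phi> \<longleftrightarrow> (\<forall>n x. ((deriv ^^ n) \<phi>) differentiable (at x))"

text \<open>Test functions of the open half-line: smooth, with compact support in \<open>{0<..}\<close>.\<close>

definition test_function :: "(real \<Rightarrow> real) \<Rightarrow> bool" where
  "test_function \<phi> \<longleftrightarrow> smooth \<phi> \<and> (\<exists>a b. 0 < a \<and> a \<le> b \<and> (\<forall>x. x \<notin> {a..b} \<longrightarrow> \<phi> x = 0))"

definition locally_integrable :: "(real \<Rightarrow> real) \<Rightarrow> bool" where
  "locally_integrable u \<longleftrightarrow> (\<forall>a b. 0 < a \<and> a \<le> b \<longrightarrow> set_integrable lborel {a..b} u)"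

definition has_weak_deriv :: "(real \<Rightarrow> real) \<Rightarrow> (real \<Rightarrow> real) \<Rightarrow> bool" where
  "has_weak_deriv u v \<longleftrightarrow> locally_integrable u \<and> locally_integrable v \<and>
     (\<forall>\<phi>. test_function \<phi> \<longrightarrow>
        (LBINT x:{0<..}. u x * deriv \<phi> x) = - (LBINT x:{0<..}. v x * \<phi> x))"

text \<open>A weak derivative is unique up to a null set, so integrals involving it do not depend on
  the choice made here.\<close>

definition weak_deriv :: "(real \<Rightarrow> real) \<Rightarrow> real \<Rightarrow> real" where
  "weak_deriv u = (SOME v. has_weak_deriv u v)"

definition square_integrable :: "(real \<Rightarrow> real) \<Rightarrow> bool" where
  "square_integrable u \<longleftrightarrow>
     set_borel_measurable lborel {0<..} u \<and> set_integrable lborel {0<..} (\<lambda>x. (u x)\<^sup>2)"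

text \<open>The real Sobolev space \<open>H\<^sup>1\<close> of the half-line. Every almost-everywhere class has exactly one
  representative that is continuous on \<open>{0..}\<close>; classes are identified with it, so that \<open>u 0\<close> is
  the boundary value, and two elements are equal iff they agree on \<open>{0..}\<close>.\<close>

definition H1 :: "(real \<Rightarrow> real) set" where
  "H1 = {u. continuous_on {0..} u \<and> square_integrable u \<and>
            (\<exists>v. square_integrable v \<and> has_weak_deriv u v)}"

definition mass :: "(real \<Rightarrow> real) \<Rightarrow> real" where
  "mass u = (LBINT x:{0<..}. \<bar>u x\<bar>\<^sup>2)"

definition H1_mass :: "real \<Rightarrow> (real \<Rightarrow> real) set" where
  "H1_mass \<mu> = {u \<in> H1. mass u = \<mu>}"

definition energy :: "real \<Rightarrow> real \<Rightarrow> (real \<Rightarrow> real) \<Rightarrow> real" where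
  "energy p \<alpha> u = 1 / 2 * (LBINT x:{0<..}. \<bar>weak_deriv u x\<bar>\<^sup>2)
     - 1 / p * (LBINT x:{0<..}. \<bar>u x\<bar> powr p) + \<alpha> / 2 * \<bar>u 0\<bar>\<^sup>2"

definition energy_inf :: "real \<Rightarrow> real \<Rightarrow> real \<Rightarrow> ereal" where
  "energy_inf p \<alpha> \<mu> = (INF u\<in>H1_mass \<mu>. ereal (energy p \<alpha> u))"

definition ground_state :: "real \<Rightarrow> real \<Rightarrow> real \<Rightarrow> (real \<Rightarrow> real) \<Rightarrow> bool" where
  "ground_state p \<alpha> \<mu> u \<longleftrightarrow> u \<in> H1_mass \<mu> \<and> ereal (energy p \<alpha> u) = energy_inf p \<alpha> \<mu>"

text \<open>Solutions are classical, with \<open>u1\<close> and \<open>u2\<close> the first and second derivative; the derivative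
  at \<open>0\<close> is one-sided.\<close>

definition bound_state :: "real \<Rightarrow> real \<Rightarrow> (real \<Rightarrow> real) \<Rightarrow> bool" where
  "bound_state p \<alpha> u \<longleftrightarrow> u \<in> H1 \<and>
     (\<exists>\<omega>>0. \<exists>u1 u2.
        (\<forall>x\<ge>0. (u has_real_derivative u1 x) (at x within {0..})) \<and>
        (\<forall>x>0. (u1 has_real_derivative u2 x) (at x)) \<and>
        (\<forall>x>0. - u2 x - \<bar>u x\<bar> powr (p - 2) * u x + \<omega> * u x = 0) \<and>
        u1 0 = \<alpha> * u 0)"

definition positive_on_half_line :: "(real \<Rightarrow> real) \<Rightarrow> bool" where
  "positive_on_half_line u \<longleftrightarrow> (\<forall>x>0. u x > 0)"

end

theory Submission
  imports Defs
begin

text \<open>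
  Put \<open>\<kappa> = 2 / \<surd>3\<close> and \<open>\<theta> x = \<kappa> \<integral>\<^sub>x\<^sup>\<infinity> u\<^sup>2\<close>. In the mass coordinate \<open>\<theta>\<close> the critical energy is a quadratic
  functional of \<open>u\<^sup>2\<close>, and completing the square gives the calibration
  \<open>F u = 1/2 \<integral> (u' + \<kappa>/2 cot \<theta> u\<^sup>3)\<^sup>2 + \<kappa>/8 cot (\<kappa> \<mu>) u(0)\<^sup>4 + \<alpha>/2 u(0)\<^sup>2\<close>.
  If \<open>\<kappa> \<mu> < \<pi>/2\<close>, that is \<open>\<mu> < \<surd>3 \<pi> / 4\<close>, the cotangent is positive and the boundary terms are
  minimised by exactly one value of \<open>u(0)\<^sup>2\<close>; equality in the square is the first-order equation
  \<open>u' = - \<kappa>/2 cot \<theta> u\<^sup>3\<close>, whose positive solutions are the translated solitons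
  \<open>\<surd>(A / cosh (\<kappa> A x + b))\<close>. For a positive bound state, \<open>u'/u\<close> solves a Riccati equation, which leads to
  the same solitons; the boundary condition and the mass fix \<open>A\<close> and \<open>b\<close>. At and above the critical mass,
  multiples of half solitons with \<open>A \<rightarrow> \<infinity>\<close> have energy tending to \<open>- \<infinity>\<close>.
\<close>

section \<open>Smooth cutoff functions\<close>

text \<open>The cotangent comes from a Jacobi equation. View w = u^2 as a function of \<theta>.
  Since d\<theta> = - kappa w dx, the integral of u'^2 is kappa/4 times that of (dw/d\<theta>)^2,
  and the integral of u^6 is 1/kappa times that of w^2. For kappa^2 = 4/3 the energy without its
  boundary term is kappa/8 times the integral of (dw/d\<theta>)^2 - w^2. Its extremals A sin
  \<theta> vanish at \<theta> = 0, that is at x = infinity, and cot \<theta> is their logarithmic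
  derivative. This change of variables is only the motivation, since u may have zeros; the completed
  square is verified in x. Its explicit remainder yields existence, the minimal value and uniqueness
  at once, in place of a compactness argument. Two obstacles shape the rest. The derivative of an H1
  function is known only through test functions, so it must be recovered as a density of u before
  products such as cot(\<theta>) u^4 can be differentiated. And the cotangent is singular at
  infinity, where u has no known rate of decay.\<close>

lemma smooth_coinduct:
  assumes "P f" and step: "\<And>g. P g \<Longrightarrow> (\<forall>x. g differentiable (at x)) \<and> P (deriv g)"
  shows "smooth f"
proof -
  \<comment> \<open>The iterated derivatives never need a closed form: every iterate of
    \<open>f\<close> stays in the class \<open>P\<close>, and all members of \<open>P\<close> are
    differentiable.\<close>
  have "P ((deriv ^^ n) f)" for n
    by (induction n) (use assms in auto)
  then show ?thesis
    using step unfolding smooth_def by blast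
qed

lemma smooth_differentiable: "smooth f \<Longrightarrow> f differentiable (at x)"
  unfolding smooth_def by (metis funpow_0)

lemma smooth_DERIV: "smooth f \<Longrightarrow> (f has_real_derivative deriv f x) (at x)"
  by (simp add: smooth_differentiable DERIV_deriv_iff_real_differentiable)

lemma smooth_deriv: "smooth f \<Longrightarrow> smooth (deriv f)"
  unfolding smooth_def by (metis funpow_Suc_right comp_apply)

lemma smoothI_deriv:
  assumes "\<And>x. (f has_real_derivative f' x) (at x)" and "smooth f'"
  shows "smooth f"
proof (rule smooth_coinduct[where P = "\<lambda>g. g = f \<or> smooth g"])
  have "deriv f = f'"
    using assms(1) DERIV_imp_deriv by blast
  then show "(\<forall>x. g differentiable (at x)) \<and> (deriv g = f \<or> smooth (deriv g))" if "g = f \<or> smooth g" for g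
    using that assms smooth_differentiable smooth_deriv real_differentiable_def by blast
qed simp

lemma smooth_diff:
  assumes "smooth f" "smooth g"
  shows "smooth (\<lambda>x. f x - g x)"
proof (rule smooth_coinduct[where P = "\<lambda>h. \<exists>f g. smooth f \<and> smooth g \<and> h = (\<lambda>x. f x - g x)"])
  fix h assume "\<exists>f g. smooth f \<and> smooth g \<and> h = (\<lambda>x. f x - g x)"
  then obtain f g where fg: "smooth f" "smooth g" and h: "h = (\<lambda>x. f x - g x)" by blast
  have D: "(h has_real_derivative deriv f x - deriv g x) (at x)" for x
    unfolding h by (intro DERIV_diff smooth_DERIV fg)
  then have "deriv h = (\<lambda>x. deriv f x - deriv g x)"
    using DERIV_imp_deriv by blast
  with D fg show "(\<forall>x. h differentiable (at x)) \<and>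
      (\<exists>f g. smooth f \<and> smooth g \<and> deriv h = (\<lambda>x. f x - g x))"
    using smooth_deriv real_differentiable_def by blast
qed (use assms in blast)

lemma smooth_affine:
  assumes "smooth f"
  shows "smooth (\<lambda>x. c * f (m * x + d))"
proof (rule smooth_coinduct[where P = "\<lambda>h. \<exists>f c. smooth f \<and> h = (\<lambda>x. c * f (m * x + d))"])
  fix h assume "\<exists>f c. smooth f \<and> h = (\<lambda>x. c * f (m * x + d))"
  then obtain f c where f: "smooth f" and h: "h = (\<lambda>x. c * f (m * x + d))" by blast
  have D: "(h has_real_derivative (c * m) * deriv f (m * x + d)) (at x)" for x
    unfolding h by (rule derivative_eq_intros DERIV_chain2[OF smooth_DERIV[OF f]] refl)+ simp
  then have "deriv h = (\<lambda>x. (c * m) * deriv f (m * x + d))"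
    using DERIV_imp_deriv by blast
  with D f show "(\<forall>x. h differentiable (at x)) \<and>
      (\<exists>f c. smooth f \<and> deriv h = (\<lambda>x. c * f (m * x + d)))"
    using smooth_deriv real_differentiable_def by blast
qed (use assms in blast)

section \<open>The bump exp(-1/(x(1-x))) on the unit interval and its derivatives\<close>

lemma DERIV_zero_of_quadratic_bound:
  fixes f :: "real \<Rightarrow> real"
  assumes "\<And>x. \<bar>f x\<bar> \<le> M * (x - c)\<^sup>2"
  shows "(f has_real_derivative 0) (at c)"
proof -
  have f0: "f c = 0" using assms[of c] by simp
  have "((\<lambda>h. f (c + h) / h) \<longlongrightarrow> 0) (at 0)"
  proof (rule Lim_null_comparison)
    show "\<forall>\<^sub>F h in at 0. norm (f (c + h) / h) \<le> M * \<bar>h\<bar>"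
    proof (rule eventually_at_filter[THEN iffD2], rule always_eventually, intro allI impI)
      fix h :: real assume "h \<noteq> 0"
      then have "\<bar>h\<bar> > 0" by simp
      moreover have "\<bar>f (c + h)\<bar> \<le> M * \<bar>h\<bar> * \<bar>h\<bar>"
        using assms[of "c + h"] by (simp add: power2_eq_square)
      ultimately show "norm (f (c + h) / h) \<le> M * \<bar>h\<bar>"
        by (simp add: divide_le_eq)
    qed
    show "((\<lambda>h. M * \<bar>h\<bar>) \<longlongrightarrow> 0) (at 0)"
      by (auto intro!: tendsto_eq_intros)
  qed
  then show ?thesis by (simp add: DERIV_def f0)
qed

text \<open>The successive derivatives of exp(-1/(x(1-x))), extended by zero, all have this shape.
  With numerator and exponent as parameters the family is closed under differentiation, as
  \<open>smooth_coinduct\<close> requires; the bump itself is \<open>bump_term 1 0\<close>.\<close>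

definition bump_term :: "real poly \<Rightarrow> nat \<Rightarrow> real \<Rightarrow> real" where
  "bump_term p n x = (if 0 < x \<and> x < 1
     then poly p x / (x * (1 - x)) ^ n * exp (- 1 / (x * (1 - x))) else 0)"

lemma power_div_fact_le_exp:
  fixes t :: real
  assumes "t \<ge> 0"
  shows "t ^ m / fact m \<le> exp t"
proof -
  have "(\<Sum>n\<in>{m}. t ^ n /\<^sub>R fact n) \<le> (\<Sum>n. t ^ n /\<^sub>R fact n)"
    by (rule sum_le_suminf[OF summable_exp_generic]) (use assms in auto)
  then show ?thesis
    by (simp add: exp_def divide_inverse mult.commute)
qed

text \<open>With q = x(1-x), the term of order n+2 in the series of exp(1/q) bounds exp(-1/q) by
  (n+2)! q^(n+2). The factor q^n absorbs the pole; the remaining q^2 is at most x^2 and at most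
  (x-1)^2, which yields differentiability at both endpoints.\<close>

lemma bump_term_bound:
  obtains M where "\<And>x. \<bar>bump_term p n x\<bar> \<le> M * x\<^sup>2" "\<And>x. \<bar>bump_term p n x\<bar> \<le> M * (x - 1)\<^sup>2"
proof -
  have "bounded (poly p ` {0..1})"
    by (intro compact_imp_bounded compact_continuous_image continuous_intros) auto
  then obtain B where B: "\<And>x. x \<in> {0..1} \<Longrightarrow> \<bar>poly p x\<bar> \<le> B"
    unfolding bounded_iff by (metis imageI real_norm_def)
  have B0: "B \<ge> 0" using B[of 0] by auto
  define M where "M = B * fact (n + 2)"
  have M0: "M \<ge> 0" unfolding M_def using B0 by simp
  have key: "\<bar>bump_term p n x\<bar> \<le> M * (x * (1 - x))\<^sup>2" if "0 < x" "x < 1" for x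
  proof -
    define q where "q = x * (1 - x)"
    have q: "q > 0" unfolding q_def using that by simp
    have "(1 / q) ^ (n + 2) / fact (n + 2) \<le> exp (1 / q)"
      using q by (intro power_div_fact_le_exp) simp
    then have "1 \<le> fact (n + 2) * q ^ (n + 2) * exp (1 / q)"
    proof -
      have "1 / (Q * N) \<le> E \<Longrightarrow> 1 \<le> N * Q * E" if "Q > 0" "N > 0" for Q N E :: real
        using that by (simp add: divide_le_eq mult_ac)
      from this[of "q ^ (n + 2)" "fact (n + 2)" "exp (1 / q)"] show ?thesis
        using q \<open>(1 / q) ^ (n + 2) / fact (n + 2) \<le> exp (1 / q)\<close>
        by (simp only: power_one_over divide_divide_eq_left zero_less_power fact_gt_zero)
    qed
    then have "exp (- 1 / q) \<le> fact (n + 2) * q ^ (n + 2)"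
      by (simp add: exp_minus field_simps)
    then have "1 / q ^ n * exp (- 1 / q) \<le> 1 / q ^ n * (fact (n + 2) * q ^ (n + 2))"
      using q by (intro mult_left_mono) auto
    also have "\<dots> = fact (n + 2) * q\<^sup>2"
      using q by (simp add: power_add power2_eq_square)
    finally have 1: "1 / q ^ n * exp (- 1 / q) \<le> fact (n + 2) * q\<^sup>2" .
    have "\<bar>bump_term p n x\<bar> = \<bar>poly p x\<bar> * (1 / q ^ n * exp (- 1 / q))"
      using that q by (simp add: bump_term_def abs_mult flip: q_def)
    also have "\<dots> \<le> B * (fact (n + 2) * q\<^sup>2)"
      using that q B0 by (intro mult_mono 1 B) auto
    finally show ?thesis by (simp add: M_def q_def mult.assoc)
  qed
  have "\<bar>bump_term p n x\<bar> \<le> M * x\<^sup>2 \<and> \<bar>bump_term p n x\<bar> \<le> M * (x - 1)\<^sup>2" for x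
  proof (cases "0 < x \<and> x < 1")
    case True
    then have 1: "(x * (1 - x))\<^sup>2 \<le> x\<^sup>2" 
      by (intro power_mono) (auto simp: mult_le_cancel_left1)
    have "(x * (1 - x))\<^sup>2 \<le> (1 - x)\<^sup>2" using True
      by (intro power_mono) (auto simp: mult_le_cancel_right1)
    then have "(x * (1 - x))\<^sup>2 \<le> (x - 1)\<^sup>2"
      by (simp add: power2_commute)
    with 1 key[of x] True M0 show ?thesis
      by (meson mult_left_mono order_trans)
  qed (use M0 in \<open>auto simp: bump_term_def\<close>)
  with that show thesis by blast
qed

text \<open>Quotient rule with q = x(1-x): \<open>[:0, 1, -1:]\<close> is q and
  \<open>[:1, -2:]\<close> is q'. The exponential contributes the factor q'/q^2, which is why the
  exponent grows by 2 and the other two terms carry q^2 and q.\<close>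

lemma bump_term_DERIV:
  "(bump_term p n has_real_derivative
     bump_term (pderiv p * [:0, 1, -1:] ^ 2 - smult (of_nat n) (p * [:1, -2:] * [:0, 1, -1:]) + p * [:1, -2:])
       (n + 2) x) (at x)" (is "(_ has_real_derivative bump_term ?p' _ x) _")
proof -
  have pq: "poly ?p' x = poly (pderiv p) x * (x * (1 - x))\<^sup>2
      - real n * (poly p x * (1 - 2 * x) * (x * (1 - x))) + poly p x * (1 - 2 * x)" for x
    by (simp add: algebra_simps power2_eq_square)
  consider "x = 0" | "x = 1" | "x < 0 \<or> x > 1" | "0 < x" "x < 1" by linarith
  then show ?thesis
  proof cases
    case 1
    \<comment> \<open>At the gluing points 0 and 1 the quotient rule does not apply. The quadratic
      bound forces the derivative 0, which is also the value there of the new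
      \<open>bump_term\<close>.\<close>
    obtain M where "\<And>x. \<bar>bump_term p n x\<bar> \<le> M * (x - 0)\<^sup>2"
      using bump_term_bound by (metis diff_zero)
    then show ?thesis
      using DERIV_zero_of_quadratic_bound 1 by (metis bump_term_def less_irrefl)
  next
    case 2
    obtain M where "\<And>x. \<bar>bump_term p n x\<bar> \<le> M * (x - 1)\<^sup>2"
      using bump_term_bound by metis
    then show ?thesis
      using DERIV_zero_of_quadratic_bound 2 by (metis bump_term_def less_irrefl)
  next
    case 3
    have "open ({..<0} \<union> {1<..} :: real set)" by auto
    moreover have D: "((\<lambda>_. 0) has_real_derivative bump_term ?p' (n + 2) x) (at x)"
      using 3 by (auto simp: bump_term_def)
    ultimately show ?thesis
      by (intro has_field_derivative_transform_within_open[OF D, of "{..<0} \<union> {1<..}"])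
        (use 3 in \<open>auto simp: bump_term_def\<close>)
  next
    case 4
    define q where "q = x * (1 - x)"
    have q: "q > 0" unfolding q_def using 4 by simp
    have DQ: "((\<lambda>x. x * (1 - x)) has_real_derivative 1 - 2 * x) (at x)"
      by (auto intro!: derivative_eq_intros)
    have G: "((\<lambda>x. P x / Q x ^ n * exp (- 1 / Q x)) has_real_derivative
       ((P' * Q x ^ n - P x * (real n * Q x ^ (n - 1) * Q')) / (Q x ^ n * Q x ^ n)
          * exp (- 1 / Q x) + P x / Q x ^ n * (exp (- 1 / Q x) * (Q' / (Q x * Q x))))) (at x)"
      if "(P has_real_derivative P') (at x)" "(Q has_real_derivative Q') (at x)" "Q x > 0" for P Q P' Q'
      using that by (auto intro!: derivative_eq_intros simp: field_simps)
    have "((\<lambda>x. poly p x / (x * (1 - x)) ^ n * exp (- 1 / (x * (1 - x)))) has_real_derivative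
       ((poly (pderiv p) x * q ^ n - poly p x * (real n * q ^ (n - 1) * (1 - 2 * x))) / (q ^ n * q ^ n)
          * exp (- 1 / q) + poly p x / q ^ n * (exp (- 1 / q) * ((1 - 2 * x) / (q * q))))) (at x)"
      using G[OF poly_DERIV DQ] q unfolding q_def by blast
    also have "((poly (pderiv p) x * q ^ n - poly p x * (real n * q ^ (n - 1) * (1 - 2 * x))) / (q ^ n * q ^ n)
          * exp (- 1 / q) + poly p x / q ^ n * (exp (- 1 / q) * ((1 - 2 * x) / (q * q))))
        = bump_term ?p' (n + 2) x"
    proof -
      have e: "real n * q ^ (n - 1) = real n * (q ^ n / q)"
        using q by (cases n) auto
      have "bump_term ?p' (n + 2) x = (poly (pderiv p) x * q\<^sup>2
          - real n * (poly p x * (1 - 2 * x) * q) + poly p x * (1 - 2 * x)) / q ^ (n + 2) * exp (- 1 / q)"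
        using 4 unfolding bump_term_def pq by (simp flip: q_def)
      moreover have "(P' * r - P * (N * (r / q) * Q')) / (r * r) * E + P / r * (E * (Q' / (q * q)))
          = (P' * q\<^sup>2 - N * (P * Q' * q) + P * Q') / (r * q\<^sup>2) * E"
        if "r > 0" for P P' Q' N E r :: real
        using that q by (simp add: divide_simps power2_eq_square) (simp add: algebra_simps)
      from this[of "q ^ n"] have "(poly (pderiv p) x * q ^ n - poly p x * (real n * (q ^ n / q) * (1 - 2 * x)))
          / (q ^ n * q ^ n) * exp (- 1 / q) + poly p x / q ^ n * (exp (- 1 / q) * ((1 - 2 * x) / (q * q)))
          = (poly (pderiv p) x * q\<^sup>2 - real n * (poly p x * (1 - 2 * x) * q)
             + poly p x * (1 - 2 * x)) / (q ^ n * q\<^sup>2) * exp (- 1 / q)"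
        using q by simp
      ultimately show ?thesis
        unfolding e by (simp only: power_add)
    qed
    finally have D: "((\<lambda>x. poly p x / (x * (1 - x)) ^ n * exp (- 1 / (x * (1 - x)))) has_real_derivative
       bump_term ?p' (n + 2) x) (at x)" .
    show ?thesis
      by (rule has_field_derivative_transform_within_open[OF D, of "{0<..<1}"]) (use 4 in \<open>auto simp: bump_term_def\<close>)
  qed
qed

lemma smooth_bump_term: "smooth (bump_term p n)"
proof (rule smooth_coinduct[where P = "\<lambda>f. \<exists>p n. f = bump_term p n"])
  fix g assume "\<exists>p n. g = bump_term p n"
  then obtain p n where g: "g = bump_term p n" by blast
  show "(\<forall>x. g differentiable (at x)) \<and> (\<exists>p n. deriv g = bump_term p n)"
    unfolding g using bump_term_DERIV real_differentiable_def DERIV_imp_deriv by (metis ext)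
qed auto

text \<open>\<open>h\<close> is the bump divided by its integral and \<open>H\<close> the primitive
  of \<open>h\<close> that vanishes at 0. Both are kept: \<open>H\<close> builds smoothed indicator
  functions, and \<open>h\<close> is the mollifier that appears when they are
  differentiated.\<close>

lemma smooth_step_exists:
  obtains H h :: "real \<Rightarrow> real" where "smooth H" "\<And>x. (H has_real_derivative h x) (at x)"
    "\<And>x. h x \<ge> 0" "\<And>x. x \<notin> {0..1} \<Longrightarrow> h x = 0" "continuous_on UNIV h"
    "\<And>x. x \<le> 0 \<Longrightarrow> H x = 0" "\<And>x. x \<ge> 1 \<Longrightarrow> H x = 1" "\<And>x. 0 \<le> H x" "\<And>x. H x \<le> 1"
proof -
  define r where "r = bump_term 1 0"
  have sm: "smooth r" unfolding r_def by (rule smooth_bump_term)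
  have cont: "isCont r x" for x
    using smooth_DERIV[OF sm] DERIV_isCont by blast
  have r0: "r x \<ge> 0" for x by (simp add: r_def bump_term_def)
  have rpos: "r x > 0" if "0 < x" "x < 1" for x using that by (simp add: r_def bump_term_def)
  have rout: "r x = 0" if "x \<notin> {0<..<1}" for x using that by (auto simp: r_def bump_term_def)
  have "\<exists>F. \<forall>x::real. -\<infinity> < ereal x \<longrightarrow> ereal x < \<infinity> \<longrightarrow> (F has_vector_derivative r x) (at x)"
    by (rule einterval_antiderivative) (auto intro: cont)
  then obtain F where F: "\<And>x. (F has_real_derivative r x) (at x)"
    by (auto simp: has_real_derivative_iff_has_vector_derivative)
  have mono: "F x \<le> F y" if "x \<le> y" for x y
    using DERIV_nonneg_imp_nondecreasing[OF that] F r0 by blast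
  have "F 0 < F 1"
    by (rule DERIV_pos_imp_increasing_open) (use F rpos in \<open>auto intro!: DERIV_continuous_on continuous_at_imp_continuous_on intro: DERIV_isCont\<close>)
  define c where "c = F 1 - F 0"
  have c: "c > 0" using \<open>F 0 < F 1\<close> by (simp add: c_def)
  have lo: "F x = F 0" if "x \<le> 0" for x
  proof -
    have "F 0 \<le> F x"
      by (rule DERIV_nonpos_imp_nonincreasing[OF that]) (use F rout in force)
    then show ?thesis using mono[OF that] by simp
  qed
  have hi: "F x = F 1" if "x \<ge> 1" for x
  proof -
    have "F x \<le> F 1"
      by (rule DERIV_nonpos_imp_nonincreasing[OF that]) (use F rout in force)
    then show ?thesis using mono[OF that] by simp
  qed
  define H where "H = (\<lambda>x. (F x - F 0) / c)"
  have DH: "(H has_real_derivative r x / c) (at x)" for x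
    unfolding H_def using c by (auto intro!: derivative_eq_intros F)
  have smH: "smooth H"
    by (rule smoothI_deriv[OF DH]) (use smooth_affine[OF sm, of "1/c" 1 0] in simp)
  have lohi: "F 0 \<le> F x" "F x \<le> F 1" for x
    using mono[of 0 x] mono[of x 1] lo[of x] hi[of x] \<open>F 0 < F 1\<close> by linarith+
  have "continuous_on UNIV (\<lambda>x. r x / c)"
    using c by (intro continuous_on_divide continuous_on_const continuous_at_imp_continuous_on ballI cont) simp
  moreover have "H x = 1" if "x \<ge> 1" for x
    using hi[OF that] c by (simp add: H_def c_def)
  moreover have "H x = 0" if "x \<le> 0" for x
    using lo[OF that] by (simp add: H_def)
  moreover have "0 \<le> H x" "H x \<le> 1" for x
    using lohi[of x] c by (simp_all add: H_def c_def)
  moreover have "0 \<le> r x / c" for x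
    using r0[of x] c by simp
  moreover have "r x / c = 0" if "x \<notin> {0..1}" for x
    using that by (subst rout) auto
  ultimately show thesis
    using that[OF smH DH] by blast
qed

section \<open>Weak derivatives\<close>

text \<open>The substitution x = c + y/(n+1) turns the kernel into the fixed function
  \<open>h\<close> and moves the scaling into \<open>U\<close>, so dominated convergence and
  continuity at c finish. The kernel lives to the right of c within distance 1, hence the bound on
  \<open>{c..c + 1}\<close>.\<close>

lemma mollifier_tendsto:
  fixes U h :: "real \<Rightarrow> real"
  assumes U [measurable]: "U \<in> borel_measurable borel" and "isCont U c"
    and M: "\<And>x. x \<in> {c..c + 1} \<Longrightarrow> \<bar>U x\<bar> \<le> M"
    and h: "integrable lborel h" "\<And>x. x \<notin> {0..1} \<Longrightarrow> h x = 0"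
  shows "integrable lborel (\<lambda>x. U x * (real (Suc n) * h (real (Suc n) * x + - real (Suc n) * c)))" (is "?P n")
    and "(\<lambda>n. LBINT x. U x * (real (Suc n) * h (real (Suc n) * x + - real (Suc n) * c)))
      \<longlonglongrightarrow> U c * (LBINT x. h x)" (is ?Q)
proof -
  have [measurable]: "h \<in> borel_measurable borel" using h(1) by auto
  define g where "g = (\<lambda>n y. U (c + (1 / real (Suc n)) * y) * h y)"
  have bound: "norm (g n y) \<le> M * norm (h y)" for n y
  proof (cases "y \<in> {0..1}")
    case True
    then have "c + (1 / real (Suc n)) * y \<in> {c..c + 1}" by (auto simp: divide_simps) (auto simp: algebra_simps)
    from M[OF this] show ?thesis by (simp add: g_def abs_mult mult_right_mono)
  qed (use h in \<open>auto simp: g_def\<close>)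
  have int_w: "integrable lborel (\<lambda>y. M * norm (h y))"
    using h(1) by auto
  have gm [measurable]: "g n \<in> borel_measurable borel" for n
    unfolding g_def by measurable
  have int_g: "integrable lborel (g n)" for n
    by (rule Bochner_Integration.integrable_bound[OF int_w]) (use bound in \<open>auto intro: order_trans[OF _ abs_ge_self]\<close>)
  have scale: "U (c + (1 / real (Suc n)) * y) * (real (Suc n) * h (real (Suc n) * (c + (1 / real (Suc n)) * y)
      + - real (Suc n) * c)) = real (Suc n) * g n y" for n y
  proof -
    have "real (Suc n) * (c + (1 / real (Suc n)) * y) + - real (Suc n) * c = y"
      by (simp add: field_simps del: of_nat_Suc)
    then show ?thesis unfolding g_def by simp
  qed
  show "?P n" for n
  proof (rule iffD1[OF lborel_integrable_real_affine_iff[of "1 / real (Suc n)" _ c]])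
    show "integrable lborel (\<lambda>y. U (c + (1 / real (Suc n)) * y) * (real (Suc n) * h (real (Suc n) *
        (c + (1 / real (Suc n)) * y) + - real (Suc n) * c)))"
      unfolding scale by (intro integrable_mult_right int_g)
  qed simp
  have "(LBINT x. U x * (real (Suc n) * h (real (Suc n) * x + - real (Suc n) * c))) = (LBINT y. g n y)" for n
    by (subst lborel_integral_real_affine[of "1 / real (Suc n)" _ c], simp)
       (simp only: scale, simp)
  moreover have "(\<lambda>n. LBINT y. g n y) \<longlonglongrightarrow> (LBINT y. U c * h y)"
  proof (rule integral_dominated_convergence[OF _ _ int_w])
    show "AE y in lborel. (\<lambda>n. g n y) \<longlonglongrightarrow> U c * h y"
    proof (rule AE_I2)
      fix y
      have "(\<lambda>n. c + (1 / real (Suc n)) * y) \<longlonglongrightarrow> c + 0 * y"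
        by (intro tendsto_intros LIMSEQ_Suc[OF lim_1_over_n])
      then have "(\<lambda>n. U (c + (1 / real (Suc n)) * y)) \<longlonglongrightarrow> U c"
        using isCont_tendsto_compose[OF \<open>isCont U c\<close>] by simp
      then show "(\<lambda>n. g n y) \<longlonglongrightarrow> U c * h y"
        unfolding g_def by (intro tendsto_intros)
    qed
  qed (use bound in auto)
  ultimately show ?Q by simp
qed

text \<open>The test functions are smoothed indicators of \<open>{a<..b}\<close>. On one side their
  derivatives are mollifiers at a and b and pick out u a - u b; on the other they converge pointwise
  to the indicator under an integrable bound.\<close>

lemma has_weak_deriv_increment:
  assumes weak: "has_weak_deriv u v" and cont: "continuous_on {0<..} u" and "0 < a" "a < b"
  shows "u b - u a = (LBINT x:{a<..b}. v x)"
proof -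
  obtain H h where Hh: "smooth H" "\<And>x. (H has_real_derivative h x) (at x)"
    "\<And>x. h x \<ge> 0" "\<And>x. x \<notin> {0..1} \<Longrightarrow> h x = 0" "continuous_on UNIV h"
    "\<And>x. x \<le> 0 \<Longrightarrow> H x = 0" "\<And>x. x \<ge> 1 \<Longrightarrow> H x = 1" "\<And>x. 0 \<le> H x" "\<And>x. H x \<le> 1"
    using smooth_step_exists by blast
  have h_ind: "h = (\<lambda>x. indicator {0..1} x *\<^sub>R h x)"
    using Hh(4) by (auto simp: indicator_def fun_eq_iff)
  have int_h: "integrable lborel h"
    by (subst h_ind) (intro borel_integrable_compact[OF compact_Icc continuous_on_subset[OF Hh(5)]], simp)
  have "(LBINT x. h x) = (\<integral>x. indicator {0..1} x *\<^sub>R h x \<partial>lborel)"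
    by (subst h_ind) simp
  also have "\<dots> = H 1 - H 0"
    by (intro integral_FTC_atLeastAtMost)
       (use Hh in \<open>auto intro: continuous_on_subset has_field_derivative_at_within simp flip: has_real_derivative_iff_has_vector_derivative\<close>)
  finally have h1: "(LBINT x. h x) = 1" using Hh(6,7) by simp
  define U where "U = (\<lambda>x. indicator {0<..} x *\<^sub>R u x)"
  have [measurable]: "U \<in> borel_measurable borel"
    unfolding U_def by (rule borel_measurable_continuous_on_indicator[OF _ cont]) simp
  have "continuous_on {0<..} U"
    by (rule continuous_on_eq[OF cont]) (simp add: U_def)
  then have contU: "isCont U c" if "c > 0" for c
    using that by (simp add: continuous_on_eq_continuous_at)
  have MU: "\<exists>M. \<forall>x\<in>{c..c + 1}. \<bar>U x\<bar> \<le> M" if "c > 0" for c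
  proof -
    have "bounded (U ` {c..c + 1})"
      using that by (intro compact_imp_bounded compact_continuous_image continuous_at_imp_continuous_on)
        (auto intro: contU)
    then show ?thesis unfolding bounded_iff by auto
  qed
  define N where "N = (\<lambda>n. real (Suc n))"
  have N: "N n \<ge> 1" for n by (simp add: N_def)
  have N_eq: "real (Suc n) = N n" for n by (simp add: N_def)
  \<comment> \<open>Both ramps rise to the right of their starting points a and b. Hence the support
    stays in [a, b+1], away from 0, and the pointwise limit is the indicator of the half-open
    interval at every point, endpoints included. The factors 1 match the shape in
    \<open>smooth_affine\<close>.\<close>
  define \<phi> where "\<phi> = (\<lambda>n x. 1 * H (N n * x + - N n * a) - 1 * H (N n * x + - N n * b))"
  have D: "((\<phi> n) has_real_derivative (N n * h (N n * x + - N n * a) - N n * h (N n * x + - N n * b))) (at x)" for n x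
    unfolding \<phi>_def by (rule derivative_eq_intros DERIV_chain2[OF Hh(2)] refl)+ simp
  have \<phi>_out: "\<phi> n x = 0" if "x \<notin> {a..b + 1}" for n x
  proof -
    consider "x \<le> a" | "x \<ge> b + 1" using \<open>x \<notin> {a..b + 1}\<close> by fastforce
    then show ?thesis
    proof cases
      case 1
      then have "N n * (x - a) \<le> 0" "N n * (x - b) \<le> 0" using N[of n] \<open>a < b\<close>
        by (auto simp: mult_le_0_iff)
      then show ?thesis using Hh(6) unfolding \<phi>_def by (simp add: algebra_simps)
    next
      case 2
      then have "N n * (x - b) \<ge> 1 * 1" "N n * (x - a) \<ge> 1 * 1" using N[of n] \<open>a < b\<close>
        by (intro mult_mono; simp)+
      then show ?thesis using Hh(7) unfolding \<phi>_def by (simp add: algebra_simps)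
    qed
  qed
  have test: "test_function (\<phi> n)" for n
    unfolding test_function_def
  proof
    show "smooth (\<phi> n)"
      unfolding \<phi>_def by (intro smooth_diff smooth_affine Hh)
    have "0 < a \<and> a \<le> b + 1 \<and> (\<forall>x. x \<notin> {a..b + 1} \<longrightarrow> \<phi> n x = 0)"
      using \<phi>_out \<open>0 < a\<close> \<open>a < b\<close> by auto
    then show "\<exists>a b. 0 < a \<and> a \<le> b \<and> (\<forall>x. x \<notin> {a..b} \<longrightarrow> \<phi> n x = 0)" by blast
  qed
  have eq: "(LBINT x:{0<..}. u x * deriv (\<phi> n) x) = - (LBINT x:{0<..}. v x * \<phi> n x)" for n
    using weak test unfolding has_weak_deriv_def by blast
  have lhs: "(\<lambda>n. LBINT x:{0<..}. u x * deriv (\<phi> n) x) \<longlonglongrightarrow> u a - u b"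
  proof -
    have b0: "0 < b" using \<open>0 < a\<close> \<open>a < b\<close> by simp
    obtain Ma where Ma: "\<And>x. x \<in> {a..a + 1} \<Longrightarrow> \<bar>U x\<bar> \<le> Ma" using MU[OF \<open>0 < a\<close>] by blast
    obtain Mb where Mb: "\<And>x. x \<in> {b..b + 1} \<Longrightarrow> \<bar>U x\<bar> \<le> Mb" using MU[OF b0] by blast
    note A = mollifier_tendsto[OF _ contU[OF \<open>0 < a\<close>] Ma int_h Hh(4), unfolded N_eq]
    note B = mollifier_tendsto[OF _ contU[OF b0] Mb int_h Hh(4), unfolded N_eq]
    have "(LBINT x:{0<..}. u x * deriv (\<phi> n) x) =
      (LBINT x. U x * (N n * h (N n * x + - N n * a))) - (LBINT x. U x * (N n * h (N n * x + - N n * b)))" for n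
    proof -
      have "(LBINT x:{0<..}. u x * deriv (\<phi> n) x) =
        (LBINT x. U x * (N n * h (N n * x + - N n * a)) - U x * (N n * h (N n * x + - N n * b)))"
        unfolding set_lebesgue_integral_def DERIV_imp_deriv[OF D] U_def
        by (intro Bochner_Integration.integral_cong refl) (simp add: right_diff_distrib)
      also have "\<dots> = (LBINT x. U x * (N n * h (N n * x + - N n * a)))
          - (LBINT x. U x * (N n * h (N n * x + - N n * b)))"
        by (rule Bochner_Integration.integral_diff[OF A(1) B(1)]) measurable
      finally show ?thesis .
    qed
    moreover have "(\<lambda>n. (LBINT x. U x * (N n * h (N n * x + - N n * a))) - (LBINT x. U x * (N n * h (N n * x + - N n * b))))
      \<longlonglongrightarrow> U a * (LBINT x. h x) - U b * (LBINT x. h x)"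
      by (intro tendsto_diff A(2) B(2)) auto
    moreover have "U a * (LBINT x. h x) - U b * (LBINT x. h x) = u a - u b"
      using h1 \<open>0 < a\<close> b0 by (simp add: U_def)
    ultimately show ?thesis by simp
  qed
  have rhs: "(\<lambda>n. LBINT x:{0<..}. v x * \<phi> n x) \<longlonglongrightarrow> (LBINT x:{a<..b}. v x)"
    unfolding set_lebesgue_integral_def
  proof (rule integral_dominated_convergence[where w = "\<lambda>x. norm (indicator {a..b + 1} x *\<^sub>R v x)"])
    have v: "set_integrable lborel {a..b + 1} v"
      using weak \<open>0 < a\<close> \<open>a < b\<close> unfolding has_weak_deriv_def locally_integrable_def by auto
    then show "integrable lborel (\<lambda>x. norm (indicator {a..b + 1} x *\<^sub>R v x))"
      unfolding set_integrable_def by (rule integrable_norm)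
    have vm: "(\<lambda>x. indicator {a..b + 1} x *\<^sub>R v x) \<in> borel_measurable lborel"
      using v unfolding set_integrable_def by blast
    have "(\<lambda>x. indicator {a<..b} x *\<^sub>R (indicator {a..b + 1} x *\<^sub>R v x)) \<in> borel_measurable lborel"
      by (rule borel_measurable_scaleR[OF _ vm]) simp
    also have "(\<lambda>x. indicator {a<..b} x *\<^sub>R (indicator {a..b + 1} x *\<^sub>R v x)) = (\<lambda>x. indicator {a<..b} x *\<^sub>R v x)"
      by (auto simp: indicator_def)
    finally show "(\<lambda>x. indicator {a<..b} x *\<^sub>R v x) \<in> borel_measurable lborel" .
    fix n
    have eqn: "indicator {0<..} x *\<^sub>R (v x * \<phi> n x) = indicator {a..b + 1} x *\<^sub>R v x * \<phi> n x" for x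
      using \<phi>_out[of x n] \<open>0 < a\<close> by (auto simp: indicator_def)
    have "continuous_on UNIV (\<phi> n)"
      using D by (meson DERIV_isCont continuous_at_imp_continuous_on)
    then have "(\<phi> n) \<in> borel_measurable lborel"
      by (simp add: borel_measurable_continuous_onI)
    then show "(\<lambda>x. indicator {0<..} x *\<^sub>R (v x * \<phi> n x)) \<in> borel_measurable lborel"
      unfolding eqn by (intro borel_measurable_times vm)
    have "\<bar>\<phi> n x\<bar> \<le> 1" for x
      using Hh(8)[of "N n * x + - N n * a"] Hh(9)[of "N n * x + - N n * a"]
        Hh(8)[of "N n * x + - N n * b"] Hh(9)[of "N n * x + - N n * b"]
      unfolding \<phi>_def by linarith
    then show "AE x in lborel. norm (indicator {0<..} x *\<^sub>R (v x * \<phi> n x)) \<le> norm (indicator {a..b + 1} x *\<^sub>R v x)"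
      unfolding eqn by (intro AE_I2) (simp add: abs_mult mult_left_le)
  next
    show "AE x in lborel. (\<lambda>n. indicator {0<..} x *\<^sub>R (v x * \<phi> n x)) \<longlonglongrightarrow> indicator {a<..b} x *\<^sub>R v x"
    proof (rule AE_I2)
      fix x
      have one: "\<forall>\<^sub>F n in sequentially. H (N n * x + - N n * c) = 1" if "c < x" for c
      proof -
        obtain m :: nat where m: "1 / (x - c) < real m" using reals_Archimedean2 by blast
        have "H (N n * x + - N n * c) = 1" if "n \<ge> m" for n
        proof -
          have "1 / (x - c) \<le> N n" using m that by (simp add: N_def)
          then have "1 \<le> N n * (x - c)" using \<open>c < x\<close> by (simp add: divide_le_eq)
          then show ?thesis using Hh(7) by (simp add: algebra_simps)
        qed
        then show ?thesis unfolding eventually_sequentially by blast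
      qed
      have zero: "H (N n * x + - N n * c) = 0" if "x \<le> c" for c n
      proof -
        have "N n * (x - c) \<le> 0" using N[of n] that by (simp add: mult_le_0_iff)
        then show ?thesis using Hh(6) by (simp add: algebra_simps)
      qed
      have "\<forall>\<^sub>F n in sequentially. \<phi> n x = indicator {a<..b} x"
      proof -
        consider "x \<le> a" | "a < x" "x \<le> b" | "b < x" by linarith
        then show ?thesis
        proof cases
          case 3
          then have "a < x" using \<open>a < b\<close> by simp
          from one[OF 3] one[OF this] show ?thesis
            by eventually_elim (use 3 in \<open>simp add: \<phi>_def indicator_def\<close>)
        next
          case 2
          from one[OF 2(1)] show ?thesis
            by eventually_elim (use 2 zero[OF 2(2)] in \<open>simp add: \<phi>_def indicator_def\<close>)
        qed (use zero \<open>a < b\<close> in \<open>simp add: \<phi>_def indicator_def\<close>)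
      qed
      then have "\<forall>\<^sub>F n in sequentially. indicator {0<..} x *\<^sub>R (v x * \<phi> n x) = indicator {a<..b} x *\<^sub>R v x"
        by eventually_elim (use \<open>0 < a\<close> in \<open>auto simp: indicator_def\<close>)
      then show "(\<lambda>n. indicator {0<..} x *\<^sub>R (v x * \<phi> n x)) \<longlonglongrightarrow> indicator {a<..b} x *\<^sub>R v x"
        by (rule tendsto_eventually)
    qed
  qed
  have "(\<lambda>n. - (LBINT x:{0<..}. v x * \<phi> n x)) \<longlonglongrightarrow> u a - u b"
    using lhs unfolding eq .
  from LIMSEQ_unique[OF this tendsto_minus[OF rhs]] show ?thesis by simp
qed

text \<open>Half-open intervals are stable under intersection and generate the Borel sets, so Dynkin
  induction carries the vanishing to all Borel sets, and a density whose integrals all vanish is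
  zero almost everywhere. The complement case uses the integral over the whole line, obtained as a
  limit over growing intervals.\<close>

lemma AE_zero_if_Ioc_integrals_zero:
  fixes h :: "real \<Rightarrow> real"
  assumes h: "integrable lborel h" and zero: "\<And>a b. (LBINT x:{a<..b}. h x) = 0"
  shows "AE x in lborel. h x = 0"
proof -
  have si: "set_integrable lborel A h" if "A \<in> sets borel" for A
    using integrable_mult_indicator[OF _ h, of A] that by (simp add: set_integrable_def)
  have total: "(LBINT x. h x) = 0"
  proof -
    have "(\<lambda>n. LBINT x:{- real n<..real n}. h x) \<longlonglongrightarrow> (LBINT x. h x)"
      unfolding set_lebesgue_integral_def
    proof (rule integral_dominated_convergence[where w = "\<lambda>x. norm (h x)"])
      show "AE x in lborel. (\<lambda>n. indicator {- real n<..real n} x *\<^sub>R h x) \<longlonglongrightarrow> h x"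
      proof (rule AE_I2)
        fix x :: real
        obtain m :: nat where m: "\<bar>x\<bar> < real m" using reals_Archimedean2 by blast
        have "\<forall>\<^sub>F n in sequentially. indicator {- real n<..real n} x *\<^sub>R h x = h x"
          unfolding eventually_sequentially using m by (intro exI[of _ m]) (auto simp: indicator_def)
        then show "(\<lambda>n. indicator {- real n<..real n} x *\<^sub>R h x) \<longlonglongrightarrow> h x"
          by (rule tendsto_eventually)
      qed
    qed (use h in \<open>auto simp: indicator_def\<close>)
    then show ?thesis using zero by (simp add: LIMSEQ_const_iff)
  qed
  have "(LBINT x:A. h x) = 0" if "A \<in> sets lborel" for A
  proof -
    have gen: "A \<in> sigma_sets UNIV (range (\<lambda>(a, b). {a<..b::real}))"
      using that by (simp add: borel_sigma_sets_Ioc)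
    have "Int_stable (range (\<lambda>(a, b). {a<..b::real}))"
      by (auto simp: Int_stable_def Int_greaterThanAtMost)
    moreover have "range (\<lambda>(a, b). {a<..b::real}) \<subseteq> Pow UNIV" by simp
    ultimately show ?thesis using gen
    proof (induction rule: sigma_sets_induct_disjoint)
      case (compl A)
      then have A: "A \<in> sets borel" by (simp add: borel_sigma_sets_Ioc)
      have "(LBINT x:UNIV. h x) = (LBINT x:A. h x) + (LBINT x:UNIV - A. h x)"
        using set_integral_Un[of A "UNIV - A" lborel h] si[OF A] si[of "UNIV - A"] A by auto
      then show ?case using compl total by (simp add: set_lebesgue_integral_def)
    next
      case (union A)
      then have A: "A i \<in> sets borel" for i by (auto simp: borel_sigma_sets_Ioc)
      have "(LBINT x:(\<Union>i. A i). h x) = (\<Sum>i. LBINT x:A i. h x)"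
        by (rule lebesgue_integral_countable_add)
          (use A union(1) in \<open>auto simp: disjoint_family_on_def intro!: si\<close>)
      then show ?case using union by simp
    qed (auto simp: zero set_lebesgue_integral_def[of _ "{}"])
  qed
  then show ?thesis
    using sigma_finite_measure.density_zero[OF lborel.sigma_finite_measure_axioms h] by blast
qed

text \<open>Local integrability allows a singularity at 0 and growth at infinity, so the difference
  is cut off to (1/(n+1), n+1], where it is integrable. The half-line is the union of these
  countably many intervals.\<close>

lemma primitive_density_unique:
  fixes v w :: "real \<Rightarrow> real"
  assumes v: "locally_integrable v" and w: "locally_integrable w"
    and eq: "\<And>a b. 0 < a \<Longrightarrow> a < b \<Longrightarrow> (LBINT x:{a<..b}. v x) = (LBINT x:{a<..b}. w x)"
  shows "AE x in lborel. x > 0 \<longrightarrow> v x = w x"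
proof -
  define I where "I = (\<lambda>n. {1 / real (Suc n)<..real (Suc n)})"
  have sub: "set_integrable lborel {a<..b} v" "set_integrable lborel {a<..b} w" if "0 < a" for a b
  proof -
    have *: "{a<..b} \<subseteq> {a..max a b}" by auto
    show "set_integrable lborel {a<..b} v" "set_integrable lborel {a<..b} w"
      by (rule set_integrable_subset[OF _ _ *]; use v w that in \<open>simp add: locally_integrable_def\<close>)+
  qed
  have "AE x in lborel. indicator (I n) x *\<^sub>R (v x - w x) = 0" for n
  proof (rule AE_zero_if_Ioc_integrals_zero)
    have n: "0 < 1 / real (Suc n)" by simp
    show "integrable lborel (\<lambda>x. indicator (I n) x *\<^sub>R (v x - w x))"
      using set_integral_diff(1)[OF sub[OF n]] unfolding set_integrable_def I_def .
    fix a b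
    let ?l = "max a (1 / real (Suc n))" and ?r = "min b (real (Suc n))"
    have "(LBINT x:{a<..b}. indicator (I n) x *\<^sub>R (v x - w x)) =
        (LBINT x:{max a (1 / real (Suc n))<..min b (real (Suc n))}. v x - w x)"
      unfolding set_lebesgue_integral_def I_def
      by (intro Bochner_Integration.integral_cong) (auto simp: indicator_def)
    also have "\<dots> = (LBINT x:{max a (1 / real (Suc n))<..min b (real (Suc n))}. v x)
        - (LBINT x:{max a (1 / real (Suc n))<..min b (real (Suc n))}. w x)"
      by (intro set_integral_diff sub less_le_trans[OF n max.cobounded2])
    also have "\<dots> = 0"
    proof (cases "?l < ?r")
      case True
      then show ?thesis using eq[OF less_le_trans[OF n max.cobounded2] True] by simp
    next
      case False
      then have "{?l<..?r} = {}" by (simp only: greaterThanAtMost_empty not_less)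
      then show ?thesis by (simp only:) (simp add: set_lebesgue_integral_def)
    qed
    finally show "(LBINT x:{a<..b}. indicator (I n) x *\<^sub>R (v x - w x)) = 0" .
  qed
  then have "AE x in lborel. \<forall>n. indicator (I n) x *\<^sub>R (v x - w x) = 0"
    unfolding AE_all_countable by (rule allI)
  then show ?thesis
  proof (rule AE_mp, intro AE_I2 impI)
    fix x :: real assume all: "\<forall>n. indicator (I n) x *\<^sub>R (v x - w x) = 0" and x: "x > 0"
    obtain n :: nat where n: "max x (1 / x) < real n" using reals_Archimedean2 by blast
    then have "1 / x < real (Suc n)" "x < real (Suc n)" by auto
    then have "x \<in> I n" using x by (auto simp: I_def field_simps)
    with all show "v x = w x" by (metis eq_iff_diff_eq_0 indicator_simps(1) scaleR_one)
  qed
qed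

lemma has_weak_deriv_AE_unique:
  assumes "has_weak_deriv u v" "has_weak_deriv u w" "continuous_on {0<..} u"
  shows "AE x in lborel. x > 0 \<longrightarrow> v x = w x"
proof (rule primitive_density_unique)
  show "(LBINT x:{a<..b}. v x) = (LBINT x:{a<..b}. w x)" if "0 < a" "a < b" for a b
    using has_weak_deriv_increment[OF assms(1,3) that] has_weak_deriv_increment[OF assms(2,3) that] by simp
qed (use assms in \<open>auto simp: has_weak_deriv_def\<close>)

section \<open>Primitives of integrable functions\<close>

text \<open>Absolute continuity on every [0, b], encoded by the integral formula. It covers C^1
  functions as well as H1 functions with their weak derivatives, so one product rule serves for
  mixed products, and almost-everywhere differentiability never enters.\<close>

definition is_primitive :: "(real \<Rightarrow> real) \<Rightarrow> (real \<Rightarrow> real) \<Rightarrow> bool" where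
  "is_primitive F f \<longleftrightarrow> (\<forall>b\<ge>0. set_integrable lborel {0<..b} f \<and> F b = F 0 + (LBINT x:{0<..b}. f x))"

lemma is_primitiveD:
  assumes "is_primitive F f" "b \<ge> 0"
  shows "set_integrable lborel {0<..b} f" "(LBINT x:{0<..b}. f x) = F b - F 0"
proof -
  have "set_integrable lborel {0<..b} f \<and> F b = F 0 + (LBINT x:{0<..b}. f x)"
    using assms unfolding is_primitive_def by blast
  then show "set_integrable lborel {0<..b} f" "(LBINT x:{0<..b}. f x) = F b - F 0" by linarith+
qed

lemma is_primitive_measurable:
  assumes "is_primitive F f" "b \<ge> 0"
  shows "(\<lambda>x. indicator {0<..b} x * F x) \<in> borel_measurable borel"
    "\<exists>M\<ge>0. \<forall>x\<in>{0<..b}. \<bar>F x\<bar> \<le> M"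
    "continuous_on {0..b} F"
proof -
  note fi = is_primitiveD(1)[OF assms]
  have fi': "set_integrable lborel {0..b} f'" if "f' = (\<lambda>x. indicator {0<..b} x *\<^sub>R f x)" for f'
    using fi integrable_mult_indicator[of "{0..b}" lborel f'] unfolding that set_integrable_def by simp
  define f' where "f' = (\<lambda>x. indicator {0<..b} x *\<^sub>R f x)"
  note fi' = fi'[OF f'_def]
  have F': "F x = F 0 + integral {0..x} f'" if "x \<in> {0..b}" for x
  proof -
    have "(LBINT x:{0<..x}. f x) = (LBINT x:{0..x}. f' x)"
      using that unfolding set_lebesgue_integral_def f'_def
      by (intro Bochner_Integration.integral_cong) (auto simp: indicator_def)
    also have "\<dots> = integral {0..x} f'"
      by (rule set_borel_integral_eq_integral(2), rule set_integrable_subset[OF fi']) (use that in auto)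
    finally show ?thesis using is_primitiveD(2)[OF assms(1), of x] that by simp
  qed
  have "continuous_on {0..b} (\<lambda>x. F 0 + integral {0..x} f')"
    by (intro continuous_intros indefinite_integral_continuous_1 set_borel_integral_eq_integral(1) fi')
  then show cont: "continuous_on {0..b} F"
    by (rule continuous_on_eq) (rule F'[symmetric])
  have "(\<lambda>x. indicator {0<..b} x *\<^sub>R F x) \<in> borel_measurable borel"
    by (rule borel_measurable_continuous_on_indicator[OF _ continuous_on_subset[OF cont]]) auto
  then show "(\<lambda>x. indicator {0<..b} x * F x) \<in> borel_measurable borel" by simp
  have "bounded (F ` {0..b})"
    by (intro compact_imp_bounded compact_continuous_image cont compact_Icc)
  then obtain B where B: "\<forall>x\<in>{0..b}. \<bar>F x\<bar> \<le> B" unfolding bounded_iff by auto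
  show "\<exists>M\<ge>0. \<forall>x\<in>{0<..b}. \<bar>F x\<bar> \<le> M"
    by (intro exI[of _ "\<bar>B\<bar>"]) (use B in \<open>auto intro: order_trans[OF _ abs_ge_self]\<close>)
qed

lemma set_integrable_mult_primitive:
  assumes "is_primitive F f" "b \<ge> 0" and g: "set_integrable lborel {0<..b} g"
  shows "set_integrable lborel {0<..b} (\<lambda>x. F x * g x)"
proof -
  obtain M where M: "M \<ge> 0" "\<forall>x\<in>{0<..b}. \<bar>F x\<bar> \<le> M" using is_primitive_measurable(2)[OF assms(1,2)] by blast
  have "integrable lborel (\<lambda>x. (indicator {0<..b} x * F x) * (indicator {0<..b} x * g x))"
  proof (rule Bochner_Integration.integrable_bound)
    show "integrable lborel (\<lambda>x. M * norm (indicator {0<..b} x *\<^sub>R g x))"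
      using g unfolding set_integrable_def by (intro integrable_mult_right integrable_norm)
    have gm: "(\<lambda>x. indicator {0<..b} x * g x) \<in> borel_measurable lborel"
      using g unfolding set_integrable_def by auto
    have "(\<lambda>x. indicator {0<..b} x * F x) \<in> borel_measurable lborel"
      using is_primitive_measurable(1)[OF assms(1,2)] by simp
    from borel_measurable_times[OF this gm]
    show "(\<lambda>x. (indicator {0<..b} x * F x) * (indicator {0<..b} x * g x)) \<in> borel_measurable lborel" .
    show "AE x in lborel. norm (indicator {0<..b} x * F x * (indicator {0<..b} x * g x))
        \<le> norm (M * norm (indicator {0<..b} x *\<^sub>R g x))"
      using M by (intro AE_I2) (auto simp: indicator_def abs_mult intro!: mult_right_mono)
  qed
  then show ?thesis
    unfolding set_integrable_def
    by (rule Bochner_Integration.integrable_cong[THEN iffD1, rotated -1]) (auto simp: indicator_def)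
qed

text \<open>The product of the two increments is an integral over a square; it is split along the diagonal,
  and one of the triangles is integrated in the other order by Fubini.\<close>

lemma is_primitive_mult:
  assumes F: "is_primitive F f" and G: "is_primitive G g"
  shows "is_primitive (\<lambda>x. F x * G x) (\<lambda>x. G x * f x + F x * g x)"
  unfolding is_primitive_def
proof (intro allI impI conjI)
  fix b :: real assume b: "b \<ge> 0"
  have fi: "set_integrable lborel {0<..b} f" and gi: "set_integrable lborel {0<..b} g"
    using is_primitiveD(1)[OF F b] is_primitiveD(1)[OF G b] .
  note i1 = set_integrable_mult_primitive[OF G b fi]
  note i2 = set_integrable_mult_primitive[OF F b gi]
  show "set_integrable lborel {0<..b} (\<lambda>x. G x * f x + F x * g x)"
    using i1 i2 by (rule set_integral_add)
  define f' where "f' = (\<lambda>x. indicator {0<..b} x * f x)"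
  define g' where "g' = (\<lambda>x. indicator {0<..b} x * g x)"
  have f': "integrable lborel f'" and g': "integrable lborel g'"
    using fi gi unfolding set_integrable_def f'_def g'_def by auto
  have [measurable]: "f' \<in> borel_measurable borel" "g' \<in> borel_measurable borel"
    using f' g' by auto
  \<comment> \<open>The strict version for \<open>F\<close> and the non-strict one for
    \<open>G\<close> reflect that the diagonal is assigned to one triangle only; in each slice it is
    a single point.\<close>
  have seg: "(LBINT x. indicator {..<y} x * f' x) = F y - F 0" "(LBINT x. indicator {..y} x * f' x) = F y - F 0"
      "(LBINT x. indicator {..y} x * g' x) = G y - G 0" if "y \<in> {0<..b}" for y
  proof -
    have "indicator {..y} x * (indicator {0<..b} x * k x) = indicator {0<..y} x *\<^sub>R k x" for x and k :: "real \<Rightarrow> real"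
      using that by (auto simp: indicator_def)
    then have "(LBINT x. indicator {..y} x * f' x) = (LBINT x:{0<..y}. f x)"
         "(LBINT x. indicator {..y} x * g' x) = (LBINT x:{0<..y}. g x)"
      unfolding f'_def g'_def set_lebesgue_integral_def by (simp_all only:)
    then show 1: "(LBINT x. indicator {..y} x * f' x) = F y - F 0" "(LBINT x. indicator {..y} x * g' x) = G y - G 0"
      using is_primitiveD(2)[OF F, of y] is_primitiveD(2)[OF G, of y] that by auto
    have "(LBINT x. indicator {..<y} x * f' x) = (LBINT x. indicator {..y} x * f' x)"
    proof (rule integral_cong_AE)
      have "AE x in lborel. x \<noteq> y" by (rule AE_lborel_singleton)
      then show "AE x in lborel. indicator {..<y} x * f' x = indicator {..y} x * f' x"
        by eventually_elim (auto simp: indicator_def)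
    qed auto
    with 1 show "(LBINT x. indicator {..<y} x * f' x) = F y - F 0" by simp
  qed
  have fg: "integrable (lborel \<Otimes>\<^sub>M lborel) (\<lambda>p. f' (fst p) * g' (snd p))"
  proof (rule lborel_pair.Fubini_integrable)
    show "integrable lborel (\<lambda>x. LBINT y. norm (f' (fst (x, y)) * g' (snd (x, y))))"
      using f' g' by (simp add: abs_mult)
  qed (use g' in auto)
  have "integrable (lborel \<Otimes>\<^sub>M lborel) (\<lambda>p. f' (fst p) * g' (snd p) * (if fst p < snd p then 1 else 0))"
    by (rule Bochner_Integration.integrable_bound[OF fg]) auto
  then have tri: "integrable (lborel \<Otimes>\<^sub>M lborel) (\<lambda>(x, y). f' x * g' y * indicator {x<..} y)"
    by (rule Bochner_Integration.integrable_cong[THEN iffD1, rotated -1]) (auto simp: indicator_def)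
  have "(F b - F 0) * (G b - G 0) = (LBINT x. f' x) * (LBINT y. g' y)"
    using is_primitiveD(2)[OF F b] is_primitiveD(2)[OF G b] unfolding set_lebesgue_integral_def f'_def g'_def by simp
  also have "\<dots> = (LBINT x. f' x * (LBINT y. g' y))" by simp
  also have "\<dots> = (LBINT x. f' x * (G x - G 0) + (LBINT y. f' x * g' y * indicator {x<..} y))"
  proof (rule Bochner_Integration.integral_cong[OF refl])
    fix x
    show "f' x * (LBINT y. g' y) = f' x * (G x - G 0) + (LBINT y. f' x * g' y * indicator {x<..} y)"
    proof (cases "x \<in> {0<..b}")
      case True
      have "(LBINT y. g' y) = (LBINT y. indicator {..x} y * g' y + g' y * indicator {x<..} y)"
        by (intro Bochner_Integration.integral_cong) (auto simp: indicator_def)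
      also have "\<dots> = (LBINT y. indicator {..x} y * g' y) + (LBINT y. g' y * indicator {x<..} y)"
        using integrable_mult_indicator[OF _ g', of "{..x}"] integrable_mult_indicator[OF _ g', of "{x<..}"]
        by (intro Bochner_Integration.integral_add) (auto simp: mult.commute)
      finally show ?thesis using seg(3)[OF True] by (simp add: distrib_left mult.assoc)
    qed (auto simp: f'_def)
  qed
  also have "\<dots> = (LBINT x. f' x * (G x - G 0)) + (LBINT x. LBINT y. f' x * g' y * indicator {x<..} y)"
  proof (rule Bochner_Integration.integral_add)
    have "integrable lborel (\<lambda>x. indicator {0<..b} x *\<^sub>R (G x * f x) - G 0 * f' x)"
      using i1 f' unfolding set_integrable_def by (intro Bochner_Integration.integrable_diff) auto
    then show "integrable lborel (\<lambda>x. f' x * (G x - G 0))"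
      by (rule Bochner_Integration.integrable_cong[THEN iffD1, rotated -1]) (auto simp: f'_def algebra_simps)
    show "integrable lborel (\<lambda>x. LBINT y. f' x * g' y * indicator {x<..} y)"
      using lborel_pair.integrable_fst[OF tri] by simp
  qed
  also have "(LBINT x. LBINT y. f' x * g' y * indicator {x<..} y) = (LBINT y. LBINT x. f' x * g' y * indicator {x<..} y)"
    using lborel_pair.Fubini_integral[OF tri] by simp
  also have "\<dots> = (LBINT y. g' y * (F y - F 0))"
  proof (rule Bochner_Integration.integral_cong[OF refl])
    fix y
    have "(LBINT x. f' x * g' y * indicator {x<..} y) = (LBINT x. g' y * (indicator {..<y} x * f' x))"
      by (intro Bochner_Integration.integral_cong) (auto simp: indicator_def)
    also have "\<dots> = g' y * (F y - F 0)"
      by (cases "y \<in> {0<..b}") (auto simp: seg g'_def)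
    finally show "(LBINT x. f' x * g' y * indicator {x<..} y) = g' y * (F y - F 0)" .
  qed
  also have "(LBINT x. f' x * (G x - G 0)) = (LBINT x:{0<..b}. G x * f x) - G 0 * (F b - F 0)"
  proof -
    have "(LBINT x. f' x * (G x - G 0)) = (LBINT x. indicator {0<..b} x *\<^sub>R (G x * f x) - G 0 * f' x)"
      by (intro Bochner_Integration.integral_cong) (auto simp: f'_def algebra_simps)
    also have "\<dots> = (LBINT x:{0<..b}. G x * f x) - (LBINT x. G 0 * f' x)"
      unfolding set_lebesgue_integral_def
      using i1 f' unfolding set_integrable_def by (intro Bochner_Integration.integral_diff) auto
    also have "(LBINT x. G 0 * f' x) = G 0 * (F b - F 0)"
      using is_primitiveD(2)[OF F b] unfolding set_lebesgue_integral_def f'_def by simp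
    finally show ?thesis .
  qed
  also have "(LBINT x. g' x * (F x - F 0)) = (LBINT x:{0<..b}. F x * g x) - F 0 * (G b - G 0)"
  proof -
    have "(LBINT x. g' x * (F x - F 0)) = (LBINT x. indicator {0<..b} x *\<^sub>R (F x * g x) - F 0 * g' x)"
      by (intro Bochner_Integration.integral_cong) (auto simp: g'_def algebra_simps)
    also have "\<dots> = (LBINT x:{0<..b}. F x * g x) - (LBINT x. F 0 * g' x)"
      unfolding set_lebesgue_integral_def
      using i2 g' unfolding set_integrable_def by (intro Bochner_Integration.integral_diff) auto
    also have "(LBINT x. F 0 * g' x) = F 0 * (G b - G 0)"
      using is_primitiveD(2)[OF G b] unfolding set_lebesgue_integral_def g'_def by simp
    finally show ?thesis .
  qed
  finally show "F b * G b = F 0 * G 0 + (LBINT x:{0<..b}. G x * f x + F x * g x)"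
    unfolding set_integral_add(2)[OF i1 i2] by (simp add: algebra_simps)
qed

lemma is_primitiveI_DERIV:
  assumes "\<And>x. x \<ge> 0 \<Longrightarrow> (F has_real_derivative f x) (at x within {0..})" and "continuous_on {0..} f"
  shows "is_primitive F f"
  unfolding is_primitive_def
proof (intro allI impI conjI)
  fix b :: real assume b: "b \<ge> 0"
  have c: "continuous_on {0..b} f" by (rule continuous_on_subset[OF assms(2)]) auto
  have "set_integrable lborel {0..b} f" by (rule borel_integrable_atLeastAtMost'[OF c])
  then show "set_integrable lborel {0<..b} f"
    by (rule set_integrable_subset) auto
  have "(LBINT x:{0<..b}. f x) = (LBINT x:{0..b}. f x)"
    unfolding set_lebesgue_integral_def
  proof (rule integral_cong_AE)
    have "AE x in lborel. x \<noteq> (0::real)" by (rule AE_lborel_singleton)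
    then show "AE x in lborel. indicator {0<..b} x *\<^sub>R f x = indicator {0..b} x *\<^sub>R f x"
      by eventually_elim (auto simp: indicator_def)
    show "(\<lambda>x. indicator {0<..b} x *\<^sub>R f x) \<in> borel_measurable lborel"
         "(\<lambda>x. indicator {0..b} x *\<^sub>R f x) \<in> borel_measurable lborel"
      by (auto intro!: borel_measurable_continuous_on_indicator continuous_on_subset[OF c] simp del: real_scaleR_def)
  qed
  also have "\<dots> = F b - F 0"
    unfolding set_lebesgue_integral_def
  proof (rule integral_FTC_atLeastAtMost[OF b _ c])
    fix x assume "0 \<le> x" "x \<le> b"
    then show "(F has_vector_derivative f x) (at x within {0..b})"
      using DERIV_subset[OF assms(1), of x "{0..b}"] by (auto simp: has_real_derivative_iff_has_vector_derivative)
  qed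
  finally show "F b = F 0 + (LBINT x:{0<..b}. f x)" by simp
qed

section \<open>The Sobolev space of the half-line\<close>

lemma set_integral_Ioi_tendsto:
  fixes f :: "real \<Rightarrow> real"
  assumes "set_integrable lborel {0<..} f" and X: "filterlim X at_top sequentially"
  shows "(\<lambda>n. LBINT x:{0<..X n}. f x) \<longlonglongrightarrow> (LBINT x:{0<..}. f x)"
  unfolding set_lebesgue_integral_def
proof (rule integral_dominated_convergence[where w = "\<lambda>x. norm (indicator {0<..} x *\<^sub>R f x)"])
  show int: "integrable lborel (\<lambda>x. norm (indicator {0<..} x *\<^sub>R f x))"
    using assms(1) unfolding set_integrable_def by (rule integrable_norm)
  show "(\<lambda>x. indicator {0<..} x *\<^sub>R f x) \<in> borel_measurable lborel"
    using assms(1) unfolding set_integrable_def by blast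
  have "set_integrable lborel {0<..X n} f" for n
    by (rule set_integrable_subset[OF assms(1)]) auto
  then show "(\<lambda>x. indicator {0<..X n} x *\<^sub>R f x) \<in> borel_measurable lborel" for n
    unfolding set_integrable_def by blast
  show "AE x in lborel. (\<lambda>n. indicator {0<..X n} x *\<^sub>R f x) \<longlonglongrightarrow> indicator {0<..} x *\<^sub>R f x"
  proof (rule AE_I2)
    fix x
    have "\<forall>\<^sub>F n in sequentially. x \<le> X n"
      using X unfolding filterlim_at_top by blast
    then have "\<forall>\<^sub>F n in sequentially. indicator {0<..X n} x *\<^sub>R f x = indicator {0<..} x *\<^sub>R f x"
      by eventually_elim (auto simp: indicator_def)
    then show "(\<lambda>n. indicator {0<..X n} x *\<^sub>R f x) \<longlonglongrightarrow> indicator {0<..} x *\<^sub>R f x"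
      by (rule tendsto_eventually)
  qed
qed (auto simp: indicator_def)

lemma set_integrable_continuous_Ioc:
  fixes f :: "real \<Rightarrow> real"
  assumes "continuous_on {0..b} f"
  shows "set_integrable lborel {0<..b} f"
  by (rule set_integrable_subset[OF borel_integrable_atLeastAtMost'[OF assms]]) auto

lemma locally_integrable_continuous:
  assumes "continuous_on {0<..} u"
  shows "locally_integrable u"
  unfolding locally_integrable_def
  by (intro allI impI borel_integrable_atLeastAtMost' continuous_on_subset[OF assms]) auto

lemma has_weak_deriv_classical:
  assumes D: "\<And>x. x > 0 \<Longrightarrow> (u has_real_derivative u' x) (at x)" and c': "continuous_on {0<..} u'"
  shows "has_weak_deriv u u'"
  unfolding has_weak_deriv_def
proof (intro conjI allI impI)
  have c: "continuous_on {0<..} u"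
    using D by (intro continuous_at_imp_continuous_on) (auto intro: DERIV_isCont)
  show "locally_integrable u" "locally_integrable u'"
    using c c' locally_integrable_continuous by auto
  fix \<phi> assume "test_function \<phi>"
  then obtain a b where ab: "0 < a" "a \<le> b" "\<And>x. x \<notin> {a..b} \<Longrightarrow> \<phi> x = 0" and sm: "smooth \<phi>"
    unfolding test_function_def by blast
  note D\<phi> = smooth_DERIV[OF sm]
  have c\<phi>: "continuous_on S \<phi>" "continuous_on S (deriv \<phi>)" for S
    using smooth_DERIV[OF sm] smooth_DERIV[OF smooth_deriv[OF sm]]
    by (meson DERIV_isCont continuous_at_imp_continuous_on)+
  have d0: "deriv \<phi> x = 0" if "x \<notin> {a..b}" for x
  proof (rule DERIV_imp_deriv)
    show "(\<phi> has_real_derivative 0) (at x)"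
      by (rule has_field_derivative_transform_within_open[OF DERIV_const[of 0], of "- {a..b}"])
        (use that ab(3) in auto)
  qed
  \<comment> \<open>The interval is a little larger than the support: at a/2 and b+1 the test
    function vanishes, which removes the boundary terms of the integration by parts, and the
    interval still avoids 0.\<close>
  have sub: "{a / 2..b + 1} \<subseteq> {0<..}" using ab by auto
  have eq: "(LBINT x:{0<..}. f x) = (LBINT x:{a / 2..b + 1}. f x)" if "\<And>x. x \<notin> {a..b} \<Longrightarrow> f x = 0" for f :: "real \<Rightarrow> real"
    unfolding set_lebesgue_integral_def
  proof (intro Bochner_Integration.integral_cong refl)
    show "indicator {0<..} x *\<^sub>R f x = indicator {a / 2..b + 1} x *\<^sub>R f x" for x
      using that[of x] ab by (cases "x \<in> {a..b}") (auto simp: indicator_def)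
  qed
  have i1: "set_integrable lborel {a / 2..b + 1} (\<lambda>x. u x * deriv \<phi> x)"
    and i2: "set_integrable lborel {a / 2..b + 1} (\<lambda>x. u' x * \<phi> x)"
    by (intro borel_integrable_atLeastAtMost' continuous_intros c\<phi> continuous_on_subset[OF c sub] continuous_on_subset[OF c' sub])+
  have "(LBINT x:{a / 2..b + 1}. u x * deriv \<phi> x) + (LBINT x:{a / 2..b + 1}. u' x * \<phi> x)
      = (LBINT x:{a / 2..b + 1}. u x * deriv \<phi> x + u' x * \<phi> x)"
    by (rule set_integral_add(2)[OF i1 i2, symmetric])
  also have "\<dots> = u (b + 1) * \<phi> (b + 1) - u (a / 2) * \<phi> (a / 2)"
    unfolding set_lebesgue_integral_def
  proof (rule integral_FTC_atLeastAtMost)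
    fix x assume "a / 2 \<le> x" "x \<le> b + 1"
    then have "x > 0" using ab by simp
    have "((\<lambda>x. u x * \<phi> x) has_real_derivative u' x * \<phi> x + deriv \<phi> x * u x) (at x)"
      by (rule DERIV_mult[OF D[OF \<open>x > 0\<close>] D\<phi>])
    then have "((\<lambda>x. u x * \<phi> x) has_real_derivative u x * deriv \<phi> x + u' x * \<phi> x) (at x within {a / 2..b + 1})"
      by (simp add: has_field_derivative_at_within add.commute mult.commute)
    then show "((\<lambda>x. u x * \<phi> x) has_vector_derivative u x * deriv \<phi> x + u' x * \<phi> x) (at x within {a / 2..b + 1})"
      unfolding has_real_derivative_iff_has_vector_derivative .
  qed (use ab in \<open>auto intro!: continuous_intros c\<phi> continuous_on_subset[OF c sub] continuous_on_subset[OF c' sub]\<close>)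
  also have "\<dots> = 0" using ab by simp
  finally show "(LBINT x:{0<..}. u x * deriv \<phi> x) = - (LBINT x:{0<..}. u' x * \<phi> x)"
    using eq[of "\<lambda>x. u x * deriv \<phi> x"] eq[of "\<lambda>x. u' x * \<phi> x"] d0 ab(3) by simp
qed

text \<open>\<open>square_integrable\<close> asks for measurability on the open half-line, while a
  weak derivative comes only with local integrability. The truncations to compact intervals are
  measurable and converge pointwise.\<close>

lemma locally_integrable_measurable:
  assumes "locally_integrable v"
  shows "set_borel_measurable lborel {0<..} v"
  unfolding set_borel_measurable_def
proof (rule borel_measurable_LIMSEQ_real)
  fix n
  have "set_integrable lborel {1 / real (Suc n)..max (1 / real (Suc n)) (real n)} v"
    using assms unfolding locally_integrable_def by simp
  then show "(\<lambda>x. indicator {1 / real (Suc n)..max (1 / real (Suc n)) (real n)} x *\<^sub>R v x) \<in> borel_measurable lborel"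
    unfolding set_integrable_def by blast
next
  fix x :: real
  obtain m :: nat where m: "max x (1 / x) < real m" using reals_Archimedean2 by blast
  have "\<forall>\<^sub>F n in sequentially. indicator {1 / real (Suc n)..max (1 / real (Suc n)) (real n)} x *\<^sub>R v x
      = indicator {0<..} x *\<^sub>R v x"
    unfolding eventually_sequentially
  proof (intro exI allI impI)
    fix n assume n: "m \<le> n"
    show "indicator {1 / real (Suc n)..max (1 / real (Suc n)) (real n)} x *\<^sub>R v x = indicator {0<..} x *\<^sub>R v x"
    proof (cases "x > 0")
      case True
      then have "1 / x < real (Suc n)" "x \<le> real n" using m n by auto
      then have "1 / real (Suc n) \<le> x" using True by (simp add: field_simps)
      then show ?thesis using True \<open>x \<le> real n\<close> by (auto simp: indicator_def)
    next
      case False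
      have "0 < 1 / real (Suc n)" by simp
      with False have "\<not> 1 / real (Suc n) \<le> x" by linarith
      with False show ?thesis by (simp add: indicator_def del: of_nat_Suc)
    qed
  qed
  then show "(\<lambda>n. indicator {1 / real (Suc n)..max (1 / real (Suc n)) (real n)} x *\<^sub>R v x)
      \<longlonglongrightarrow> indicator {0<..} x *\<^sub>R v x"
    by (rule tendsto_eventually)
qed

lemma square_integrable_AE_cong:
  assumes v: "square_integrable v" and w: "set_borel_measurable lborel {0<..} w"
    and eq: "AE x in lborel. x > 0 \<longrightarrow> v x = w x"
  shows "square_integrable w" "(LBINT x:{0<..}. (w x)\<^sup>2) = (LBINT x:{0<..}. (v x)\<^sup>2)"
proof -
  have m: "(\<lambda>x. indicator {0<..} x *\<^sub>R (f x)\<^sup>2) \<in> borel_measurable lborel"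
    if "set_borel_measurable lborel {0<..} f" for f :: "real \<Rightarrow> real"
  proof -
    have "(\<lambda>x. (indicator {0<..} x *\<^sub>R f x)\<^sup>2) \<in> borel_measurable lborel"
      using that unfolding set_borel_measurable_def by (rule borel_measurable_power)
    then show ?thesis
      by (rule measurable_cong[THEN iffD1, rotated]) (simp add: indicator_def)
  qed
  have AE: "AE x in lborel. indicator {0<..} x *\<^sub>R (v x)\<^sup>2 = indicator {0<..} x *\<^sub>R (w x)\<^sup>2"
    using eq by eventually_elim (auto simp: indicator_def)
  have mv: "set_borel_measurable lborel {0<..} v" and iv: "set_integrable lborel {0<..} (\<lambda>x. (v x)\<^sup>2)"
    using v unfolding square_integrable_def by auto
  show "square_integrable w"
    using w iv integrable_cong_AE[OF m[OF mv] m[OF w] AE] unfolding square_integrable_def set_integrable_def by blast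
  show "(LBINT x:{0<..}. (w x)\<^sup>2) = (LBINT x:{0<..}. (v x)\<^sup>2)"
    using integral_cong_AE[OF m[OF mv] m[OF w] AE] unfolding set_lebesgue_integral_def by simp
qed

text \<open>Makes the choice hidden in \<open>weak_deriv\<close> harmless: two weak derivatives
  agree almost everywhere, so square integrability and the Dirichlet integral may be read off from
  any of them, in particular from a classical derivative.\<close>

lemma H1_D:
  assumes "u \<in> H1"
  shows "continuous_on {0..} u" "square_integrable u" "has_weak_deriv u (weak_deriv u)"
    "square_integrable (weak_deriv u)"
    "has_weak_deriv u v \<Longrightarrow> square_integrable v"
    "has_weak_deriv u v \<Longrightarrow> (LBINT x:{0<..}. \<bar>weak_deriv u x\<bar>\<^sup>2) = (LBINT x:{0<..}. (v x)\<^sup>2)"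
proof -
  show cont: "continuous_on {0..} u" and "square_integrable u"
    using assms unfolding H1_def by auto
  obtain w where w: "square_integrable w" "has_weak_deriv u w"
    using assms unfolding H1_def by auto
  show wd: "has_weak_deriv u (weak_deriv u)"
    unfolding weak_deriv_def by (rule someI[of "has_weak_deriv u", OF w(2)])
  have c: "continuous_on {0<..} u" by (rule continuous_on_subset[OF cont]) auto
  note eq = square_integrable_AE_cong[OF w(1) locally_integrable_measurable has_weak_deriv_AE_unique[OF w(2) _ c]]
  show "square_integrable (weak_deriv u)"
    by (rule eq(1)) (use wd in \<open>auto simp: has_weak_deriv_def\<close>)
  show "square_integrable v" if "has_weak_deriv u v"
    by (rule eq(1)) (use that in \<open>auto simp: has_weak_deriv_def\<close>)
  have "(LBINT x:{0<..}. (v x)\<^sup>2) = (LBINT x:{0<..}. (w x)\<^sup>2)" if "has_weak_deriv u v" for v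
    by (rule eq(2)) (use that in \<open>auto simp: has_weak_deriv_def\<close>)
  from this[OF wd] this show "(LBINT x:{0<..}. \<bar>weak_deriv u x\<bar>\<^sup>2) = (LBINT x:{0<..}. (v x)\<^sup>2)" if "has_weak_deriv u v"
    using that by simp
qed

lemma square_integrable_mult:
  assumes "square_integrable u" "square_integrable v"
  shows "set_integrable lborel {0<..} (\<lambda>x. u x * v x)"
  unfolding set_integrable_def
proof (rule Bochner_Integration.integrable_bound)
  show "integrable lborel (\<lambda>x. indicator {0<..} x *\<^sub>R (u x)\<^sup>2 + indicator {0<..} x *\<^sub>R (v x)\<^sup>2)"
    using assms unfolding square_integrable_def set_integrable_def by (intro Bochner_Integration.integrable_add) auto
  have "(\<lambda>x. (indicator {0<..} x *\<^sub>R u x) * (indicator {0<..} x *\<^sub>R v x)) \<in> borel_measurable lborel"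
    using assms unfolding square_integrable_def set_borel_measurable_def by (intro borel_measurable_times) auto
  then show "(\<lambda>x. indicator {0<..} x *\<^sub>R (u x * v x)) \<in> borel_measurable lborel"
    by (rule measurable_cong[THEN iffD1, rotated]) (simp add: indicator_def)
  have "\<bar>p * q\<bar> \<le> p\<^sup>2 + q\<^sup>2" for p q :: real
  proof -
    have "2 * (\<bar>p\<bar> * \<bar>q\<bar>) \<le> p\<^sup>2 + q\<^sup>2" using sum_squares_bound[of "\<bar>p\<bar>" "\<bar>q\<bar>"] by (simp add: mult.assoc)
    moreover have "0 \<le> \<bar>p\<bar> * \<bar>q\<bar>" by simp
    ultimately show ?thesis unfolding abs_mult by linarith
  qed
  then show "AE x in lborel. norm (indicator {0<..} x *\<^sub>R (u x * v x))
      \<le> norm (indicator {0<..} x *\<^sub>R (u x)\<^sup>2 + indicator {0<..} x *\<^sub>R (v x)\<^sup>2)"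
    by (intro AE_I2) (auto simp: indicator_def)
qed

lemma square_integrable_Ioc:
  assumes "square_integrable v"
  shows "set_integrable lborel {0<..b} v"
proof (cases "b > 0")
  case True
  define c where "c = (\<lambda>x. indicator {0<..b} x :: real)"
  have "square_integrable c"
    unfolding square_integrable_def set_borel_measurable_def
  proof
    have "(\<lambda>x. indicator {0<..} x *\<^sub>R (c x)\<^sup>2) = (\<lambda>x. indicator {0<..b} x :: real)"
      by (auto simp: c_def indicator_def)
    moreover have "integrable lborel (\<lambda>x. indicator {0<..b} x :: real)"
      using True by (auto intro!: integrable_real_indicator)
    ultimately show "set_integrable lborel {0<..} (\<lambda>x. (c x)\<^sup>2)" unfolding set_integrable_def by simp
  qed (simp add: c_def)
  from square_integrable_mult[OF this assms] show ?thesis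
    unfolding set_integrable_def
    by (rule Bochner_Integration.integrable_cong[THEN iffD1, rotated -1]) (auto simp: c_def indicator_def)
next
  case False
  then have "{0<..b} = {}" by auto
  then show ?thesis by simp
qed

text \<open>Test functions give the increment formula only between positive points. Continuity of u
  at 0, and integrability of the weak derivative up to 0 as a consequence of its square
  integrability, allow the left endpoint to tend to 0.\<close>

lemma H1_is_primitive:
  assumes "u \<in> H1"
  shows "is_primitive u (weak_deriv u)"
  unfolding is_primitive_def
proof (intro allI impI conjI)
  note D = H1_D[OF assms]
  fix b :: real assume "b \<ge> 0"
  show int: "set_integrable lborel {0<..b} (weak_deriv u)"
    by (rule square_integrable_Ioc[OF D(4)])
  show "u b = u 0 + (LBINT x:{0<..b}. weak_deriv u x)"
  proof (cases "b = 0")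
    case False
    then have "b > 0" using \<open>b \<ge> 0\<close> by simp
    \<comment> \<open>The denominator starts at 2, so that a n < b holds from n = 0 on.\<close>
    define a where "a = (\<lambda>n. b / real (Suc (Suc n)))"
    have a: "0 < a n" "a n < b" for n
      using \<open>b > 0\<close> unfolding a_def by (auto simp: field_simps add_pos_nonneg)
    have a0: "a \<longlonglongrightarrow> 0"
      unfolding a_def by (rule LIMSEQ_Suc[OF LIMSEQ_Suc[OF lim_const_over_n]])
    have "(\<lambda>n. u (a n)) \<longlonglongrightarrow> u 0"
      by (rule continuous_on_tendsto_compose[OF D(1) a0]) (use a in \<open>auto intro!: always_eventually less_imp_le\<close>)
    then have "(\<lambda>n. u b - u (a n)) \<longlonglongrightarrow> u b - u 0" by (intro tendsto_intros)
    moreover have "u b - u (a n) = (LBINT x:{a n<..b}. weak_deriv u x)" for n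
      by (rule has_weak_deriv_increment[OF D(3) continuous_on_subset[OF D(1)] a]) auto
    moreover have "(\<lambda>n. LBINT x:{a n<..b}. weak_deriv u x) \<longlonglongrightarrow> (LBINT x:{0<..b}. weak_deriv u x)"
      unfolding set_lebesgue_integral_def
    proof (rule integral_dominated_convergence[where w = "\<lambda>x. norm (indicator {0<..b} x *\<^sub>R weak_deriv u x)"])
      show "integrable lborel (\<lambda>x. norm (indicator {0<..b} x *\<^sub>R weak_deriv u x))"
        using int unfolding set_integrable_def by (rule integrable_norm)
      show "(\<lambda>x. indicator {0<..b} x *\<^sub>R weak_deriv u x) \<in> borel_measurable lborel"
        using int unfolding set_integrable_def by blast
      have "set_integrable lborel {a n<..b} (weak_deriv u)" for n
        by (rule set_integrable_subset[OF int]) (use a[of n] in auto)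
      then show "(\<lambda>x. indicator {a n<..b} x *\<^sub>R weak_deriv u x) \<in> borel_measurable lborel" for n
        unfolding set_integrable_def by blast
      show "AE x in lborel. (\<lambda>n. indicator {a n<..b} x *\<^sub>R weak_deriv u x) \<longlonglongrightarrow> indicator {0<..b} x *\<^sub>R weak_deriv u x"
      proof (rule AE_I2)
        fix x
        have "\<forall>\<^sub>F n in sequentially. indicator {a n<..b} x *\<^sub>R weak_deriv u x = indicator {0<..b} x *\<^sub>R weak_deriv u x"
        proof (cases "x > 0")
          case True
          have "\<forall>\<^sub>F n in sequentially. a n < x" using order_tendstoD(2)[OF a0 True] .
          then show ?thesis by eventually_elim (use True in \<open>auto simp: indicator_def\<close>)
        next
          case False
          then have "\<not> a n < x" for n using a(1)[of n] by simp
          with False show ?thesis by (simp add: indicator_def)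
        qed
        then show "(\<lambda>n. indicator {a n<..b} x *\<^sub>R weak_deriv u x) \<longlonglongrightarrow> indicator {0<..b} x *\<^sub>R weak_deriv u x"
          by (rule tendsto_eventually)
      qed
      show "AE x in lborel. norm (indicator {a n<..b} x *\<^sub>R weak_deriv u x) \<le> norm (indicator {0<..b} x *\<^sub>R weak_deriv u x)" for n
        using a[of n] by (intro AE_I2) (auto simp: indicator_def)
    qed
    ultimately show ?thesis using LIMSEQ_unique by fastforce
  qed (simp add: set_lebesgue_integral_def)
qed

text \<open>The product rule gives (u^2)' = 2 u u', and u u' is integrable as a product of two
  square integrable functions, so u^2 differs from its value at 0 by a bounded amount.\<close>

lemma H1_bounded:
  assumes "u \<in> H1"
  obtains M where "\<And>x. x \<ge> 0 \<Longrightarrow> \<bar>u x\<bar> \<le> M"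
proof -
  let ?v = "weak_deriv u"
  note D = H1_D[OF assms]
  have int: "set_integrable lborel {0<..} (\<lambda>x. u x * ?v x)"
    by (rule square_integrable_mult[OF D(2,4)])
  then have int': "set_integrable lborel {0<..} (\<lambda>x. \<bar>u x * ?v x\<bar>)"
    by (rule set_integrable_abs)
  define K where "K = (LBINT x:{0<..}. \<bar>u x * ?v x\<bar>)"
  have "\<bar>u x\<bar> \<le> sqrt ((u 0)\<^sup>2 + 2 * K)" if "x \<ge> 0" for x
  proof -
    have sub: "set_integrable lborel {0<..x} (\<lambda>x. u x * ?v x)" "set_integrable lborel {0<..x} (\<lambda>x. \<bar>u x * ?v x\<bar>)"
      by (rule set_integrable_subset[OF int] set_integrable_subset[OF int']; auto)+
    have "u x * u x - u 0 * u 0 = (LBINT x:{0<..x}. u x * ?v x + u x * ?v x)"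
      using is_primitiveD(2)[OF is_primitive_mult[OF H1_is_primitive[OF assms] H1_is_primitive[OF assms]] that] by simp
    also have "\<dots> = 2 * (LBINT x:{0<..x}. u x * ?v x)"
      using set_integral_add(2)[OF sub(1) sub(1)] by simp
    also have "(LBINT x:{0<..x}. u x * ?v x) \<le> (LBINT x:{0<..x}. \<bar>u x * ?v x\<bar>)"
      by (rule set_integral_mono[OF sub]) auto
    also have "\<dots> \<le> K"
      unfolding K_def set_lebesgue_integral_def
      using sub(2) int' unfolding set_integrable_def by (rule integral_mono) (auto simp: indicator_def)
    finally have "(u x)\<^sup>2 \<le> (u 0)\<^sup>2 + 2 * K" by (simp add: power2_eq_square)
    then show ?thesis using real_le_rsqrt by (metis power2_abs)
  qed
  with that show thesis by blast
qed

lemma H1_pow6_integrable: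
  assumes "u \<in> H1"
  shows "set_integrable lborel {0<..} (\<lambda>x. (u x) ^ 6)"
proof -
  obtain M where M: "\<And>x. x \<ge> 0 \<Longrightarrow> \<bar>u x\<bar> \<le> M" using H1_bounded[OF assms] by blast
  note D = H1_D[OF assms]
  show ?thesis
    unfolding set_integrable_def
  proof (rule Bochner_Integration.integrable_bound)
    show "integrable lborel (\<lambda>x. M ^ 4 * (indicator {0<..} x *\<^sub>R (u x)\<^sup>2))"
      using D(2) unfolding square_integrable_def set_integrable_def by (intro integrable_mult_right) auto
    have "(\<lambda>x. (indicator {0<..} x *\<^sub>R u x) ^ 6) \<in> borel_measurable lborel"
      using D(2) unfolding square_integrable_def set_borel_measurable_def by (intro borel_measurable_power) auto
    then show "(\<lambda>x. indicator {0<..} x *\<^sub>R (u x) ^ 6) \<in> borel_measurable lborel"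
      by (rule measurable_cong[THEN iffD1, rotated]) (simp add: indicator_def)
    have "(u x) ^ 6 \<le> M ^ 4 * (u x)\<^sup>2" if "x > 0" for x
    proof -
      have "\<bar>u x\<bar> ^ 4 \<le> M ^ 4" using M[of x] that by (intro power_mono) auto
      then have "u x ^ 4 * (u x)\<^sup>2 \<le> M ^ 4 * (u x)\<^sup>2" by (intro mult_right_mono) auto
      then show ?thesis by (simp flip: power_add)
    qed
    then show "AE x in lborel. norm (indicator {0<..} x *\<^sub>R (u x) ^ 6) \<le> norm (M ^ 4 * (indicator {0<..} x *\<^sub>R (u x)\<^sup>2))"
      by (intro AE_I2) (auto simp: indicator_def)
  qed
qed

lemma energy_6_eq:
  "energy 6 \<alpha> u = 1 / 2 * (LBINT x:{0<..}. \<bar>weak_deriv u x\<bar>\<^sup>2) - 1 / 6 * (LBINT x:{0<..}. (u x) ^ 6) + \<alpha> / 2 * (u 0)\<^sup>2"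
proof -
  have "\<bar>y\<bar> powr 6 = y ^ 6" for y :: real
    by (cases "y = 0") (simp_all add: powr_numeral)
  then show ?thesis unfolding energy_def by simp
qed

text \<open>Decay along a sequence is what the boundary term of the calibration asks for. If u^2
  stayed above e beyond some point, an interval longer than the total integral divided by e would
  already exceed that integral.\<close>

lemma square_integrable_vanishing_sequence:
  fixes u :: "real \<Rightarrow> real"
  assumes "set_integrable lborel {0<..} (\<lambda>x. (u x)\<^sup>2)"
  obtains X where "filterlim X at_top sequentially" "\<And>n. X n \<ge> 0" "(\<lambda>n. u (X n)) \<longlonglongrightarrow> 0"
proof -
  have "\<exists>x\<ge>real n. (u x)\<^sup>2 < e" if "e > 0" for n e
  proof (rule ccontr)
    assume "\<not> ?thesis"
    then have big: "e \<le> (u x)\<^sup>2" if "x \<ge> real n" for x using that by (meson not_le)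
    obtain K :: nat where K: "(LBINT x:{0<..}. (u x)\<^sup>2) / e < real K" using reals_Archimedean2 by blast
    have "(LBINT x:{real n<..real n + real K}. e) \<le> (LBINT x:{0<..}. (u x)\<^sup>2)"
      unfolding set_lebesgue_integral_def
    proof (rule integral_mono)
      show "integrable lborel (\<lambda>x. indicator {real n<..real n + real K} x *\<^sub>R e)"
        by (auto intro!: integrable_scaleR_left integrable_real_indicator)
      show "integrable lborel (\<lambda>x. indicator {0<..} x *\<^sub>R (u x)\<^sup>2)"
        using assms unfolding set_integrable_def .
      show "indicator {real n<..real n + real K} x *\<^sub>R e \<le> indicator {0<..} x *\<^sub>R (u x)\<^sup>2" for x
        using big[of x] by (auto simp: indicator_def)
    qed
    moreover have "(LBINT x:{real n<..real n + real K}. e) = real K * e"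
      unfolding set_lebesgue_integral_def by simp
    ultimately show False using K \<open>e > 0\<close> by (simp add: divide_less_eq mult.commute)
  qed
  then have "\<exists>x\<ge>real n. (u x)\<^sup>2 < 1 / real (Suc n)" for n by simp
  then obtain X where X: "\<And>n. X n \<ge> real n" "\<And>n. (u (X n))\<^sup>2 < 1 / real (Suc n)" by metis
  show thesis
  proof
    show "filterlim X at_top sequentially"
      by (rule filterlim_at_top_mono[OF filterlim_real_sequentially]) (use X in auto)
    show "X n \<ge> 0" for n using X(1)[of n] by linarith
    have "(\<lambda>n. (u (X n))\<^sup>2) \<longlonglongrightarrow> 0"
      by (rule Lim_null_comparison[OF _ LIMSEQ_Suc[OF lim_1_over_n]])
        (use X(2) in \<open>auto intro!: always_eventually less_imp_le\<close>)
    then have "(\<lambda>n. sqrt ((u (X n))\<^sup>2)) \<longlonglongrightarrow> sqrt 0" by (intro tendsto_intros)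
    then show "(\<lambda>n. u (X n)) \<longlonglongrightarrow> 0"
      by (simp add: tendsto_rabs_zero_iff)
  qed
qed

lemma DERIV_integral_Ioc:
  fixes f :: "real \<Rightarrow> real"
  assumes "continuous_on {0..} f" "x \<ge> 0"
  shows "((\<lambda>x. LBINT t:{0<..x}. f t) has_real_derivative f x) (at x within {0..})"
proof -
  have c: "continuous_on {0..x + 1} f" by (rule continuous_on_subset[OF assms(1)]) auto
  have "((\<lambda>y. integral {0..y} f) has_real_derivative f x) (at x within {0..x + 1})"
    by (rule integral_has_real_derivative[OF c]) (use assms(2) in auto)
  then have "((\<lambda>y. LBINT t:{0<..y}. f t) has_real_derivative f x) (at x within {0..x + 1})"
  proof (rule has_field_derivative_transform_within[of _ _ _ _ 1])
    fix y assume y: "y \<in> {0..x + 1}"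
    have "integral {0..y} f = (LBINT t:{0..y}. f t)"
      using y by (intro set_borel_integral_eq_integral(2)[symmetric] borel_integrable_atLeastAtMost' continuous_on_subset[OF c]) auto
    also have "\<dots> = (LBINT t:{0<..y}. f t)"
      using y interval_integral_Icc[of 0 y f] interval_integral_Ioc[of 0 y f] by (simp add: zero_ereal_def)
    finally show "integral {0..y} f = (LBINT t:{0<..y}. f t)" .
  qed (use assms(2) in auto)
  moreover have "at x within {0..x + 1} = at x within {0..}"
    by (rule at_within_nhd[of _ "{x - 1<..<x + 1}"]) auto
  ultimately show ?thesis by simp
qed

section \<open>Calibration of the energy\<close>

definition kappa :: real where "kappa = 2 / sqrt 3"

lemma kappa: "kappa > 0" "kappa\<^sup>2 = 4 / 3" "kappa * kappa = 4 / 3"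
  by (simp_all add: kappa_def power_divide flip: power2_eq_square)

text \<open>kappa times the mass to the right of x, shifted by e; for e = 0 it is the mass
  coordinate itself. Writing the tail as the total minus an integral from 0 makes its derivative
  immediate.\<close>

definition angle :: "real \<Rightarrow> (real \<Rightarrow> real) \<Rightarrow> real \<Rightarrow> real" where
  "angle e u x = kappa * (mass u - (LBINT t:{0<..x}. (u t)\<^sup>2)) + e"

lemma angle_0 [simp]: "angle e u 0 = kappa * mass u + e"
  by (simp add: angle_def set_lebesgue_integral_def)

lemma H1_mass_split:
  assumes "u \<in> H1"
  shows "set_integrable lborel {0<..} (\<lambda>x. (u x)\<^sup>2)" "mass u = (LBINT x:{0<..}. (u x)\<^sup>2)"
    "x \<ge> 0 \<Longrightarrow> mass u - (LBINT t:{0<..x}. (u t)\<^sup>2) = (LBINT t:{x<..}. (u t)\<^sup>2)"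
proof -
  show int: "set_integrable lborel {0<..} (\<lambda>x. (u x)\<^sup>2)"
    using H1_D(2)[OF assms] unfolding square_integrable_def by blast
  show m: "mass u = (LBINT x:{0<..}. (u x)\<^sup>2)"
    unfolding mass_def by simp
  show "mass u - (LBINT t:{0<..x}. (u t)\<^sup>2) = (LBINT t:{x<..}. (u t)\<^sup>2)" if "x \<ge> 0"
  proof -
    have un: "{0<..} = {0<..x} \<union> {x<..}" using that by auto
    have "(LBINT t:{0<..}. (u t)\<^sup>2) = (LBINT t:{0<..x}. (u t)\<^sup>2) + (LBINT t:{x<..}. (u t)\<^sup>2)"
      unfolding un by (rule set_integral_Un; (rule set_integrable_subset[OF int])?) (use that in auto)
    with m show ?thesis by simp
  qed
qed

lemma set_integral_nonneg_real:
  fixes f :: "real \<Rightarrow> real"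
  assumes "\<And>x. x \<in> A \<Longrightarrow> f x \<ge> 0"
  shows "(LBINT x:A. f x) \<ge> 0"
  unfolding set_lebesgue_integral_def
  by (rule Bochner_Integration.integral_nonneg) (use assms in \<open>auto simp: indicator_def\<close>)

lemma angle_bounds:
  assumes "u \<in> H1" "x \<ge> 0"
  shows "e \<le> angle e u x" "angle e u x \<le> kappa * mass u + e"
    "positive_on_half_line u \<Longrightarrow> e < angle e u x"
proof -
  note m = H1_mass_split[OF assms(1)]
  have tail: "mass u - (LBINT t:{0<..x}. (u t)\<^sup>2) \<ge> 0"
    unfolding m(3)[OF assms(2)] by (rule set_integral_nonneg_real) simp
  then show "e \<le> angle e u x" unfolding angle_def using kappa(1) by simp
  have "(LBINT t:{0<..x}. (u t)\<^sup>2) \<ge> 0" by (rule set_integral_nonneg_real) simp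
  then show "angle e u x \<le> kappa * mass u + e" unfolding angle_def using kappa(1) by simp
  assume pos: "positive_on_half_line u"
  have "mass u - (LBINT t:{0<..x}. (u t)\<^sup>2) \<noteq> 0"
  proof
    assume "mass u - (LBINT t:{0<..x}. (u t)\<^sup>2) = 0"
    then have z: "(LBINT t:{x<..}. (u t)\<^sup>2) = 0" using m(3)[OF assms(2)] by simp
    have "set_integrable lborel {x<..} (\<lambda>x. (u x)\<^sup>2)"
      by (rule set_integrable_subset[OF m(1)]) (use assms(2) in auto)
    then have "AE t in lborel. indicator {x<..} t *\<^sub>R (u t)\<^sup>2 = 0"
      using z integral_nonneg_eq_0_iff_AE[of lborel "\<lambda>t. indicator {x<..} t *\<^sub>R (u t)\<^sup>2"]
      unfolding set_integrable_def set_lebesgue_integral_def by simp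
    \<comment> \<open>A vanishing tail makes u zero almost everywhere beyond x; positivity then
      turns an interval of length 1 into a null set.\<close>
    then have "AE t in lborel. t \<notin> {x<..<x + 1}"
    proof eventually_elim
      case (elim t)
      show ?case
      proof
        assume "t \<in> {x<..<x + 1}"
        then have "t > x" "u t > 0" using pos assms(2) by (auto simp: positive_on_half_line_def)
        with elim show False by simp
      qed
    qed
    then have "{x<..<x + 1} \<in> null_sets lborel"
      by (subst AE_iff_null_sets) auto
    then show False by (simp add: null_sets_def)
  qed
  with tail have "mass u - (LBINT t:{0<..x}. (u t)\<^sup>2) > 0" by simp
  then show "e < angle e u x" unfolding angle_def using kappa(1) by simp
qed

lemma DERIV_angle:
  assumes "u \<in> H1" "x \<ge> 0"
  shows "(angle e u has_real_derivative - kappa * (u x)\<^sup>2) (at x within {0..})"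
proof -
  have "continuous_on {0..} (\<lambda>x. (u x)\<^sup>2)"
    by (intro continuous_intros H1_D(1)[OF assms(1)])
  from DERIV_integral_Ioc[OF this assms(2)] show ?thesis
    unfolding angle_def by (auto intro!: derivative_eq_intros)
qed

text \<open>As a function of its argument the cotangent solves the Riccati equation G' = - (1 +
  G^2), and the chain rule adds the factor - kappa u^2. The form in terms of the cotangent itself,
  instead of the sine, is the one that completes the square.\<close>

lemma DERIV_cot_angle:
  assumes "u \<in> H1" "x \<ge> 0" "0 < angle e u x" "angle e u x < pi"
  shows "((\<lambda>x. cot (angle e u x)) has_real_derivative kappa * (u x)\<^sup>2 * (1 + (cot (angle e u x))\<^sup>2)) (at x within {0..})"
proof -
  have s: "sin (angle e u x) > 0" by (rule sin_gt_zero) (use assms in auto)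
  have "((\<lambda>x. cot (angle e u x)) has_real_derivative - inverse ((sin (angle e u x))\<^sup>2) * (- kappa * (u x)\<^sup>2)) (at x within {0..})"
    by (rule DERIV_chain2[OF DERIV_cot DERIV_angle[OF assms(1,2)]]) (use s in simp)
  moreover have "inverse ((sin (angle e u x))\<^sup>2) = 1 + (cot (angle e u x))\<^sup>2"
    using s sin_cos_squared_add[of "angle e u x"] by (simp add: cot_def power_divide field_simps)
  ultimately have "((\<lambda>x. cot (angle e u x)) has_real_derivative - (1 + (cot (angle e u x))\<^sup>2) * (- kappa * (u x)\<^sup>2)) (at x within {0..})"
    by (simp only:)
  moreover have "- (1 + (cot (angle e u x))\<^sup>2) * (- kappa * (u x)\<^sup>2) = kappa * (u x)\<^sup>2 * (1 + (cot (angle e u x))\<^sup>2)"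
    by (simp add: algebra_simps)
  ultimately show ?thesis by (simp only:)
qed

text \<open>This is the Riccati completion of the square for the energy as a quadratic functional of \<open>u\<^sup>2\<close> in
  the mass coordinate \<open>\<theta>\<close>; the constant of \<open>kappa\<close> is chosen so that the sixth powers cancel.\<close>

lemma calibration_identity:
  assumes u: "u \<in> H1" and ang: "\<forall>x\<ge>0. 0 < angle e u x \<and> angle e u x < pi" and X: "X \<ge> 0"
  shows "set_integrable lborel {0<..X} (\<lambda>x. (weak_deriv u x + kappa / 2 * cot (angle e u x) * u x ^ 3)\<^sup>2)"
    and "1 / 2 * (LBINT x:{0<..X}. (weak_deriv u x + kappa / 2 * cot (angle e u x) * u x ^ 3)\<^sup>2)
      = 1 / 2 * (LBINT x:{0<..X}. (weak_deriv u x)\<^sup>2) - 1 / 6 * (LBINT x:{0<..X}. u x ^ 6)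
        + kappa / 8 * (cot (angle e u X) * u X ^ 4 - cot (kappa * mass u + e) * u 0 ^ 4)"
proof -
  define v where "v = weak_deriv u"
  define G where "G = (\<lambda>x. cot (angle e u x))"
  define g where "g = (\<lambda>x. kappa * (u x)\<^sup>2 * (1 + (G x)\<^sup>2))"
  note D = H1_D[OF u]
  have DG: "(G has_real_derivative g x) (at x within {0..})" if "x \<ge> 0" for x
    unfolding G_def g_def using DERIV_cot_angle[OF u that] ang that by blast
  have cG: "continuous_on {0..} G"
    by (rule DERIV_continuous_on[of _ G g]) (use DG in auto)
  have cg: "continuous_on {0..} g"
    unfolding g_def by (intro continuous_intros D(1) cG)
  have Gp: "is_primitive G g" by (rule is_primitiveI_DERIV[OF DG cg])
  have up: "is_primitive u v" unfolding v_def by (rule H1_is_primitive[OF u])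
  note u2 = is_primitive_mult[OF up up]
  note u4 = is_primitive_mult[OF u2 u2]
  note Gu4 = is_primitive_mult[OF Gp u4]
  \<comment> \<open>The density of cot(\<theta>) u^4 in the exact shape in which
    \<open>is_primitive_mult\<close> delivers it. Its part free of \<open>G\<close> is kappa u^6,
    which is what meets the sixth power of the energy.\<close>
  define b where "b = (\<lambda>x. u x * u x * (u x * u x) * g x + G x * (u x * u x * (u x * v x + u x * v x) + u x * u x * (u x * v x + u x * v x)))"
  have bi: "set_integrable lborel {0<..X} b" and bI: "(LBINT x:{0<..X}. b x) = G X * u X ^ 4 - G 0 * u 0 ^ 4"
    using is_primitiveD[OF Gu4 X] unfolding b_def by (simp_all add: power4_eq_xxxx mult.assoc)
  have v2: "set_integrable lborel {0<..X} (\<lambda>x. (v x)\<^sup>2)"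
    by (rule set_integrable_subset[of _ "{0<..}"]) (use D(4) in \<open>auto simp: v_def square_integrable_def\<close>)
  have u6: "set_integrable lborel {0<..X} (\<lambda>x. u x ^ 6)"
    by (rule set_integrable_subset[OF H1_pow6_integrable[OF u]]) auto
  have eq: "(v x + kappa / 2 * G x * u x ^ 3)\<^sup>2 = ((v x)\<^sup>2 - 1 / 3 * u x ^ 6) + kappa / 4 * b x" for x
  proof -
    have "(v x + kappa / 2 * G x * u x ^ 3)\<^sup>2 = (v x)\<^sup>2 + kappa * (G x * u x ^ 3 * v x) + kappa\<^sup>2 / 4 * ((G x)\<^sup>2 * u x ^ 6)"
      by (simp add: power2_eq_square algebra_simps power3_eq_cube eval_nat_numeral)
    moreover have "kappa / 4 * b x = kappa\<^sup>2 / 4 * (u x ^ 6 + (G x)\<^sup>2 * u x ^ 6) + kappa * (G x * u x ^ 3 * v x)"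
      unfolding b_def g_def by (simp add: power2_eq_square algebra_simps power3_eq_cube eval_nat_numeral)
    ultimately show ?thesis unfolding kappa(2) by (simp add: algebra_simps)
  qed
  have i1: "set_integrable lborel {0<..X} (\<lambda>x. (v x)\<^sup>2 - 1 / 3 * u x ^ 6)"
    by (intro set_integral_diff v2 set_integrable_mult_right u6)
  have i2: "set_integrable lborel {0<..X} (\<lambda>x. kappa / 4 * b x)"
    by (intro set_integrable_mult_right bi)
  have "set_integrable lborel {0<..X} (\<lambda>x. (v x + kappa / 2 * G x * u x ^ 3)\<^sup>2)"
    unfolding eq by (rule set_integral_add(1)[OF i1 i2])
  then show "set_integrable lborel {0<..X} (\<lambda>x. (weak_deriv u x + kappa / 2 * cot (angle e u x) * u x ^ 3)\<^sup>2)"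
    unfolding v_def G_def .
  have "(LBINT x:{0<..X}. (v x + kappa / 2 * G x * u x ^ 3)\<^sup>2)
      = (LBINT x:{0<..X}. (v x)\<^sup>2) - 1 / 3 * (LBINT x:{0<..X}. u x ^ 6) + kappa / 4 * (G X * u X ^ 4 - G 0 * u 0 ^ 4)"
    unfolding eq set_integral_add(2)[OF i1 i2]
    by (subst set_integral_diff(2)[OF v2 set_integrable_mult_right]) (use u6 bI in auto)
  then show "1 / 2 * (LBINT x:{0<..X}. (weak_deriv u x + kappa / 2 * cot (angle e u x) * u x ^ 3)\<^sup>2)
      = 1 / 2 * (LBINT x:{0<..X}. (weak_deriv u x)\<^sup>2) - 1 / 6 * (LBINT x:{0<..X}. u x ^ 6)
        + kappa / 8 * (cot (angle e u X) * u X ^ 4 - cot (kappa * mass u + e) * u 0 ^ 4)"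
    unfolding v_def G_def angle_0 by (simp add: algebra_simps)
qed

text \<open>The shift \<open>e > 0\<close> of the angle keeps the cotangent bounded, so the boundary term at infinity
  vanishes without any assumption on the decay or the zeros of \<open>u\<close>.\<close>

lemma energy_calibrated_bound_shifted:
  assumes u: "u \<in> H1" and e: "0 < e" "kappa * mass u + e < pi / 2" and Y: "Y \<ge> 0"
  shows "energy 6 \<alpha> u \<ge> kappa / 8 * cot (kappa * mass u + e) * u 0 ^ 4 + \<alpha> / 2 * (u 0)\<^sup>2
    + 1 / 2 * (LBINT x:{0<..Y}. (weak_deriv u x + kappa / 2 * cot (angle e u x) * u x ^ 3)\<^sup>2)"
proof -
  define v where "v = weak_deriv u"
  define q where "q = (\<lambda>x. (v x + kappa / 2 * cot (angle e u x) * u x ^ 3)\<^sup>2)"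
  define C where "C = cot (kappa * mass u + e) * u 0 ^ 4"
  note D = H1_D[OF u]
  have ang: "\<forall>x\<ge>0. 0 < angle e u x \<and> angle e u x < pi"
  proof (intro allI impI)
    fix x :: real assume "x \<ge> 0"
    from angle_bounds(1,2)[OF u this, of e] show "0 < angle e u x \<and> angle e u x < pi"
      using e by linarith
  qed
  note cal = calibration_identity[OF u ang, folded v_def, folded q_def C_def]
  have v2: "set_integrable lborel {0<..} (\<lambda>x. (v x)\<^sup>2)"
    using D(4) by (simp add: v_def square_integrable_def)
  note u6 = H1_pow6_integrable[OF u]
  obtain X where X: "filterlim X at_top sequentially" "\<And>n. X n \<ge> 0" "(\<lambda>n. u (X n)) \<longlonglongrightarrow> 0"
    using square_integrable_vanishing_sequence[OF H1_mass_split(1)[OF u]] by blast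
  \<comment> \<open>Both bounds on the angle enter: between e and pi/2 the sine is increasing, hence
    at least sin e, while the cosine is at most 1.\<close>
  have cot_le: "cot (angle e u x) \<le> 1 / sin e" if "x \<ge> 0" for x
  proof -
    have b: "e \<le> angle e u x" "angle e u x \<le> pi / 2" using angle_bounds(1,2)[OF u that, of e] e by auto
    have "sin e \<le> sin (angle e u x)" using b e by (intro sin_monotone_2pi_le) auto
    moreover have "sin e > 0" using e b by (intro sin_gt_zero) auto
    ultimately show ?thesis unfolding cot_def by (intro frac_le) auto
  qed
  \<comment> \<open>Only the remainder on \<open>{0<..Y}\<close> is kept while \<open>X n\<close>
    tends to infinity; the rest of the square is nonnegative and is discarded. A fixed Y serves the
    equality case, where the square is shown to vanish on every bounded interval.\<close>
  have upper: "1 / 2 * (LBINT x:{0<..Y}. q x) \<le> 1 / 2 * (LBINT x:{0<..}. (v x)\<^sup>2)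
      - 1 / 6 * (LBINT x:{0<..X n}. u x ^ 6) + kappa / 8 * (1 / sin e * u (X n) ^ 4 - C)" if "Y \<le> X n" for n
  proof -
    have "(LBINT x:{0<..Y}. q x) \<le> (LBINT x:{0<..X n}. q x)"
      unfolding set_lebesgue_integral_def using cal(1)[OF Y] cal(1)[OF X(2)[of n]] that unfolding set_integrable_def
      by (intro integral_mono) (auto simp: indicator_def q_def)
    moreover have "(LBINT x:{0<..X n}. (v x)\<^sup>2) \<le> (LBINT x:{0<..}. (v x)\<^sup>2)"
      unfolding set_lebesgue_integral_def
      using v2 set_integrable_subset[OF v2, of "{0<..X n}"] unfolding set_integrable_def
      by (intro integral_mono) (auto simp: indicator_def Ioc_subset_iff subset_eq)
    moreover have "cot (angle e u (X n)) * u (X n) ^ 4 \<le> 1 / sin e * u (X n) ^ 4"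
      by (intro mult_right_mono cot_le X(2)) simp
    then have "kappa / 8 * (cot (angle e u (X n)) * u (X n) ^ 4 - C) \<le> kappa / 8 * (1 / sin e * u (X n) ^ 4 - C)"
      using kappa(1) by (intro mult_left_mono) auto
    ultimately show ?thesis using cal(2)[OF X(2)[of n]] by linarith
  qed
  have "(\<lambda>n. 1 / 2 * (LBINT x:{0<..}. (v x)\<^sup>2) - 1 / 6 * (LBINT x:{0<..X n}. u x ^ 6)
        + kappa / 8 * (1 / sin e * u (X n) ^ 4 - C))
    \<longlonglongrightarrow> 1 / 2 * (LBINT x:{0<..}. (v x)\<^sup>2) - 1 / 6 * (LBINT x:{0<..}. u x ^ 6) + kappa / 8 * (1 / sin e * 0 ^ 4 - C)"
    by (intro tendsto_intros set_integral_Ioi_tendsto[OF u6 X(1)] X(3))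
  moreover have "\<forall>\<^sub>F n in sequentially. Y \<le> X n"
    using X(1) unfolding filterlim_at_top by blast
  then have "\<forall>\<^sub>F n in sequentially. 1 / 2 * (LBINT x:{0<..Y}. q x) \<le> 1 / 2 * (LBINT x:{0<..}. (v x)\<^sup>2)
      - 1 / 6 * (LBINT x:{0<..X n}. u x ^ 6) + kappa / 8 * (1 / sin e * u (X n) ^ 4 - C)"
    by eventually_elim (rule upper)
  ultimately have "1 / 2 * (LBINT x:{0<..Y}. q x) \<le>
      1 / 2 * (LBINT x:{0<..}. (v x)\<^sup>2) - 1 / 6 * (LBINT x:{0<..}. u x ^ 6) + kappa / 8 * (1 / sin e * 0 ^ 4 - C)"
    by (rule tendsto_lowerbound) simp
  moreover have "kappa / 8 * (1 / sin e * 0 ^ 4 - C) = - (kappa / 8 * cot (kappa * mass u + e) * u 0 ^ 4)"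
    by (simp add: C_def)
  ultimately show ?thesis
    using H1_D(6)[OF u D(3)] unfolding energy_6_eq q_def v_def by linarith
qed

section \<open>Removal of the shift of the angle\<close>

lemma cot_shift_tendsto:
  assumes "0 < a" "a < pi"
  shows "((\<lambda>e. cot (a + e)) \<longlongrightarrow> cot a) (at_right 0)"
proof -
  have "sin (a + 0) \<noteq> 0" using sin_gt_zero[OF assms] by simp
  then have "((\<lambda>e. cot (a + e)) \<longlongrightarrow> cot (a + 0)) (at_right 0)"
    by (intro tendsto_intros)
  then show ?thesis by simp
qed

text \<open>The shifted bound with Y = 0, where the remainder is empty, as the shift tends to 0 from
  the right; kappa times the mass is a point of continuity of the cotangent.\<close>

lemma energy_calibrated_bound:
  assumes u: "u \<in> H1" and m: "0 < mass u" "kappa * mass u < pi / 2"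
  shows "energy 6 \<alpha> u \<ge> kappa / 8 * cot (kappa * mass u) * u 0 ^ 4 + \<alpha> / 2 * (u 0)\<^sup>2"
proof -
  let ?f = "\<lambda>e. kappa / 8 * cot (kappa * mass u + e) * u 0 ^ 4 + \<alpha> / 2 * (u 0)\<^sup>2"
  have lt_pi: "kappa * mass u < pi" using m(2) pi_gt_zero by linarith
  have "(?f \<longlongrightarrow> kappa / 8 * cot (kappa * mass u) * u 0 ^ 4 + \<alpha> / 2 * (u 0)\<^sup>2) (at_right 0)"
    using m kappa(1) lt_pi by (intro tendsto_add tendsto_diff tendsto_mult tendsto_const cot_shift_tendsto) (auto intro: mult_pos_pos)
  moreover have "\<forall>\<^sub>F e in at_right 0. ?f e \<le> energy 6 \<alpha> u"
  proof -
    have "\<forall>\<^sub>F e in at_right 0. e < pi / 2 - kappa * mass u"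
      using m by (intro order_tendstoD(2)[OF tendsto_ident_at]) simp
    with eventually_at_right_less[of 0] show ?thesis
    proof eventually_elim
      case (elim e)
      then have e: "0 < e" "kappa * mass u + e < pi / 2" by auto
      have "(LBINT x:{0<..0}. (weak_deriv u x + kappa / 2 * cot (angle e u x) * u x ^ 3)\<^sup>2) = 0"
        by (simp add: set_lebesgue_integral_def)
      then show "?f e \<le> energy 6 \<alpha> u"
        using energy_calibrated_bound_shifted[OF u e order_refl, of \<alpha>] by simp
    qed
  qed
  ultimately show ?thesis by (rule tendsto_upperbound) simp
qed

text \<open>In the remainder the shift stands under the integral sign.
  \<open>calibration_identity\<close> trades it for terms in which the shift enters only through two
  values of the cotangent, so the limit is elementary. Positivity of u keeps the unshifted angle
  strictly positive, which makes the identity available at e = 0 as well.\<close>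

lemma energy_calibrated_equality:
  assumes u: "u \<in> H1" and m: "0 < mass u" "kappa * mass u < pi / 2" and pos: "positive_on_half_line u"
    and eq: "energy 6 \<alpha> u = kappa / 8 * cot (kappa * mass u) * u 0 ^ 4 + \<alpha> / 2 * (u 0)\<^sup>2"
    and Y: "Y \<ge> 0"
  shows "(LBINT x:{0<..Y}. (weak_deriv u x + kappa / 2 * cot (angle 0 u x) * u x ^ 3)\<^sup>2) = 0"
proof -
  let ?q = "\<lambda>e. 1 / 2 * (LBINT x:{0<..Y}. (weak_deriv u x + kappa / 2 * cot (angle e u x) * u x ^ 3)\<^sup>2)"
  let ?r = "\<lambda>e. 1 / 2 * (LBINT x:{0<..Y}. (weak_deriv u x)\<^sup>2) - 1 / 6 * (LBINT x:{0<..Y}. u x ^ 6)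
        + kappa / 8 * (cot (angle 0 u Y + e) * u Y ^ 4 - cot (kappa * mass u + e) * u 0 ^ 4)"
  let ?f = "\<lambda>e. kappa / 8 * cot (kappa * mass u + e) * u 0 ^ 4 + \<alpha> / 2 * (u 0)\<^sup>2 + ?r e"
  have ang0: "0 < angle 0 u x" "angle 0 u x < pi" if "x \<ge> 0" for x
    using angle_bounds(2,3)[OF u that, of 0] m pos pi_gt_zero by linarith+
  have shift: "angle e u x = angle 0 u x + e" for e x by (simp add: angle_def)
  have qr: "?q e = ?r e" if "0 \<le> e" "kappa * mass u + e < pi / 2" for e
  proof -
    have "\<forall>x\<ge>0. 0 < angle e u x \<and> angle e u x < pi"
    proof (intro allI impI)
      fix x :: real assume x: "x \<ge> 0"
      show "0 < angle e u x \<and> angle e u x < pi"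
        using angle_bounds(2)[OF u x, of e] ang0(1)[OF x] \<open>0 \<le> e\<close> \<open>kappa * mass u + e < pi / 2\<close> pi_gt_zero
        unfolding shift[of e x] by linarith
    qed
    from calibration_identity(2)[OF u this Y] show ?thesis unfolding shift[of e Y] by simp
  qed
  have lt_pi: "kappa * mass u < pi" using m(2) pi_gt_zero by linarith
  have "(?f \<longlongrightarrow> kappa / 8 * cot (kappa * mass u) * u 0 ^ 4 + \<alpha> / 2 * (u 0)\<^sup>2
      + (1 / 2 * (LBINT x:{0<..Y}. (weak_deriv u x)\<^sup>2) - 1 / 6 * (LBINT x:{0<..Y}. u x ^ 6)
        + kappa / 8 * (cot (angle 0 u Y) * u Y ^ 4 - cot (kappa * mass u) * u 0 ^ 4))) (at_right 0)"
    using m kappa(1) ang0[OF Y] lt_pi by (intro tendsto_add tendsto_diff tendsto_mult tendsto_const cot_shift_tendsto) (auto intro: mult_pos_pos)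
  moreover have "\<forall>\<^sub>F e in at_right 0. ?f e \<le> energy 6 \<alpha> u"
  proof -
    have "\<forall>\<^sub>F e in at_right 0. e < pi / 2 - kappa * mass u"
      using m by (intro order_tendstoD(2)[OF tendsto_ident_at]) simp
    with eventually_at_right_less[of 0] show ?thesis
    proof eventually_elim
      case (elim e)
      then have e: "0 < e" "kappa * mass u + e < pi / 2" by auto
      show "?f e \<le> energy 6 \<alpha> u"
        using energy_calibrated_bound_shifted[OF u e Y, of \<alpha>] qr[OF less_imp_le[OF e(1)] e(2)] by linarith
    qed
  qed
  ultimately have "kappa / 8 * cot (kappa * mass u) * u 0 ^ 4 + \<alpha> / 2 * (u 0)\<^sup>2 + ?r 0 \<le> energy 6 \<alpha> u"
    using tendsto_upperbound[of ?f _ "at_right 0" "energy 6 \<alpha> u"] by simp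
  with eq qr[of 0] m have "?q 0 \<le> 0" by simp
  moreover have "?q 0 \<ge> 0" using set_integral_nonneg_real[of "{0<..Y}"] by simp
  ultimately show ?thesis by simp
qed

section \<open>Solitons\<close>

text \<open>A translated soliton of - u'' - u^5 + (A^2/3) u = 0: A is the maximum of u^2 on the
  whole line and kappa A the rate of the hyperbolic argument. For b > 0 the half-line sees only a
  decreasing tail; b = 0 gives the half soliton.\<close>

definition soliton :: "real \<Rightarrow> real \<Rightarrow> real \<Rightarrow> real" where
  "soliton A b x = sqrt (A / cosh (kappa * A * x + b))"

definition soliton_deriv :: "real \<Rightarrow> real \<Rightarrow> real \<Rightarrow> real" where
  "soliton_deriv A b x = - (kappa * A / 2) * tanh (kappa * A * x + b) * soliton A b x"

lemma one_minus_tanh_sq: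
  fixes y :: real
  shows "1 - (tanh y)\<^sup>2 = 1 / (cosh y)\<^sup>2"
proof -
  have "1 - (tanh y)\<^sup>2 = ((cosh y)\<^sup>2 - (sinh y)\<^sup>2) / (cosh y)\<^sup>2"
    by (simp add: tanh_def power_divide diff_divide_distrib)
  then show ?thesis by (simp add: cosh_square_eq)
qed

text \<open>Gudermannian substitution: 2 arctan(exp(- y)) is the angle \<theta> of a soliton at the
  point where kappa A x + b equals y, so these formulas translate between \<theta> and y.\<close>

lemma double_arctan_exp:
  fixes y :: real
  shows "sin (2 * arctan (exp (- y))) = 1 / cosh y" "cos (2 * arctan (exp (- y))) = tanh y"
    "cot (2 * arctan (exp (- y))) = sinh y"
proof -
  have s: "sqrt (1 + (exp (- y))\<^sup>2) * sqrt (1 + (exp (- y))\<^sup>2) = 1 + (exp (- y))\<^sup>2"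
    by simp
  have c: "cosh y = (1 + (exp (- y))\<^sup>2) / (2 * exp (- y))" "sinh y = (1 - (exp (- y))\<^sup>2) / (2 * exp (- y))"
    by (simp_all add: cosh_def sinh_def exp_minus field_simps power2_eq_square)
  show 1: "sin (2 * arctan (exp (- y))) = 1 / cosh y"
    unfolding sin_double sin_arctan cos_arctan c using s by (simp add: field_simps)
  have "cos (2 * arctan (exp (- y))) = (1 - (exp (- y))\<^sup>2) / (1 + (exp (- y))\<^sup>2)"
    unfolding cos_double sin_arctan cos_arctan power_divide by (simp add: diff_divide_distrib)
  also have "\<dots> = tanh y"
    unfolding tanh_def c by simp
  finally show 2: "cos (2 * arctan (exp (- y))) = tanh y" .
  show "cot (2 * arctan (exp (- y))) = sinh y"
    unfolding cot_def 1 2 by (simp add: tanh_def)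
qed

lemma integral_Ioi_primitive:
  assumes "is_primitive F f" "set_integrable lborel {0<..} f" "(F \<longlongrightarrow> L) at_top"
  shows "(LBINT x:{0<..}. f x) = L - F 0"
proof (rule LIMSEQ_unique)
  show "(\<lambda>n. LBINT x:{0<..real n}. f x) \<longlonglongrightarrow> (LBINT x:{0<..}. f x)"
    by (rule set_integral_Ioi_tendsto[OF assms(2) filterlim_real_sequentially])
  have "(\<lambda>n. F (real n) - F 0) \<longlonglongrightarrow> L - F 0"
    by (intro tendsto_diff tendsto_const filterlim_compose[OF assms(3) filterlim_real_sequentially])
  then show "(\<lambda>n. LBINT x:{0<..real n}. f x) \<longlonglongrightarrow> L - F 0"
    using is_primitiveD(2)[OF assms(1)] by simp
qed

context
  fixes A b :: real
  assumes A: "A > 0"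
begin

lemma soliton_pos: "soliton A b x > 0"
  unfolding soliton_def using A by simp

lemma soliton_sq: "(soliton A b x)\<^sup>2 = A / cosh (kappa * A * x + b)"
  unfolding soliton_def using A by simp

lemma DERIV_soliton: "(soliton A b has_real_derivative soliton_deriv A b x) (at x)"
proof -
  have "((\<lambda>x. A / cosh (kappa * A * x + b)) has_real_derivative
      - (kappa * A) * tanh (kappa * A * x + b) * (soliton A b x)\<^sup>2) (at x)"
    unfolding soliton_sq by (auto intro!: derivative_eq_intros simp: tanh_def power2_eq_square)
  from DERIV_chain2[OF DERIV_real_sqrt this]
  have "(soliton A b has_real_derivative inverse (soliton A b x) / 2 *
      (- (kappa * A) * tanh (kappa * A * x + b) * (soliton A b x)\<^sup>2)) (at x)"
    using A unfolding soliton_def[abs_def] by simp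
  moreover have "inverse (soliton A b x) / 2 * (- (kappa * A) * tanh (kappa * A * x + b) * (soliton A b x)\<^sup>2)
      = soliton_deriv A b x"
    unfolding soliton_deriv_def using soliton_pos[of x] by (simp add: power2_eq_square field_simps)
  ultimately show ?thesis by (simp only:)
qed

lemma DERIV_soliton2:
  "(soliton_deriv A b has_real_derivative
     A\<^sup>2 / 3 * soliton A b x - soliton A b x ^ 5) (at x)"
proof -
  let ?t = "tanh (kappa * A * x + b)" and ?U = "soliton A b x"
  have "(soliton_deriv A b has_real_derivative
     - (kappa * A / 2) * ((1 - ?t\<^sup>2) * (kappa * A)) * ?U + - (kappa * A / 2) * ?t * (- (kappa * A / 2) * ?t * ?U)) (at x)"
    unfolding soliton_deriv_def[abs_def]
    by (auto intro!: derivative_eq_intros DERIV_soliton[unfolded soliton_deriv_def] simp: field_simps power2_eq_square)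
  moreover have "- (kappa * A / 2) * ((1 - ?t\<^sup>2) * (kappa * A)) * ?U + - (kappa * A / 2) * ?t * (- (kappa * A / 2) * ?t * ?U)
     = A\<^sup>2 / 3 * ?U - ?U ^ 5"
  proof -
    have "?U ^ 4 = A\<^sup>2 / (cosh (kappa * A * x + b))\<^sup>2"
      using soliton_sq[of x] by (metis power_divide power_mult numeral_Bit0 mult_2 power2_eq_square power4_eq_xxxx mult.assoc)
    then have U4: "?U ^ 4 = A\<^sup>2 * (1 - ?t\<^sup>2)" by (simp add: one_minus_tanh_sq)
    have "?U ^ 5 = ?U ^ 4 * ?U" by (simp add: eval_nat_numeral)
    then have U5: "?U ^ 5 = A\<^sup>2 * (1 - ?t\<^sup>2) * ?U" by (simp only: U4)
    have "- (kappa * A / 2) * ((1 - ?t\<^sup>2) * (kappa * A)) * ?U + - (kappa * A / 2) * ?t * (- (kappa * A / 2) * ?t * ?U)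
        = (kappa * kappa) * A\<^sup>2 * ?U * (?t\<^sup>2 / 4 - (1 - ?t\<^sup>2) / 2)"
      by (simp add: power2_eq_square field_simps)
    also have "\<dots> = A\<^sup>2 / 3 * ?U - ?U ^ 5"
      unfolding U5 kappa(3) by (simp add: field_simps)
    finally show ?thesis .
  qed
  ultimately show ?thesis by (simp only:)
qed

lemma continuous_soliton: "continuous_on S (soliton A b)"
  using DERIV_soliton by (meson DERIV_isCont continuous_at_imp_continuous_on)

lemma soliton_argument_at_top: "filterlim (\<lambda>x. kappa * A * x + b) at_top at_top"
proof -
  have "filterlim (\<lambda>x. b + (kappa * A) * x) at_top at_top"
    by (rule filterlim_tendsto_add_at_top[OF tendsto_const filterlim_tendsto_pos_mult_at_top[OF tendsto_const _ filterlim_ident]])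
      (use A kappa(1) in simp)
  then show ?thesis by (simp add: add.commute)
qed

lemma soliton_mass:
  "set_integrable lborel {0<..} (\<lambda>x. (soliton A b x)\<^sup>2)"
  "(LBINT x:{0<..}. (soliton A b x)\<^sup>2) = 2 / kappa * arctan (exp (- b))"
proof -
  \<comment> \<open>This is - \<theta>/kappa along the soliton, and u^2 = - \<theta>'/kappa.\<close>
  let ?F = "\<lambda>x. - (2 / kappa) * arctan (exp (- (kappa * A * x + b)))"
  have D: "(?F has_real_derivative (soliton A b x)\<^sup>2) (at x)" for x
  proof -
    have "(?F has_real_derivative - (2 / kappa) * (exp (- (kappa * A * x + b)) * - (kappa * A) / (1 + (exp (- (kappa * A * x + b)))\<^sup>2))) (at x)"
      by (auto intro!: derivative_eq_intros simp: divide_inverse mult_ac)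
    moreover have "- (2 / kappa) * (exp (- y) * - (kappa * A) / (1 + (exp (- y))\<^sup>2)) = A / cosh y" for y
    proof -
      have c: "cosh y = (1 + (exp (- y))\<^sup>2) / (2 * exp (- y))"
        by (simp add: cosh_def exp_minus field_simps power2_eq_square)
      have "1 + (exp (- y))\<^sup>2 > 0" by (simp add: add_pos_nonneg)
      then show ?thesis unfolding c using kappa(1) by (simp add: field_simps)
    qed
    ultimately show ?thesis unfolding soliton_sq by (simp only:)
  qed
  have c2: "continuous_on S (\<lambda>x. (soliton A b x)\<^sup>2)" for S by (intro continuous_intros continuous_soliton)
  have P: "is_primitive ?F (\<lambda>x. (soliton A b x)\<^sup>2)"
    by (rule is_primitiveI_DERIV[OF has_field_derivative_at_within[OF D] c2])
  have "((\<lambda>x. exp (- (kappa * A * x + b))) \<longlongrightarrow> 0) at_top"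
    by (rule filterlim_compose[OF exp_at_bot filterlim_compose[OF filterlim_uminus_at_bot_at_top soliton_argument_at_top]])
  then have "(?F \<longlongrightarrow> - (2 / kappa) * arctan 0) at_top"
    by (intro tendsto_intros)
  then have L: "(?F \<longlongrightarrow> 0) at_top" by simp
  have "(\<integral>\<^sup>+x. ennreal ((soliton A b x)\<^sup>2) * indicator {0..} x \<partial>lborel) = ennreal (0 - ?F 0)"
    by (rule nn_integral_FTC_atLeast[OF _ D _ L]) (use c2[of UNIV] in \<open>auto intro: borel_measurable_continuous_onI\<close>)
  then have fin: "(\<integral>\<^sup>+x. ennreal (indicator {0..} x *\<^sub>R (soliton A b x)\<^sup>2) \<partial>lborel) < \<infinity>"
    by (simp add: indicator_mult_ennreal mult.commute)
  have "(\<lambda>x. indicator {0..} x *\<^sub>R (soliton A b x)\<^sup>2) \<in> borel_measurable lborel"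
    using borel_measurable_continuous_on_indicator[of "{0..}", OF _ c2] by simp
  then have "set_integrable lborel {0..} (\<lambda>x. (soliton A b x)\<^sup>2)"
    unfolding set_integrable_def using fin by (intro integrableI_nonneg) auto
  then show int: "set_integrable lborel {0<..} (\<lambda>x. (soliton A b x)\<^sup>2)"
    by (rule set_integrable_subset) auto
  show "(LBINT x:{0<..}. (soliton A b x)\<^sup>2) = 2 / kappa * arctan (exp (- b))"
    using integral_Ioi_primitive[OF P int L] by simp
qed

lemma set_integrable_soliton_dominated:
  assumes "continuous_on {0<..} f" "\<And>x. \<bar>f x\<bar> \<le> C * (soliton A b x)\<^sup>2"
  shows "set_integrable lborel {0<..} f"
  unfolding set_integrable_def
proof (rule Bochner_Integration.integrable_bound)
  show "integrable lborel (\<lambda>x. C * (indicator {0<..} x *\<^sub>R (soliton A b x)\<^sup>2))"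
    using soliton_mass(1) unfolding set_integrable_def by (rule integrable_mult_right)
  show "(\<lambda>x. indicator {0<..} x *\<^sub>R f x) \<in> borel_measurable lborel"
    using borel_measurable_continuous_on_indicator[of "{0<..}", OF _ assms(1)] by simp
  show "AE x in lborel. norm (indicator {0<..} x *\<^sub>R f x) \<le> norm (C * (indicator {0<..} x *\<^sub>R (soliton A b x)\<^sup>2))"
  proof (rule AE_I2)
    fix x
    have "\<bar>f x\<bar> \<le> \<bar>C * (soliton A b x)\<^sup>2\<bar>" using assms(2)[of x] by linarith
    then show "norm (indicator {0<..} x *\<^sub>R f x) \<le> norm (C * (indicator {0<..} x *\<^sub>R (soliton A b x)\<^sup>2))"
      by (auto simp: indicator_def)
  qed
qed

lemma soliton_energy_density:
  shows "continuous_on S (soliton_deriv A b)"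
    and "set_integrable lborel {0<..} (\<lambda>x. (soliton_deriv A b x)\<^sup>2)"
    and "set_integrable lborel {0<..} (\<lambda>x. soliton A b x ^ 6)"
    and "1 / 2 * (LBINT x:{0<..}. (soliton_deriv A b x)\<^sup>2) - 1 / 6 * (LBINT x:{0<..}. soliton A b x ^ 6)
      = kappa / 8 * A\<^sup>2 * sinh b / (cosh b)\<^sup>2"
proof -
  show cu': "continuous_on S (soliton_deriv A b)" for S
    using DERIV_soliton2 by (meson DERIV_isCont continuous_at_imp_continuous_on)
  show i1: "set_integrable lborel {0<..} (\<lambda>x. (soliton_deriv A b x)\<^sup>2)"
  proof (rule set_integrable_soliton_dominated)
    fix x
    have "\<bar>tanh (kappa * A * x + b)\<bar> \<le> 1"
      using tanh_real_bounds[of "kappa * A * x + b"] by auto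
    then have "(tanh (kappa * A * x + b))\<^sup>2 \<le> 1" by (simp add: abs_square_le_1)
    then have "(kappa * A / 2)\<^sup>2 * ((tanh (kappa * A * x + b))\<^sup>2 * (soliton A b x)\<^sup>2) \<le> (kappa * A / 2)\<^sup>2 * (1 * (soliton A b x)\<^sup>2)"
      by (intro mult_left_mono mult_right_mono) auto
    moreover have "(soliton_deriv A b x)\<^sup>2 = (kappa * A / 2)\<^sup>2 * ((tanh (kappa * A * x + b))\<^sup>2 * (soliton A b x)\<^sup>2)"
      unfolding soliton_deriv_def by (simp only: power_mult_distrib power2_minus mult.assoc)
    ultimately show "\<bar>(soliton_deriv A b x)\<^sup>2\<bar> \<le> (kappa * A / 2)\<^sup>2 * (soliton A b x)\<^sup>2"
      by simp
  qed (intro continuous_intros cu')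
  show i2: "set_integrable lborel {0<..} (\<lambda>x. soliton A b x ^ 6)"
  proof (rule set_integrable_soliton_dominated)
    fix x
    have "(soliton A b x)\<^sup>2 \<le> A"
      unfolding soliton_sq using A cosh_real_ge_1[of "kappa * A * x + b"] by (simp add: divide_le_eq mult_le_cancel_left1)
    then have "((soliton A b x)\<^sup>2)\<^sup>2 \<le> A\<^sup>2" by (intro power_mono) auto
    then have "((soliton A b x)\<^sup>2)\<^sup>2 * (soliton A b x)\<^sup>2 \<le> A\<^sup>2 * (soliton A b x)\<^sup>2"
      by (intro mult_right_mono) auto
    then show "\<bar>soliton A b x ^ 6\<bar> \<le> A\<^sup>2 * (soliton A b x)\<^sup>2"
      by (simp flip: power_mult power_add)
  qed (intro continuous_intros continuous_soliton)
  \<comment> \<open>On a soliton w = u^2 equals A sin \<theta>, so (dw/d\<theta>)^2 - w^2 is A^2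
    cos(2 \<theta>), with primitive A^2 sin \<theta> cos \<theta>, which is A^2 sinh y / (cosh y)^2
    in the variable y. The minus sign appears because \<theta> decreases in x.\<close>
  let ?E = "\<lambda>x. - (kappa / 8) * A\<^sup>2 * (sinh (kappa * A * x + b) / (cosh (kappa * A * x + b))\<^sup>2)"
  have D: "(?E has_real_derivative 1 / 2 * (soliton_deriv A b x)\<^sup>2 - 1 / 6 * soliton A b x ^ 6) (at x)" for x
  proof -
    let ?y = "kappa * A * x + b"
    have "((\<lambda>x. sinh (kappa * A * x + b) / (cosh (kappa * A * x + b))\<^sup>2) has_real_derivative
        (cosh ?y * (kappa * A) * (cosh ?y)\<^sup>2 - sinh ?y * (2 * cosh ?y * (sinh ?y * (kappa * A)))) / ((cosh ?y)\<^sup>2 * (cosh ?y)\<^sup>2)) (at x)"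
      by (auto intro!: derivative_eq_intros)
    from DERIV_cmult[OF this, of "- (kappa / 8) * A\<^sup>2"]
    have "(?E has_real_derivative - (kappa / 8) * A\<^sup>2 *
        ((cosh ?y * (kappa * A) * (cosh ?y)\<^sup>2 - sinh ?y * (2 * cosh ?y * (sinh ?y * (kappa * A)))) / ((cosh ?y)\<^sup>2 * (cosh ?y)\<^sup>2))) (at x)" .
    moreover have "- (kappa / 8) * A\<^sup>2 *
        ((cosh ?y * (kappa * A) * (cosh ?y)\<^sup>2 - sinh ?y * (2 * cosh ?y * (sinh ?y * (kappa * A)))) / ((cosh ?y)\<^sup>2 * (cosh ?y)\<^sup>2))
        = 1 / 2 * (soliton_deriv A b x)\<^sup>2 - 1 / 6 * soliton A b x ^ 6"
    proof -
      have "soliton A b x ^ 6 = ((soliton A b x)\<^sup>2) ^ 3" by (simp flip: power_mult)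
      then have 6: "soliton A b x ^ 6 = A ^ 3 / cosh ?y ^ 3" unfolding soliton_sq by (simp add: power_divide)
      have "(soliton_deriv A b x)\<^sup>2 = kappa\<^sup>2 * A\<^sup>2 / 4 * (sinh ?y / cosh ?y)\<^sup>2 * (soliton A b x)\<^sup>2"
        unfolding soliton_deriv_def[abs_def] by (simp add: power_mult_distrib power_divide tanh_def)
      then have 2: "(soliton_deriv A b x)\<^sup>2 = A ^ 3 / 3 * (sinh ?y)\<^sup>2 / cosh ?y ^ 3"
        unfolding soliton_sq kappa(2) by (simp add: power_divide eval_nat_numeral mult_ac)
      have "- (kappa / 8) * A\<^sup>2 *
        ((c * (kappa * A) * c\<^sup>2 - s * (2 * c * (s * (kappa * A)))) / (c\<^sup>2 * c\<^sup>2))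
        = 1 / 2 * (A ^ 3 / 3 * s\<^sup>2 / c ^ 3) - 1 / 6 * (A ^ 3 / c ^ 3)" if "c > 0" "c\<^sup>2 = s\<^sup>2 + 1" for c s
      proof -
        have "- (kappa / 8) * A\<^sup>2 * ((c * (kappa * A) * c\<^sup>2 - s * (2 * c * (s * (kappa * A)))) / (c\<^sup>2 * c\<^sup>2))
          = - (kappa * kappa / 8) * A ^ 3 * ((c\<^sup>2 - 2 * s\<^sup>2) / c ^ 3)"
          using that(1) by (simp add: field_simps eval_nat_numeral)
        also have "\<dots> = - (1 / 6) * A ^ 3 * ((1 - s\<^sup>2) / c ^ 3)"
          unfolding kappa(3) that(2) by simp
        finally show ?thesis using that(1) by (simp add: field_simps)
      qed
      from this[OF cosh_real_pos cosh_square_eq] show ?thesis unfolding 2 6 .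
    qed
    ultimately show ?thesis by (simp only:)
  qed
  have ce: "continuous_on {0..} (\<lambda>x. 1 / 2 * (soliton_deriv A b x)\<^sup>2 - 1 / 6 * soliton A b x ^ 6)"
    by (intro continuous_intros cu' continuous_soliton)
  have P: "is_primitive ?E (\<lambda>x. 1 / 2 * (soliton_deriv A b x)\<^sup>2 - 1 / 6 * soliton A b x ^ 6)"
    by (rule is_primitiveI_DERIV[OF has_field_derivative_at_within[OF D] ce])
  have L: "(?E \<longlongrightarrow> 0) at_top"
  proof -
    have "((\<lambda>y::real. 1 / cosh y) \<longlongrightarrow> 0) at_top"
      by (intro tendsto_divide_0[OF tendsto_const] filterlim_at_top_imp_at_infinity cosh_real_at_top)
    then have "((\<lambda>y. tanh y * (1 / cosh y)) \<longlongrightarrow> 1 * (0::real)) at_top"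
      by (intro tendsto_mult tanh_real_at_top)
    moreover have "(\<lambda>y::real. tanh y * (1 / cosh y)) = (\<lambda>y. sinh y / (cosh y)\<^sup>2)"
      by (simp add: tanh_def power2_eq_square fun_eq_iff)
    ultimately have "((\<lambda>y::real. sinh y / (cosh y)\<^sup>2) \<longlongrightarrow> 0) at_top" by simp
    from tendsto_mult[OF tendsto_const filterlim_compose[OF this soliton_argument_at_top]]
    have "(?E \<longlongrightarrow> - (kappa / 8) * A\<^sup>2 * 0) at_top" .
    then show ?thesis by simp
  qed
  have i3: "set_integrable lborel {0<..} (\<lambda>x. 1 / 2 * (soliton_deriv A b x)\<^sup>2 - 1 / 6 * soliton A b x ^ 6)"
    by (intro set_integral_diff set_integrable_mult_right i1 i2)
  have "(LBINT x:{0<..}. 1 / 2 * (soliton_deriv A b x)\<^sup>2 - 1 / 6 * soliton A b x ^ 6) = 0 - ?E 0"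
    by (rule integral_Ioi_primitive[OF P i3 L])
  moreover have "(LBINT x:{0<..}. 1 / 2 * (soliton_deriv A b x)\<^sup>2 - 1 / 6 * soliton A b x ^ 6)
      = 1 / 2 * (LBINT x:{0<..}. (soliton_deriv A b x)\<^sup>2) - 1 / 6 * (LBINT x:{0<..}. soliton A b x ^ 6)"
    by (subst set_integral_diff(2)) (auto intro!: set_integrable_mult_right i1 i2)
  ultimately show "1 / 2 * (LBINT x:{0<..}. (soliton_deriv A b x)\<^sup>2) - 1 / 6 * (LBINT x:{0<..}. soliton A b x ^ 6)
      = kappa / 8 * A\<^sup>2 * sinh b / (cosh b)\<^sup>2" by simp
qed

text \<open>The factor r scales the quadratic parts of the energy by r^2 and the negative
  sixth-power part by r^6, hence the inequality when r^2 \<ge> 1. The case r = 1 serves the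
  subcritical masses; r^2 \<ge> 1 with b = 0 reaches every mass from the critical one
  upwards.\<close>

lemma scaled_soliton:
  shows "(\<lambda>x. r * soliton A b x) \<in> H1"
    and "mass (\<lambda>x. r * soliton A b x) = r\<^sup>2 * (2 / kappa * arctan (exp (- b)))"
    and "r\<^sup>2 \<ge> 1 \<Longrightarrow> energy 6 \<alpha> (\<lambda>x. r * soliton A b x)
      \<le> r\<^sup>2 * (kappa / 8 * A\<^sup>2 * sinh b / (cosh b)\<^sup>2 + \<alpha> / 2 * (A / cosh b))"
    and "energy 6 \<alpha> (soliton A b) = kappa / 8 * A\<^sup>2 * sinh b / (cosh b)\<^sup>2 + \<alpha> / 2 * (A / cosh b)"
proof -
  define u' where "u' = soliton_deriv A b"
  note E = soliton_energy_density[folded u'_def]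
  define K where "K = (LBINT x:{0<..}. (u' x)\<^sup>2)"
  define P where "P = (LBINT x:{0<..}. soliton A b x ^ 6)"
  have KP: "1 / 2 * K - 1 / 6 * P = kappa / 8 * A\<^sup>2 * sinh b / (cosh b)\<^sup>2"
    using E(4) by (simp add: K_def P_def)
  have P0: "P \<ge> 0" unfolding P_def by (rule set_integral_nonneg_real) simp
  have meas: "set_borel_measurable lborel {0<..} f" if "continuous_on {0<..} f" for f :: "real \<Rightarrow> real"
    using borel_measurable_continuous_on_indicator[of "{0<..}", OF _ that] unfolding set_borel_measurable_def by simp
  have wd: "has_weak_deriv (\<lambda>x. r * soliton A b x) (\<lambda>x. r * u' x)" for r
    by (rule has_weak_deriv_classical)
      (auto intro!: continuous_intros soliton_energy_density(1) DERIV_cmult DERIV_soliton simp: u'_def)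
  have sq: "square_integrable (\<lambda>x. r * soliton A b x)" "square_integrable (\<lambda>x. r * u' x)" for r
    unfolding square_integrable_def power_mult_distrib
    by (auto intro!: meas continuous_intros E(1) continuous_soliton set_integrable_mult_right soliton_mass(1) E(2))
  show H: "(\<lambda>x. r * soliton A b x) \<in> H1" for r
    unfolding H1_def using wd[of r] sq[of r] by (auto intro!: continuous_intros continuous_soliton)
  show "mass (\<lambda>x. r * soliton A b x) = r\<^sup>2 * (2 / kappa * arctan (exp (- b)))"
    unfolding mass_def using soliton_mass(2) by (simp add: power_mult_distrib abs_mult)
  have en: "energy 6 \<alpha> (\<lambda>x. r * soliton A b x) = r\<^sup>2 * (1 / 2 * K) - r ^ 6 * (1 / 6 * P) + r\<^sup>2 * (\<alpha> / 2 * (A / cosh b))" for r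
  proof -
    have a1: "(LBINT x:{0<..}. \<bar>weak_deriv (\<lambda>x. r * soliton A b x) x\<bar>\<^sup>2) = r\<^sup>2 * K"
      unfolding H1_D(6)[OF H wd] K_def by (simp add: power_mult_distrib)
    have a2: "(LBINT x:{0<..}. (r * soliton A b x) ^ 6) = r ^ 6 * P"
      unfolding P_def by (simp add: power_mult_distrib)
    show ?thesis
      unfolding energy_6_eq a1 a2 by (simp add: power_mult_distrib soliton_sq)
  qed
  show "energy 6 \<alpha> (\<lambda>x. r * soliton A b x)
      \<le> r\<^sup>2 * (kappa / 8 * A\<^sup>2 * sinh b / (cosh b)\<^sup>2 + \<alpha> / 2 * (A / cosh b))" if "r\<^sup>2 \<ge> 1"
  proof -
    have "r\<^sup>2 * 1 \<le> r\<^sup>2 * ((r\<^sup>2) * (r\<^sup>2))"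
      using that by (intro mult_left_mono mult_ge1_I) auto
    then have "r\<^sup>2 \<le> r ^ 6" by (simp flip: power_add)
    then have "r\<^sup>2 * (1 / 6 * P) \<le> r ^ 6 * (1 / 6 * P)" using P0 by (intro mult_right_mono) auto
    then show ?thesis unfolding en KP[symmetric] by (simp add: algebra_simps)
  qed
  show "energy 6 \<alpha> (soliton A b) = kappa / 8 * A\<^sup>2 * sinh b / (cosh b)\<^sup>2 + \<alpha> / 2 * (A / cosh b)"
    using en[of 1] KP by simp
qed

end

section \<open>Equality in the calibration\<close>

text \<open>Positivity is demanded only for x > 0, but recovering a function from its square at 0
  needs a sign there, which the limit from the right supplies.\<close>

lemma nonneg_at_0_if_positive:
  assumes "continuous_on {0..} v" "positive_on_half_line v"
  shows "v 0 \<ge> 0"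
proof (rule tendsto_lowerbound)
  have "(v \<longlongrightarrow> v 0) (at 0 within {0..})"
    using assms(1) by (auto simp: continuous_on_def)
  then show "(v \<longlongrightarrow> v 0) (at_right 0)"
    by (rule tendsto_within_subset) auto
  show "\<forall>\<^sub>F x in at_right 0. 0 \<le> v x"
    using eventually_at_right_less[of "0::real"]
    by eventually_elim (use assms(2) in \<open>auto simp: positive_on_half_line_def intro: less_imp_le\<close>)
qed simp

lemma DERIV_zero_constant_half_line:
  fixes f :: "real \<Rightarrow> real"
  assumes "\<And>x. x \<ge> 0 \<Longrightarrow> (f has_real_derivative 0) (at x within {0..})" "x \<ge> 0"
  shows "f x = f 0"
proof -
  obtain c where "\<And>x. x \<in> {0..} \<Longrightarrow> f x = c"
    using has_field_derivative_zero_constant[of "{0::real..}" f] assms(1) by auto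
  then show ?thesis using assms(2) by auto
qed

lemma set_integral_square_zero_AE:
  fixes f :: "real \<Rightarrow> real"
  assumes "set_integrable lborel S (\<lambda>x. (f x)\<^sup>2)" "(LBINT x:S. (f x)\<^sup>2) = 0"
  shows "AE x in lborel. x \<in> S \<longrightarrow> f x = 0"
proof -
  have "AE x in lborel. indicator S x *\<^sub>R (f x)\<^sup>2 = 0"
    using assms integral_nonneg_eq_0_iff_AE[of lborel "\<lambda>x. indicator S x *\<^sub>R (f x)\<^sup>2"]
    unfolding set_integrable_def set_lebesgue_integral_def by simp
  then show ?thesis by eventually_elim (auto simp: indicator_def)
qed

text \<open>Regularity from equality: the square vanishes, so the weak derivative coincides almost
  everywhere with a continuous function, and u, being its primitive, is continuously differentiable
  up to 0.\<close>

lemma equality_DERIV: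
  assumes u: "u \<in> H1" and ang: "\<forall>x\<ge>0. 0 < angle 0 u x \<and> angle 0 u x < pi"
    and zero: "\<And>Y. Y \<ge> 0 \<Longrightarrow>
      (LBINT x:{0<..Y}. (weak_deriv u x + kappa / 2 * cot (angle 0 u x) * u x ^ 3)\<^sup>2) = 0"
    and x: "x \<ge> 0"
  shows "(u has_real_derivative - (kappa / 2 * cot (angle 0 u x) * u x ^ 3)) (at x within {0..})"
proof -
  define h where "h = (\<lambda>x. - (kappa / 2 * cot (angle 0 u x) * u x ^ 3))"
  have "((\<lambda>x. cot (angle 0 u x)) has_real_derivative kappa * (u x)\<^sup>2 * (1 + (cot (angle 0 u x))\<^sup>2)) (at x within {0..})"
    if "x \<in> {0..}" for x using DERIV_cot_angle[OF u, of x 0] ang that by simp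
  then have "continuous_on {0..} (\<lambda>x. cot (angle 0 u x))" by (rule DERIV_continuous_on)
  then have ch: "continuous_on {0..} h"
    unfolding h_def by (intro continuous_on_minus continuous_on_mult continuous_on_const continuous_on_power H1_D(1)[OF u])
  have rep: "u Y = u 0 + (LBINT x:{0<..Y}. h x)" if Y: "Y \<ge> 0" for Y
  proof -
    note P = is_primitiveD[OF H1_is_primitive[OF u] Y]
    have hi: "set_integrable lborel {0<..Y} h"
      by (intro set_integrable_continuous_Ioc continuous_on_subset[OF ch]) auto
    have "AE x in lborel. x \<in> {0<..Y} \<longrightarrow> weak_deriv u x + kappa / 2 * cot (angle 0 u x) * u x ^ 3 = 0"
      by (rule set_integral_square_zero_AE[OF calibration_identity(1)[OF u ang Y] zero[OF Y]])
    then have "AE x in lborel. indicator {0<..Y} x *\<^sub>R weak_deriv u x = indicator {0<..Y} x *\<^sub>R h x"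
      by eventually_elim (auto simp: h_def indicator_def)
    then have "(LBINT x:{0<..Y}. weak_deriv u x) = (LBINT x:{0<..Y}. h x)"
      using P(1) hi unfolding set_lebesgue_integral_def set_integrable_def
      by (intro integral_cong_AE borel_measurable_integrable) auto
    with P(2) show ?thesis by simp
  qed
  have "((\<lambda>Y. u 0 + (LBINT x:{0<..Y}. h x)) has_real_derivative h x) (at x within {0..})"
    by (auto intro!: derivative_eq_intros DERIV_integral_Ioc[OF ch x])
  then have "(u has_real_derivative h x) (at x within {0..})"
  proof (rule has_field_derivative_transform_within[of _ _ _ _ 1])
    show "u 0 + (LBINT x:{0<..y}. h x) = u y" if "y \<in> {0..}" for y
      using rep[of y] that by simp
  qed (use x in auto)
  then show ?thesis unfolding h_def .
qed

lemma equality_imp_soliton: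
  assumes u: "u \<in> H1" and m: "0 < mass u" "kappa * mass u < pi / 2" and pos: "positive_on_half_line u"
    and zero: "\<And>Y. Y \<ge> 0 \<Longrightarrow>
      (LBINT x:{0<..Y}. (weak_deriv u x + kappa / 2 * cot (angle 0 u x) * u x ^ 3)\<^sup>2) = 0"
    and b: "exp (- b) = tan (kappa * mass u / 2)" and x: "x \<ge> 0"
  shows "u x = soliton ((u 0)\<^sup>2 * cosh b) b x"
proof -
  have ang: "\<forall>x\<ge>0. 0 < angle 0 u x \<and> angle 0 u x < pi"
  proof (intro allI impI)
    fix x :: real assume x: "x \<ge> 0"
    show "0 < angle 0 u x \<and> angle 0 u x < pi"
      using angle_bounds(2)[OF u x, of 0] angle_bounds(3)[OF u x pos, of 0] m pi_gt_zero by linarith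
  qed
  define \<theta> where "\<theta> = angle 0 u"
  \<comment> \<open>At x = 0 the sine of the angle is 1 / cosh b, so this is the value at 0 of the
    ratio of u^2 to sin \<theta>.\<close>
  define A where "A = (u 0)\<^sup>2 * cosh b"
  have \<theta>: "0 < \<theta> x" "\<theta> x < pi" if "x \<ge> 0" for x using ang that by (auto simp: \<theta>_def)
  have sin\<theta>: "sin (\<theta> x) > 0" if "x \<ge> 0" for x using \<theta>[OF that] by (rule sin_gt_zero)
  have D\<theta>: "(\<theta> has_real_derivative - kappa * (u x)\<^sup>2) (at x within {0..})" if "x \<ge> 0" for x
    unfolding \<theta>_def by (rule DERIV_angle[OF u that])
  have Du: "(u has_real_derivative - (kappa / 2 * cot (\<theta> x) * u x ^ 3)) (at x within {0..})" if "x \<ge> 0" for x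
    unfolding \<theta>_def by (rule equality_DERIV[OF u ang zero that])
  have b': "kappa * mass u = 2 * arctan (exp (- b))"
  proof -
    have "kappa * mass u > 0" using m(1) kappa(1) by simp
    then show ?thesis
      unfolding b using m(2) by (subst arctan_tan) linarith+
  qed
  have \<theta>0: "\<theta> 0 = 2 * arctan (exp (- b))" unfolding \<theta>_def using b' by simp
  \<comment> \<open>The equation for u and \<theta>' = - kappa u^2 give u^2 and sin \<theta> the
    same logarithmic derivative, - kappa cot(\<theta>) u^2.\<close>
  have ratio: "(u x)\<^sup>2 = A * sin (\<theta> x)" if "x \<ge> 0" for x
  proof -
    have "(\<lambda>x. (u x)\<^sup>2 / sin (\<theta> x)) x = (\<lambda>x. (u x)\<^sup>2 / sin (\<theta> x)) 0"
    proof (rule DERIV_zero_constant_half_line[OF _ that])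
      fix x :: real assume x: "x \<ge> 0"
      have "((\<lambda>x. (u x)\<^sup>2 / sin (\<theta> x)) has_real_derivative
          ((2 * u x * - (kappa / 2 * cot (\<theta> x) * u x ^ 3)) * sin (\<theta> x) - (u x)\<^sup>2 * (cos (\<theta> x) * (- kappa * (u x)\<^sup>2)))
            / (sin (\<theta> x) * sin (\<theta> x))) (at x within {0..})"
        using sin\<theta>[OF x] by (auto intro!: derivative_eq_intros D\<theta>[OF x] Du[OF x])
      moreover have "(2 * u x * - (kappa / 2 * cot (\<theta> x) * u x ^ 3)) * sin (\<theta> x) - (u x)\<^sup>2 * (cos (\<theta> x) * (- kappa * (u x)\<^sup>2)) = 0"
        using sin\<theta>[OF x] by (simp add: cot_def power2_eq_square power3_eq_cube)
      ultimately show "((\<lambda>x. (u x)\<^sup>2 / sin (\<theta> x)) has_real_derivative 0) (at x within {0..})"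
        by (simp only: div_0)
    qed
    then have "(u x)\<^sup>2 / sin (\<theta> x) = A"
      unfolding \<theta>0 double_arctan_exp A_def by simp
    then show ?thesis using sin\<theta>[OF that] by (simp add: field_simps)
  qed
  \<comment> \<open>With the ratio constant, \<theta>' = - kappa A sin \<theta>. The inverse
    Gudermannian substitution y = - ln tan(\<theta>/2) turns this into y' = kappa A.\<close>
  define y where "y = (\<lambda>x. - ln (tan (\<theta> x / 2)))"
  have t: "tan (\<theta> x / 2) > 0" "cos (\<theta> x / 2) > 0" "sin (\<theta> x / 2) > 0" if "x \<ge> 0" for x
    using \<theta>[OF that] by (auto intro!: tan_gt_zero cos_gt_zero sin_gt_zero)
  have yx: "y x = kappa * A * x + b" if "x \<ge> 0" for x
  proof -
    have "(\<lambda>x. y x - kappa * A * x) x = (\<lambda>x. y x - kappa * A * x) 0"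
    proof (rule DERIV_zero_constant_half_line[OF _ that])
      fix x :: real assume x: "x \<ge> 0"
      have "((\<lambda>x. y x - kappa * A * x) has_real_derivative
          - (1 / tan (\<theta> x / 2) * (inverse ((cos (\<theta> x / 2))\<^sup>2) * (- kappa * (u x)\<^sup>2 / 2))) - kappa * A) (at x within {0..})"
      proof -
        have "((\<lambda>x. tan (\<theta> x / 2)) has_real_derivative inverse ((cos (\<theta> x / 2))\<^sup>2) * (- kappa * (u x)\<^sup>2 / 2)) (at x within {0..})"
          by (rule DERIV_chain2[OF DERIV_tan DERIV_cdivide[OF D\<theta>[OF x]]]) (use t(2)[OF x] in simp)
        from DERIV_chain2[OF DERIV_ln_divide[OF t(1)[OF x]] this]
        have "((\<lambda>x. - ln (tan (\<theta> x / 2))) has_real_derivative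
            - (1 / tan (\<theta> x / 2) * (inverse ((cos (\<theta> x / 2))\<^sup>2) * (- kappa * (u x)\<^sup>2 / 2)))) (at x within {0..})"
          by (rule DERIV_minus)
        from DERIV_diff[OF this DERIV_cmult_Id[of "kappa * A"]] show ?thesis
          unfolding y_def .
      qed
      moreover have "1 / tan (\<theta> x / 2) * (inverse ((cos (\<theta> x / 2))\<^sup>2) * (- kappa * (u x)\<^sup>2 / 2)) = - (kappa * A)"
      proof -
        have "sin (\<theta> x) = 2 * sin (\<theta> x / 2) * cos (\<theta> x / 2)" using sin_double[of "\<theta> x / 2"] by simp
        then have u2: "(u x)\<^sup>2 = A * (2 * sin (\<theta> x / 2) * cos (\<theta> x / 2))" using ratio[OF x] by (simp only:)
        have "1 / (S / C) * (inverse (C\<^sup>2) * (- k * (A * (2 * S * C)) / 2)) = - (k * A)" if "S > 0" "C > 0" for S C k :: real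
          using that by (simp add: power2_eq_square divide_simps)
        from this[OF t(3,2)[OF x]] show ?thesis unfolding tan_def u2 .
      qed
      ultimately have "((\<lambda>x. y x - kappa * A * x) has_real_derivative - (- (kappa * A)) - kappa * A) (at x within {0..})"
        by (simp only:)
      then show "((\<lambda>x. y x - kappa * A * x) has_real_derivative 0) (at x within {0..})" by simp
    qed
    then have "y x = kappa * A * x + y 0" by simp
    moreover have "y 0 = b" unfolding y_def \<theta>0 by (simp add: tan_arctan)
    ultimately show ?thesis by simp
  qed
  have "exp (- y x) = tan (\<theta> x / 2)" using t(1)[OF x] by (simp add: y_def)
  then have "\<theta> x = 2 * arctan (exp (- y x))"
    using \<theta>[OF x] by (simp add: arctan_tan)
  then have "(u x)\<^sup>2 = A * (1 / cosh (y x))"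
    using ratio[OF x] by (simp only: double_arctan_exp)
  then have "(u x)\<^sup>2 = A / cosh (kappa * A * x + b)"
    by (simp add: yx[OF x])
  moreover have "u x \<ge> 0"
    using x pos nonneg_at_0_if_positive[OF H1_D(1)[OF u] pos]
    by (cases "x = 0") (auto simp: positive_on_half_line_def intro: less_imp_le)
  ultimately show ?thesis unfolding soliton_def A_def[symmetric] by (rule real_sqrt_unique[symmetric])
qed

section \<open>Bound states\<close>

lemma tanh_artanh:
  fixes x :: real
  assumes "\<bar>x\<bar> < 1"
  shows "tanh (artanh x) = x"
proof -
  have x: "- 1 < x" "x < 1" using assms by auto
  define z where "z = (1 + x) / (1 - x)"
  have z: "z > 0" unfolding z_def using x by simp
  have "artanh x = ln (sqrt z)" using z by (simp add: artanh_def ln_sqrt z_def)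
  then have "tanh (artanh x) = (z - 1) / (z + 1)" using z by (simp add: tanh_ln_real)
  also have "\<dots> = x" unfolding z_def using x by (simp add: field_simps)
  finally show ?thesis .
qed

lemma constant_integrable_Ioi:
  fixes C :: real
  assumes "set_integrable lborel {0<..} (\<lambda>x::real. C)"
  shows "C = 0"
proof -
  have "(\<lambda>n. LBINT x:{0<..real n}. C) \<longlonglongrightarrow> (LBINT x:{0::real<..}. C)"
    by (rule set_integral_Ioi_tendsto[OF assms filterlim_real_sequentially])
  then have "(\<lambda>n. real n * C) \<longlonglongrightarrow> (LBINT x:{0::real<..}. C)"
    by (simp add: set_lebesgue_integral_def)
  then have "(\<lambda>n. (real n * C) * (1 / real n)) \<longlonglongrightarrow> (LBINT x:{0::real<..}. C) * 0"
    by (intro tendsto_mult lim_1_over_n)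
  moreover have "\<forall>\<^sub>F n in sequentially. (real n * C) * (1 / real n) = C"
    using eventually_gt_at_top[of 0] by eventually_elim simp
  ultimately have "(\<lambda>n::nat. C) \<longlonglongrightarrow> 0"
    using tendsto_cong by fastforce
  then show ?thesis by (simp add: LIMSEQ_const_iff)
qed

lemma DERIV_zero_constant_Ioi:
  fixes f :: "real \<Rightarrow> real"
  assumes "\<And>x. x > 0 \<Longrightarrow> (f has_real_derivative 0) (at x)"
  shows "\<exists>c. \<forall>x>0. f x = c"
proof -
  have "(f has_real_derivative 0) (at x within {0<..})" if "x \<in> {0<..}" for x
    using assms that by (auto intro: has_field_derivative_at_within)
  then obtain c where "\<And>x. x \<in> {0<..} \<Longrightarrow> f x = c"
    using has_field_derivative_zero_constant[of "{0<..}" f] by auto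
  then show ?thesis by auto
qed

text \<open>The integration constant of the first integral vanishes because all other terms are integrable
  on the half-line.\<close>

lemma bound_state_first_integral:
  assumes u: "u \<in> H1" and D: "\<And>x. x > 0 \<Longrightarrow> (u has_real_derivative u1 x) (at x)"
    "\<And>x. x > 0 \<Longrightarrow> (u1 has_real_derivative w * u x - u x ^ 5) (at x)" and x: "x > 0"
  shows "(u1 x)\<^sup>2 = w * (u x)\<^sup>2 - u x ^ 6 / 3"
proof -
  define E where "E = (\<lambda>x. (u1 x)\<^sup>2 - w * (u x)\<^sup>2 + 1 / 3 * u x ^ 6)"
  have "(E has_real_derivative 0) (at x)" if "x > 0" for x
  proof -
    have "(E has_real_derivative 2 * u1 x * (w * u x - u x ^ 5) - w * (2 * u x * u1 x) + 1 / 3 * (6 * u x ^ 5 * u1 x)) (at x)"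
      unfolding E_def using D[OF that] by (auto intro!: derivative_eq_intros)
    moreover have "2 * u1 x * (w * u x - u x ^ 5) - w * (2 * u x * u1 x) + 1 / 3 * (6 * u x ^ 5 * u1 x) = 0"
      by (simp add: algebra_simps)
    ultimately show ?thesis by simp
  qed
  then obtain C where C: "\<And>x. x > 0 \<Longrightarrow> E x = C" using DERIV_zero_constant_Ioi by blast
  have "continuous_on {0<..} u1"
    using D(2) by (intro continuous_at_imp_continuous_on) (auto intro: DERIV_isCont)
  then have "square_integrable u1"
    using H1_D(5)[OF u] has_weak_deriv_classical[OF D(1)] by blast
  then have "set_integrable lborel {0<..} E"
    unfolding E_def using H1_D(2)[OF u]
    by (intro set_integral_add set_integral_diff set_integrable_mult_right H1_pow6_integrable[OF u])
      (auto simp: square_integrable_def)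
  then have "set_integrable lborel {0<..} (\<lambda>x::real. C)"
    by (rule set_integrable_cong[THEN iffD1, rotated -1]) (use C in auto)
  then have "C = 0" by (rule constant_integrable_Ioi)
  with C[OF x] show ?thesis by (simp add: E_def)
qed

text \<open>Let s^2 be the frequency and r = u'/u. The first integral reads r^2 = s^2 - u^4/3, which
  eliminates u from the equation for r and leaves r' = - 2 (s^2 - r^2), integrated by artanh. The
  same first integral then gives u^4 back from r.\<close>

lemma bound_state_is_soliton:
  assumes bs: "bound_state 6 \<alpha> u" and pos: "positive_on_half_line u"
  obtains s b where "s > 0" "\<alpha> = - s * tanh b" "\<And>x. x \<ge> 0 \<Longrightarrow> u x = soliton (sqrt 3 * s) b x"
proof -
  obtain w u1 u2 where u: "u \<in> H1" and w: "w > 0"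
    and D0: "\<forall>x\<ge>0. (u has_real_derivative u1 x) (at x within {0..})"
    and D2: "\<forall>x>0. (u1 has_real_derivative u2 x) (at x)"
    and ode: "\<forall>x>0. - u2 x - \<bar>u x\<bar> powr (6 - 2) * u x + w * u x = 0" and bc: "u1 0 = \<alpha> * u 0"
    using bs unfolding bound_state_def by blast
  have up: "u x > 0" if "x > 0" for x using pos that by (simp add: positive_on_half_line_def)
  have Du: "(u has_real_derivative u1 x) (at x)" if "x > 0" for x
  proof -
    have "at x within {0..} = at x" using that by (intro at_within_interior) simp
    then show ?thesis using D0 that by (metis less_imp_le)
  qed
  have Du1: "(u1 has_real_derivative w * u x - u x ^ 5) (at x)" if "x > 0" for x
  proof -
    have "\<bar>u x\<bar> powr (6 - 2) * u x = u x ^ 5"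
      using up[OF that] by (simp add: powr_numeral eval_nat_numeral)
    then have "u2 x = w * u x - u x ^ 5" using ode that by (smt (verit))
    then show ?thesis using D2 that by metis
  qed
  define s where "s = sqrt w"
  have s: "s > 0" "s\<^sup>2 = w" using w by (auto simp: s_def)
  define r where "r = (\<lambda>x. u1 x / u x)"
  have r2: "(r x)\<^sup>2 = s\<^sup>2 - u x ^ 4 / 3" if "x > 0" for x
  proof -
    have "(r x)\<^sup>2 = (w * (u x)\<^sup>2 - u x ^ 6 / 3) / (u x)\<^sup>2"
      unfolding r_def power_divide using bound_state_first_integral[OF u Du Du1 that] by simp
    also have "u x ^ 6 = u x ^ 4 * (u x)\<^sup>2" by (simp flip: power_add)
    also have "(w * (u x)\<^sup>2 - u x ^ 4 * (u x)\<^sup>2 / 3) / (u x)\<^sup>2 = w - u x ^ 4 / 3"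
    proof -
      have "w * (u x)\<^sup>2 - u x ^ 4 * (u x)\<^sup>2 / 3 = (w - u x ^ 4 / 3) * (u x)\<^sup>2" by (simp add: algebra_simps)
      then show ?thesis using up[OF that] by simp
    qed
    finally show ?thesis by (simp only: s(2))
  qed
  \<comment> \<open>Strictness comes from u > 0 and keeps the argument inside the domain of
    artanh.\<close>
  have rs: "\<bar>- (r x / s)\<bar> < 1" if "x > 0" for x
  proof -
    have "\<bar>r x\<bar>\<^sup>2 < s\<^sup>2" using r2[OF that] up[OF that] by simp
    then have "\<bar>r x\<bar> < s" by (rule power2_less_imp_less) (use s(1) in simp)
    then show ?thesis using s(1) by simp
  qed
  have Dr: "(r has_real_derivative - 2 * (s\<^sup>2 - (r x)\<^sup>2)) (at x)" if "x > 0" for x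
  proof -
    have nz: "u x \<noteq> 0" using up[OF that] by simp
    have D: "(r has_real_derivative ((w * u x - u x ^ 5) * u x - u1 x * u1 x) / (u x * u x)) (at x)"
      unfolding r_def by (rule DERIV_divide[OF Du1[OF that] Du[OF that] nz])
    have alg: "((w * p - p ^ 5) * p - q * q) / (p * p) = w - p ^ 4 - (q / p)\<^sup>2" if "p \<noteq> 0" for p q
    proof -
      have "p ^ 5 = p ^ 4 * p" by (simp flip: power_Suc2)
      then have "(w * p - p ^ 5) * p - q * q = (w - p ^ 4) * (p * p) - q * q"
        by (simp only: left_diff_distrib mult.assoc)
      then show ?thesis using that by (simp add: diff_divide_distrib power2_eq_square)
    qed
    have u4: "u x ^ 4 = 3 * (s\<^sup>2 - (r x)\<^sup>2)" using r2[OF that] by simp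
    have "w - u x ^ 4 - (r x)\<^sup>2 = - 2 * (s\<^sup>2 - (r x)\<^sup>2)"
      unfolding u4 s(2)[symmetric] by simp
    with alg[OF nz, of "u1 x"] have "((w * u x - u x ^ 5) * u x - u1 x * u1 x) / (u x * u x) = - 2 * (s\<^sup>2 - (r x)\<^sup>2)"
      unfolding r_def by (rule trans)
    from D[unfolded this] show ?thesis .
  qed
  have "((\<lambda>x. artanh (- (r x / s)) - 2 * s * x) has_real_derivative 0) (at x)" if "x > 0" for x
  proof -
    have D: "((\<lambda>x. - (r x / s)) has_real_derivative - (- 2 * (s\<^sup>2 - (r x)\<^sup>2) / s)) (at x)"
      by (rule DERIV_minus[OF DERIV_cdivide[OF Dr[OF that]]])
    have "((\<lambda>x. artanh (- (r x / s))) has_real_derivative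
        1 / (1 - (- (r x / s))\<^sup>2) * - (- 2 * (s\<^sup>2 - (r x)\<^sup>2) / s)) (at x)"
      by (rule DERIV_chain2[OF artanh_real_has_field_derivative[OF rs[OF that]] D])
    moreover have "1 / (1 - (- (r x / s))\<^sup>2) * - (- 2 * (s\<^sup>2 - (r x)\<^sup>2) / s) = 2 * s"
    proof -
      have pos: "s\<^sup>2 - (r x)\<^sup>2 > 0" using r2[OF that] up[OF that] by simp
      have "1 - (- (r x / s))\<^sup>2 = (s\<^sup>2 - (r x)\<^sup>2) / s\<^sup>2"
        using s(1) by (simp add: power_divide diff_divide_distrib)
      moreover have "1 / (d / s\<^sup>2) * - (- 2 * d / s) = 2 * s" if "d > 0" for d
        using that s(1) by (simp add: power2_eq_square)
      ultimately show ?thesis using pos by presburger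
    qed
    ultimately have "((\<lambda>x. artanh (- (r x / s))) has_real_derivative 2 * s) (at x)" by (simp only:)
    from DERIV_diff[OF this DERIV_cmult_Id[of "2 * s"]] show ?thesis by simp
  qed
  then obtain b where b: "\<And>x. x > 0 \<Longrightarrow> artanh (- (r x / s)) - 2 * s * x = b"
    using DERIV_zero_constant_Ioi[of "\<lambda>x. artanh (- (r x / s)) - 2 * s * x"] by blast
  \<comment> \<open>The amplitude A = sqrt 3 s is forced by A^2/3 = s^2, and the rate kappa A is
    then 2 s.\<close>
  have A: "sqrt 3 * s > 0" "kappa * (sqrt 3 * s) = 2 * s" using s(1) by (auto simp: kappa_def)
  have sol: "u x = soliton (sqrt 3 * s) b x" if "x > 0" for x
  proof -
    let ?y = "2 * s * x + b"
    have "artanh (- (r x / s)) = ?y" using b[OF that] by simp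
    then have "- (r x / s) = tanh ?y" using tanh_artanh[OF rs[OF that]] by simp
    then have "tanh ?y * s = - (r x / s) * s" by (simp only:)
    also have "\<dots> = - r x" using s(1) by simp
    finally have "(- r x)\<^sup>2 = (tanh ?y * s)\<^sup>2" by (simp only:)
    then have rT: "(r x)\<^sup>2 = (tanh ?y)\<^sup>2 * s\<^sup>2" by (simp only: power2_minus power_mult_distrib)
    have "u x ^ 4 = 3 * (s\<^sup>2 - (r x)\<^sup>2)" using r2[OF that] by simp
    also have "\<dots> = 3 * s\<^sup>2 * (1 - (tanh ?y)\<^sup>2)" unfolding rT by (simp add: algebra_simps)
    finally have "u x ^ 4 = 3 * s\<^sup>2 * (1 / (cosh ?y)\<^sup>2)" by (simp only: one_minus_tanh_sq)
    moreover have "((u x)\<^sup>2)\<^sup>2 = u x ^ 4" by (simp flip: power_mult)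
    moreover have "(sqrt 3 * s / cosh ?y)\<^sup>2 = 3 * s\<^sup>2 * (1 / (cosh ?y)\<^sup>2)"
      by (simp add: power_divide power_mult_distrib)
    ultimately have sq: "((u x)\<^sup>2)\<^sup>2 = (sqrt 3 * s / cosh ?y)\<^sup>2" by (simp only:)
    have "(u x)\<^sup>2 = sqrt 3 * s / cosh ?y"
      by (rule power2_eq_imp_eq[OF sq]) (use s(1) in auto)
    from real_sqrt_unique[OF this less_imp_le[OF up[OF that]]] show ?thesis
      unfolding soliton_def A(2) by (rule sym)
  qed
  \<comment> \<open>The differential equation holds only for x > 0; the value at 0 is carried over
    by continuity of both sides.\<close>
  have sol0: "u 0 = soliton (sqrt 3 * s) b 0"
  proof (rule tendsto_unique[of "at_right (0::real)"])
    have lim: "(f \<longlongrightarrow> f 0) (at_right 0)" if "continuous_on {0..} f" for f :: "real \<Rightarrow> real"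
    proof (rule tendsto_within_subset)
      show "(f \<longlongrightarrow> f 0) (at 0 within {0..})" using that by (auto simp: continuous_on_def)
    qed auto
    show "(u \<longlongrightarrow> u 0) (at_right 0)" by (rule lim[OF H1_D(1)[OF u]])
    have "(soliton (sqrt 3 * s) b \<longlongrightarrow> soliton (sqrt 3 * s) b 0) (at_right 0)"
      by (rule lim[OF continuous_soliton[OF A(1)]])
    moreover have "\<forall>\<^sub>F x in at_right 0. soliton (sqrt 3 * s) b x = u x"
      using eventually_at_right_less[of "0::real"] by eventually_elim (rule sol[symmetric])
    ultimately show "(u \<longlongrightarrow> soliton (sqrt 3 * s) b 0) (at_right 0)"
      by (rule Lim_transform_eventually)
  qed simp
  have all: "u x = soliton (sqrt 3 * s) b x" if "x \<ge> 0" for x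
    using sol sol0 that by (cases "x = 0") auto
  have "\<alpha> = - s * tanh b"
  proof -
    have "(soliton (sqrt 3 * s) b has_real_derivative soliton_deriv (sqrt 3 * s) b 0) (at 0 within {0..})"
      by (rule has_field_derivative_at_within[OF DERIV_soliton[OF A(1)]])
    then have "(u has_real_derivative soliton_deriv (sqrt 3 * s) b 0) (at 0 within {0..})"
    proof (rule has_field_derivative_transform_within[of _ _ _ _ 1])
      show "soliton (sqrt 3 * s) b y = u y" if "y \<in> {0..}" for y
        using all[of y] that by simp
    qed auto
    moreover have "(u has_real_derivative u1 0) (at 0 within {0..})" using D0 by simp
    \<comment> \<open>Both derivatives are one-sided at 0, where the limit of the difference
      quotient is unique, so the boundary condition passes to the soliton.\<close>
    ultimately have "soliton_deriv (sqrt 3 * s) b 0 = u1 0"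
      unfolding has_field_derivative_iff at_within_Ici_at_right
      by (rule tendsto_unique[OF trivial_limit_at_right_real])
    then have "\<alpha> * soliton (sqrt 3 * s) b 0 = - s * tanh b * soliton (sqrt 3 * s) b 0"
      unfolding soliton_deriv_def bc sol0 A(2) by simp
    moreover have "soliton (sqrt 3 * s) b 0 \<noteq> 0" using soliton_pos[OF A(1), of b 0] by simp
    ultimately show ?thesis by (simp only: mult_cancel_right) simp
  qed
  from that[OF s(1) this all] show thesis .
qed

text \<open>The frequency is s^2 = A^2/3 for A = sqrt 3 s, and the logarithmic derivative of the
  profile at 0 is - s tanh b.\<close>

lemma soliton_bound_state:
  assumes s: "s > 0" and \<alpha>: "\<alpha> = - s * tanh b"
  shows "bound_state 6 \<alpha> (soliton (sqrt 3 * s) b)"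
proof -
  have A: "sqrt 3 * s > 0" "kappa * (sqrt 3 * s) = 2 * s" "(sqrt 3 * s)\<^sup>2 / 3 = s\<^sup>2"
    using s by (auto simp: kappa_def power_mult_distrib)
  let ?U = "soliton (sqrt 3 * s) b"
  have "\<bar>?U x\<bar> powr (6 - 2) * ?U x = ?U x ^ 5" for x
    using soliton_pos[OF A(1), of b x] by (simp add: powr_numeral eval_nat_numeral)
  then have ode: "- ((sqrt 3 * s)\<^sup>2 / 3 * ?U x - ?U x ^ 5) - \<bar>?U x\<bar> powr (6 - 2) * ?U x + s\<^sup>2 * ?U x = 0" for x
    unfolding A(3) by simp
  have bc: "soliton_deriv (sqrt 3 * s) b 0 = \<alpha> * ?U 0"
    unfolding soliton_deriv_def \<alpha> A(2) by simp
  have D: "(?U has_real_derivative soliton_deriv (sqrt 3 * s) b x) (at x within {0..})" for x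
    by (rule has_field_derivative_at_within[OF DERIV_soliton[OF A(1)]])
  have "?U \<in> H1" using scaled_soliton(1)[OF A(1), of 1 b] by simp
  moreover have "s\<^sup>2 > 0" using s by simp
  ultimately show ?thesis
    unfolding bound_state_def
  proof (intro conjI exI)
    show "\<forall>x\<ge>0. (?U has_real_derivative soliton_deriv (sqrt 3 * s) b x) (at x within {0..})"
      using D by simp
    show "\<forall>x>0. (soliton_deriv (sqrt 3 * s) b has_real_derivative (sqrt 3 * s)\<^sup>2 / 3 * ?U x - ?U x ^ 5) (at x)"
      using DERIV_soliton2[OF A(1), of b] by simp
    show "\<forall>x>0. - ((sqrt 3 * s)\<^sup>2 / 3 * ?U x - ?U x ^ 5) - \<bar>?U x\<bar> powr (6 - 2) * ?U x + s\<^sup>2 * ?U x = 0"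
      using ode by simp
  qed (use bc in auto)
qed

section \<open>Ground states\<close>

lemma kappa_critical_mass: "kappa * (sqrt 3 * pi / 4) = pi / 2" "2 / kappa = sqrt 3"
  by (simp_all add: kappa_def)

lemma mass_cong:
  assumes "\<And>x. x > 0 \<Longrightarrow> u x = v x"
  shows "mass u = mass v"
  unfolding mass_def set_lebesgue_integral_def
  by (intro Bochner_Integration.integral_cong) (auto simp: indicator_def assms)

text \<open>The half soliton has the critical mass; its energy \<open>\<alpha> A / 2\<close> is unbounded below, and
  multiplication by a factor at least \<open>1\<close> only lowers it further.\<close>

lemma energy_inf_supercritical:
  assumes "\<alpha> < 0" "\<mu> \<ge> sqrt 3 * pi / 4"
  shows "energy_inf 6 \<alpha> \<mu> = - \<infinity>"
proof (rule ereal_bot)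
  fix B :: real
  define c where "c = sqrt 3 * pi / 4"
  have c: "c > 0" by (simp add: c_def)
  \<comment> \<open>The half soliton has mass c, so scaling by r gives mass \<mu>; the assumption on
    \<mu> says r^2 \<ge> 1.\<close>
  define r where "r = sqrt (\<mu> / c)"
  have r: "r\<^sup>2 = \<mu> / c" "r\<^sup>2 \<ge> 1"
    using c assms(2) by (simp_all add: r_def c_def[symmetric])
  \<comment> \<open>Solves r^2 \<alpha> A / 2 = r^2 \<alpha> / 2 - |B|; the summand 1 keeps A
    positive when B = 0.\<close>
  define A where "A = 1 + 2 * \<bar>B\<bar> / (r\<^sup>2 * - \<alpha>)"
  have "2 * \<bar>B\<bar> / (r\<^sup>2 * - \<alpha>) \<ge> 0" using r(2) assms(1) by (intro divide_nonneg_pos mult_pos_pos) auto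
  then have A: "A > 0" by (simp add: A_def)
  define u where "u = (\<lambda>x. r * soliton A 0 x)"
  have "mass u = \<mu>"
    using scaled_soliton(2)[OF A, of r 0] r(1) c unfolding u_def kappa_critical_mass by (simp add: arctan_one c_def)
  then have u: "u \<in> H1_mass \<mu>"
    using scaled_soliton(1)[OF A] by (simp add: H1_mass_def u_def)
  have "energy 6 \<alpha> u \<le> r\<^sup>2 * (\<alpha> / 2 * A)"
    using scaled_soliton(3)[OF A r(2), of \<alpha> 0] by (simp add: u_def)
  also have "\<dots> = r\<^sup>2 * \<alpha> / 2 - \<bar>B\<bar>"
  proof -
    have "r \<noteq> 0" using r(2) by auto
    then show ?thesis using assms(1) by (simp add: A_def field_simps)
  qed
  also have "\<dots> \<le> B"
  proof -
    have "r\<^sup>2 * \<alpha> \<le> 0" using r(2) assms(1) by (intro mult_nonneg_nonpos) auto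
    then show ?thesis by linarith
  qed
  finally have "energy 6 \<alpha> u \<le> B" .
  then show "energy_inf 6 \<alpha> \<mu> \<le> ereal B"
    unfolding energy_inf_def by (intro INF_lower2[OF u]) simp
qed

section \<open>Subcritical masses: the minimum, its attainment and uniqueness\<close>

context
  fixes \<alpha> \<mu> b s A :: real
  assumes \<alpha>: "\<alpha> < 0" and b: "b > 0" and s: "s > 0" "\<alpha> = - s * tanh b"
    and \<mu>: "kappa * \<mu> = 2 * arctan (exp (- b))" and A_def: "A = sqrt 3 * s"
begin

private lemma A: "A > 0" "kappa * A = 2 * s"
  using s by (simp_all add: A_def kappa_def)

private lemma mu_bounds: "0 < \<mu>" "kappa * \<mu> < pi / 2"
proof -
  have "arctan (exp (- b)) < arctan 1" using b by (intro arctan_monotone) simp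
  then show "kappa * \<mu> < pi / 2" unfolding \<mu> by (simp add: arctan_one)
  have "arctan (exp (- b)) > 0" by simp
  then have "kappa * \<mu> > 0" unfolding \<mu> by simp
  then show "0 < \<mu>" using kappa(1) by (simp add: zero_less_mult_iff)
qed

text \<open>Brings the boundary coefficient into the form that completes a square with the quartic
  term; w stands for u(0)^2 or for its value on the soliton.\<close>

private lemma alpha_eq: "\<alpha> / 2 * w = - (kappa / 4 * sinh b * (A / cosh b)) * w"
proof -
  have "s = kappa * A / 2" using A(2) by simp
  then have "\<alpha> = - (kappa * A / 2) * (sinh b / cosh b)" using s(2) unfolding tanh_def by (simp only:)
  then show ?thesis by simp
qed

private lemma sinh_pos: "sinh b > 0"
  using b by simp

lemma soliton_in_H1_mass: "soliton A b \<in> H1_mass \<mu>"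
proof -
  have "mass (soliton A b) = 2 / kappa * arctan (exp (- b))"
    using scaled_soliton(2)[OF A(1), of 1 b] by simp
  also have "\<dots> = \<mu>" using \<mu> kappa(1) by (simp add: field_simps)
  finally show ?thesis using scaled_soliton(1)[OF A(1), of 1 b] by (simp add: H1_mass_def)
qed

lemma soliton_energy: "energy 6 \<alpha> (soliton A b) = - (kappa / 8 * sinh b * (A / cosh b)\<^sup>2)"
proof -
  have "energy 6 \<alpha> (soliton A b) = kappa / 8 * sinh b * (A / cosh b)\<^sup>2 + \<alpha> / 2 * (A / cosh b)"
    unfolding scaled_soliton(4)[OF A(1)] by (simp add: power_divide)
  also have "\<dots> = - (kappa / 8 * sinh b * (A / cosh b)\<^sup>2)"
    unfolding alpha_eq by (simp add: power2_eq_square)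
  finally show ?thesis .
qed

text \<open>Since cot(kappa \<mu>) = sinh b > 0, the boundary terms form an upward parabola in
  u(0)^2. Its vertex is A / cosh b, the square of the soliton at 0, and its minimum is the energy of
  the soliton.\<close>

lemma energy_quadratic_bound:
  assumes "u \<in> H1_mass \<mu>"
  shows "energy 6 \<alpha> u \<ge> energy 6 \<alpha> (soliton A b) + kappa / 8 * sinh b * ((u 0)\<^sup>2 - A / cosh b)\<^sup>2"
proof -
  have u: "u \<in> H1" "mass u = \<mu>" using assms by (auto simp: H1_mass_def)
  have "energy 6 \<alpha> u \<ge> kappa / 8 * sinh b * u 0 ^ 4 + \<alpha> / 2 * (u 0)\<^sup>2"
    using energy_calibrated_bound[OF u(1), of \<alpha>] mu_bounds unfolding u(2) \<mu> double_arctan_exp by simp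
  moreover have "kappa / 8 * sinh b * u 0 ^ 4 + \<alpha> / 2 * (u 0)\<^sup>2
      = energy 6 \<alpha> (soliton A b) + kappa / 8 * sinh b * ((u 0)\<^sup>2 - A / cosh b)\<^sup>2"
    unfolding soliton_energy alpha_eq power2_diff by (simp add: power2_eq_square power4_eq_xxxx algebra_simps)
  ultimately show ?thesis by simp
qed

lemma energy_inf_eq: "energy_inf 6 \<alpha> \<mu> = ereal (energy 6 \<alpha> (soliton A b))"
  unfolding energy_inf_def
proof (rule INF_eqI)
  fix u assume "u \<in> H1_mass \<mu>"
  moreover have "kappa / 8 * sinh b * ((u 0)\<^sup>2 - A / cosh b)\<^sup>2 \<ge> 0"
    using kappa(1) sinh_pos by simp
  ultimately show "ereal (energy 6 \<alpha> (soliton A b)) \<le> ereal (energy 6 \<alpha> u)"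
    using energy_quadratic_bound by fastforce
qed (use soliton_in_H1_mass in blast)

lemma soliton_ground_state: "ground_state 6 \<alpha> \<mu> (soliton A b)"
  unfolding ground_state_def energy_inf_eq using soliton_in_H1_mass by simp

text \<open>Minimality turns both estimates into equalities. The parabola fixes v(0)^2 = A / cosh b,
  and the vanishing calibration square makes v a soliton with parameter b and amplitude v(0)^2 cosh
  b = A.\<close>

lemma ground_state_unique:
  assumes gs: "ground_state 6 \<alpha> \<mu> v" and pos: "positive_on_half_line v" and x: "x \<ge> 0"
  shows "v x = soliton A b x"
proof -
  have v: "v \<in> H1_mass \<mu>" "energy 6 \<alpha> v = energy 6 \<alpha> (soliton A b)"
    using gs unfolding ground_state_def energy_inf_eq by auto
  then have v': "v \<in> H1" "mass v = \<mu>" by (auto simp: H1_mass_def)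
  have "kappa / 8 * sinh b * ((v 0)\<^sup>2 - A / cosh b)\<^sup>2 \<le> 0"
    using energy_quadratic_bound[OF v(1)] v(2) by simp
  then have "((v 0)\<^sup>2 - A / cosh b)\<^sup>2 \<le> 0"
    using kappa(1) sinh_pos by (simp add: mult_le_0_iff)
  then have v0: "(v 0)\<^sup>2 = A / cosh b" by simp
  have "energy 6 \<alpha> v = kappa / 8 * sinh b * v 0 ^ 4 + \<alpha> / 2 * (v 0)\<^sup>2"
  proof -
    have "v 0 ^ 4 = (A / cosh b)\<^sup>2" unfolding v0[symmetric] by (simp flip: power_mult)
    then show ?thesis unfolding v(2) soliton_energy alpha_eq v0 by (simp add: power2_eq_square)
  qed
  then have "energy 6 \<alpha> v = kappa / 8 * cot (kappa * mass v) * v 0 ^ 4 + \<alpha> / 2 * (v 0)\<^sup>2"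
    unfolding v'(2) \<mu> double_arctan_exp .
  note zero = energy_calibrated_equality[OF v'(1) _ _ pos this, unfolded v'(2), OF mu_bounds]
  have "exp (- b) = tan (kappa * mass v / 2)"
    unfolding v'(2) \<mu> by (simp add: tan_arctan)
  from equality_imp_soliton[OF v'(1) _ _ pos zero this x, unfolded v'(2), OF mu_bounds]
  have "v x = soliton ((v 0)\<^sup>2 * cosh b) b x" .
  then show ?thesis unfolding v0 by simp
qed

text \<open>The mass determines b, because arctan and exp are injective; then \<alpha> = - s tanh b
  determines s, because tanh b is nonzero.\<close>

lemma bound_state_unique:
  assumes bs: "bound_state 6 \<alpha> v" and pos: "positive_on_half_line v" and m: "mass v = \<mu>" and x: "x \<ge> 0"
  shows "v x = soliton A b x"
proof -
  obtain s' b' where s': "s' > 0" "\<alpha> = - s' * tanh b'"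
    and v: "\<And>x. x \<ge> 0 \<Longrightarrow> v x = soliton (sqrt 3 * s') b' x"
    using bound_state_is_soliton[OF bs pos] by metis
  have "sqrt 3 * s' > 0" using s'(1) by simp
  from scaled_soliton(2)[OF this, of 1 b']
  have "mass (soliton (sqrt 3 * s') b') = 2 / kappa * arctan (exp (- b'))" by simp
  moreover have "mass (soliton (sqrt 3 * s') b') = \<mu>"
    using mass_cong[of v "soliton (sqrt 3 * s') b'"] v m by simp
  ultimately have "kappa * \<mu> = 2 * arctan (exp (- b'))" using kappa(1) by (simp add: field_simps)
  then have "b' = b" unfolding \<mu> by (simp add: arctan_eq_iff)
  moreover have "tanh b \<noteq> 0" using b by simp
  ultimately have "s' = s" using s(2) s'(2) by simp
  with v[OF x] \<open>b' = b\<close> show ?thesis by (simp add: A_def)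
qed

end

text \<open>The mass condition reads exp(- b) = tan(kappa \<mu> / 2). Subcriticality means kappa
  \<mu> / 2 < pi / 4, so the tangent is below 1 and b > 0; then s = - \<alpha> / tanh b is positive
  because \<alpha> < 0.\<close>

lemma subcritical_parameters:
  assumes "\<alpha> < 0" "0 < \<mu>" "\<mu> < sqrt 3 * pi / 4"
  obtains b s where "b > 0" "s > 0" "\<alpha> = - s * tanh b" "kappa * \<mu> = 2 * arctan (exp (- b))"
proof -
  have th: "0 < kappa * \<mu> / 2" "kappa * \<mu> / 2 < pi / 4"
    using assms(2) mult_strict_left_mono[OF assms(3) kappa(1)] kappa(1) unfolding kappa_critical_mass by auto
  define t where "t = tan (kappa * \<mu> / 2)"
  have t: "0 < t" "t < 1"
  proof -
    show "0 < t" unfolding t_def using th by (intro tan_gt_zero) auto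
    have "t < tan (pi / 4)" unfolding t_def using th by (intro tan_monotone) auto
    then show "t < 1" by (simp add: tan_45)
  qed
  define b where "b = - ln t"
  have b: "b > 0" using t by (simp add: b_def)
  have "arctan (exp (- b)) = kappa * \<mu> / 2"
    using t(1) th unfolding b_def by (simp add: t_def arctan_tan)
  then have "kappa * \<mu> = 2 * arctan (exp (- b))" by simp
  moreover have "tanh b > 0" using b by simp
  then have "- \<alpha> / tanh b > 0" "\<alpha> = - (- \<alpha> / tanh b) * tanh b" using assms(1) by (simp_all add: divide_neg_pos)
  ultimately show thesis using that[OF b] by blast
qed

theorem theorem1p5:
  fixes \<alpha> \<mu> p :: real
  assumes "p = 6" and "\<alpha> < 0" and "\<mu> > 0"
  shows "(\<mu> < sqrt 3 * pi / 4 \<longrightarrow> (\<exists>c::real. c > 0 \<and> energy_inf p \<alpha> \<mu> = ereal (- c))) \<and>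
    (\<mu> \<ge> sqrt 3 * pi / 4 \<longrightarrow> energy_inf p \<alpha> \<mu> = - \<infinity>) \<and>
    (\<mu> < sqrt 3 * pi / 4 \<longrightarrow>
      (\<exists>u. ground_state p \<alpha> \<mu> u \<and> positive_on_half_line u \<and>
        bound_state p \<alpha> u \<and> mass u = \<mu> \<and>
        (\<forall>v. ground_state p \<alpha> \<mu> v \<and> positive_on_half_line v \<longrightarrow> (\<forall>x\<ge>0. v x = u x)) \<and>
        (\<forall>v. bound_state p \<alpha> v \<and> positive_on_half_line v \<and> mass v = \<mu> \<longrightarrow>
             (\<forall>x\<ge>0. v x = u x))))"
proof (cases "\<mu> < sqrt 3 * pi / 4")
  case False
  then show ?thesis using energy_inf_supercritical[OF assms(2)] assms(1) by simp
next
  case True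
  obtain b s where bs: "b > 0" "s > 0" "\<alpha> = - s * tanh b" "kappa * \<mu> = 2 * arctan (exp (- b))"
    using subcritical_parameters[OF assms(2,3) True] by metis
  \<comment> \<open>The reflexivity instance discharges the assumption that names the amplitude and
    so instantiates \<open>A\<close> with \<open>sqrt 3 * s\<close>.\<close>
  note params = assms(2) bs refl[of "sqrt 3 * s"]
  let ?U = "soliton (sqrt 3 * s) b"
  \<comment> \<open>Minus the energy of the soliton; it is positive because b > 0.\<close>
  let ?c = "kappa / 8 * sinh b * (sqrt 3 * s / cosh b)\<^sup>2"
  have "?c > 0" using kappa(1) bs(1,2) by (intro mult_pos_pos zero_less_power divide_pos_pos) auto
  moreover have "energy_inf p \<alpha> \<mu> = ereal (- ?c)"
    unfolding assms(1) energy_inf_eq[OF params] soliton_energy[OF params] ..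
  moreover have "ground_state p \<alpha> \<mu> ?U"
    unfolding assms(1) by (rule soliton_ground_state[OF params])
  moreover have "positive_on_half_line ?U"
    unfolding positive_on_half_line_def using soliton_pos bs(2) by simp
  moreover have "bound_state p \<alpha> ?U"
    unfolding assms(1) by (rule soliton_bound_state[OF bs(2,3)])
  moreover have "mass ?U = \<mu>"
    using soliton_in_H1_mass[OF params] by (simp add: H1_mass_def)
  moreover have "\<forall>v. ground_state p \<alpha> \<mu> v \<and> positive_on_half_line v \<longrightarrow> (\<forall>x\<ge>0. v x = ?U x)"
    unfolding assms(1) using ground_state_unique[OF params] by blast
  moreover have "\<forall>v. bound_state p \<alpha> v \<and> positive_on_half_line v \<and> mass v = \<mu> \<longrightarrow> (\<forall>x\<ge>0. v x = ?U x)"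
    unfolding assms(1) using bound_state_unique[OF params] by blast
  ultimately show ?thesis using True by (metis not_le)
qed

end
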